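(* Let $F:(M,g,J)\to(N,g')$ be a conformal anti-invariant submersion with dilation $\lambda$ from a Kähler manifold $(M,g,J)$ to a Riemannian manifold $(N,g')$. Then the following assertions are equivalent: (a) the distribution $(\ker F_* )^\perp$ is integrable; (b) for all $X,Y\in\Gamma((\ker F_* )^\perp)$ and $V\in\Gamma(\ker F_* )$, $$\frac{1}{\lambda^2}g'\big(\nabla^F_YF_*CX-\nabla^F_XF_*CY,\,F_*JV\big)=g(A_XBY-A_YBX,JV)-g(\mathcal H\operatorname{grad}\ln\lambda,CY)\,g(X,JV)+g(\mathcal H\operatorname{grad}\ln\lambda,CX)\,g(Y,JV)-2g(CX,Y)\,g(\mathcal H\operatorname{grad}\ln\lambda,JV).$$
   Context: A Kähler manifold $(M,g,J)$ is a Riemannian manifold with a $(1,1)$-tensor field $J$ such that $J^2=-I$, $g(JX,JY)=g(X,Y)$ and $\nabla J=0$, where $\nabla$ is the Levi-Civita connection of $g$. A smooth submersion $F:(M,g)\to(N,g')$ is horizontally conformal with dilation $\lambda:M\to(0,\infty)$ if $g'(F_*X,F_*Y)=\lambda^2g(X,Y)$ for all $X,Y\in\Gamma((\ker F_* )^\perp)$. It is a conformal anti-invariant submersion if moreover $J(\ker F_* )\subseteq(\ker F_* )^\perp$. Sections of $\ker F_*$ are vertical, sections of $(\ker F_* )^\perp$ are horizontal; $\mathcal V,\mathcal H$ are the orthogonal projections onto the vertical and horizontal distributions. Let $\mu$ be the orthogonal complement of $J(\ker F_* )$ in $(\ker F_* )^\perp$ (it is $J$-invariant). For horizontal $X$ write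 $JX=BX+CX$ with $BX\in\Gamma(\ker F_* )$ and $CX\in\Gamma(\mu)$. O'Neill's tensor $A$ is $A_EG=\mathcal V\nabla_{\mathcal HE}\mathcal HG+\mathcal H\nabla_{\mathcal HE}\mathcal VG$ for vector fields $E,G$ on $M$. $\nabla^F$ denotes the pullback to $F^{-1}TN$ of the Levi-Civita connection of $N$. *)

theory Defs
  imports "HOL-Analysis.Analysis" "HOL-Library.Function_Algebras"
begin

section \<open>Pointwise vector space structure on functions\<close>

instantiation "fun" :: (type, real_vector) real_vector
begin

definition scaleR_fun :: "real \<Rightarrow> ('a \<Rightarrow> 'b) \<Rightarrow> 'a \<Rightarrow> 'b"
  where "scaleR_fun c f = (\<lambda>x. c *\<^sub>R f x)"

instance
  by standard (simp_all add: scaleR_fun_def fun_eq_iff scaleR_add_right scaleR_add_left)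

end


section \<open>Smooth manifolds\<close>

text \<open>\<open>C\<^sup>k\<close> and \<open>C\<^sup>\<infinity>\<close> maps on an open subset of a Euclidean space.\<close>

primrec Ck_on :: "nat \<Rightarrow> 'a::euclidean_space set \<Rightarrow> ('a \<Rightarrow> 'b::real_normed_vector) \<Rightarrow> bool" where
  "Ck_on 0 S f \<longleftrightarrow> continuous_on S f"
| "Ck_on (Suc k) S f \<longleftrightarrow>
     (\<forall>x\<in>S. f differentiable (at x)) \<and> (\<forall>v. Ck_on k S (\<lambda>x. frechet_derivative f (at x) v))"

definition smooth_on :: "'a::euclidean_space set \<Rightarrow> ('a \<Rightarrow> 'b::real_normed_vector) \<Rightarrow> bool" where
  "smooth_on S f \<longleftrightarrow> (\<forall>k. Ck_on k S f)"

text \<open>The points of a manifold form a type \<open>'m\<close>, which carries the topology; the model space is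
  the Euclidean space \<open>'e\<close>. An atlas need not be maximal.\<close>

type_synonym ('m, 'e) chart = "'m set \<times> ('m \<Rightarrow> 'e)"
type_synonym ('m, 'e) atlas = "('m, 'e) chart set"

definition is_chart :: "('m::topological_space, 'e::euclidean_space) chart \<Rightarrow> bool" where
  "is_chart = (\<lambda>(U, \<phi>). open U \<and> open (\<phi> ` U) \<and> (\<exists>\<psi>. homeomorphism U (\<phi> ` U) \<phi> \<psi>))"

definition smooth_manifold ::
  "('m::{t2_space, second_countable_topology}, 'e::euclidean_space) atlas \<Rightarrow> bool" where
  "smooth_manifold A \<longleftrightarrow>
     (\<forall>c\<in>A. is_chart c) \<and> (\<Union>c\<in>A. fst c) = UNIV \<and>
     (\<forall>(U, \<phi>)\<in>A. \<forall>(V, \<psi>)\<in>A. smooth_on (\<phi> ` (U \<inter> V)) (\<psi> \<circ> inv_into U \<phi>))"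

definition smooth_fun ::
  "('m::topological_space, 'e::euclidean_space) atlas \<Rightarrow> ('m \<Rightarrow> real) \<Rightarrow> bool" where
  "smooth_fun A f \<longleftrightarrow> (\<forall>(U, \<phi>)\<in>A. smooth_on (\<phi> ` U) (f \<circ> inv_into U \<phi>))"

definition smooth_map ::
  "('m::topological_space, 'e::euclidean_space) atlas \<Rightarrow>
   ('n::topological_space, 'f::euclidean_space) atlas \<Rightarrow> ('m \<Rightarrow> 'n) \<Rightarrow> bool" where
  "smooth_map A B F \<longleftrightarrow> continuous_on UNIV F \<and>
     (\<forall>(U, \<phi>)\<in>A. \<forall>(V, \<psi>)\<in>B. smooth_on (\<phi> ` (U \<inter> F -` V)) (\<psi> \<circ> F \<circ> inv_into U \<phi>))"


section \<open>Tangent vectors and vector fields\<close>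

text \<open>A tangent vector at \<open>p\<close> is a derivation at \<open>p\<close> of the algebra of globally defined smooth
  functions. Its value on non-smooth functions is fixed to \<open>0\<close>, so that derivations which agree on
  smooth functions are equal as HOL functions.\<close>

type_synonym 'm tvec = "('m \<Rightarrow> real) \<Rightarrow> real"

definition tangent_space ::
  "('m::topological_space, 'e::euclidean_space) atlas \<Rightarrow> 'm \<Rightarrow> 'm tvec set" where
  "tangent_space A p = {v.
     (\<forall>f h. smooth_fun A f \<longrightarrow> smooth_fun A h \<longrightarrow> v (\<lambda>q. f q + h q) = v f + v h) \<and>
     (\<forall>c f. smooth_fun A f \<longrightarrow> v (\<lambda>q. c * f q) = c * v f) \<and>
     (\<forall>f h. smooth_fun A f \<longrightarrow> smooth_fun A h \<longrightarrow> v (\<lambda>q. f q * h q) = v f * h p + f p * v h) \<and>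
     (\<forall>f. \<not> smooth_fun A f \<longrightarrow> v f = 0)}"

definition pushforward ::
  "('n::topological_space, 'f::euclidean_space) atlas \<Rightarrow> ('m \<Rightarrow> 'n) \<Rightarrow> 'm tvec \<Rightarrow> 'n tvec" where
  "pushforward B F v = (\<lambda>h. if smooth_fun B h then v (h \<circ> F) else 0)"

definition vector_field ::
  "('m::topological_space, 'e::euclidean_space) atlas \<Rightarrow> ('m \<Rightarrow> 'm tvec) \<Rightarrow> bool" where
  "vector_field A X \<longleftrightarrow> (\<forall>p. X p \<in> tangent_space A p) \<and>
     (\<forall>f. smooth_fun A f \<longrightarrow> smooth_fun A (\<lambda>p. X p f))"

definition section_of ::
  "('m::topological_space, 'e::euclidean_space) atlas \<Rightarrow> ('m \<Rightarrow> 'm tvec set) \<Rightarrow>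
   ('m \<Rightarrow> 'm tvec) \<Rightarrow> bool" where
  "section_of A D X \<longleftrightarrow> vector_field A X \<and> (\<forall>p. X p \<in> D p)"

text \<open>Sections of the pullback bundle \<open>F\<^sup>-\<^sup>1TN\<close>, that is, vector fields along \<open>F\<close>.\<close>

definition section_along ::
  "('m::topological_space, 'e::euclidean_space) atlas \<Rightarrow>
   ('n::topological_space, 'f::euclidean_space) atlas \<Rightarrow> ('m \<Rightarrow> 'n) \<Rightarrow> ('m \<Rightarrow> 'n tvec) \<Rightarrow> bool" where
  "section_along A B F s \<longleftrightarrow> (\<forall>p. s p \<in> tangent_space B (F p)) \<and>
     (\<forall>h. smooth_fun B h \<longrightarrow> smooth_fun A (\<lambda>p. s p h))"

definition push_field ::
  "('n::topological_space, 'f::euclidean_space) atlas \<Rightarrow> ('m \<Rightarrow> 'n) \<Rightarrow> ('m \<Rightarrow> 'm tvec) \<Rightarrow>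
   'm \<Rightarrow> 'n tvec" where
  "push_field B F X = (\<lambda>p. pushforward B F (X p))"

definition lie_bracket :: "('m \<Rightarrow> 'm tvec) \<Rightarrow> ('m \<Rightarrow> 'm tvec) \<Rightarrow> 'm \<Rightarrow> 'm tvec" where
  "lie_bracket X Y = (\<lambda>p f. X p (\<lambda>q. Y q f) - Y p (\<lambda>q. X q f))"


section \<open>Integrable distributions\<close>

text \<open>The differential at \<open>x\<close> of a map \<open>\<phi>\<close> from an open subset of a Euclidean space to a
  manifold.\<close>

definition param_differential ::
  "('m::topological_space, 'e::euclidean_space) atlas \<Rightarrow> ('k::euclidean_space \<Rightarrow> 'm) \<Rightarrow>
   'k \<Rightarrow> 'k \<Rightarrow> 'm tvec" where
  "param_differential A \<phi> x v =
     (\<lambda>f. if smooth_fun A f then frechet_derivative (f \<circ> \<phi>) (at x) v else 0)"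

definition injective_immersion_on ::
  "('m::topological_space, 'e::euclidean_space) atlas \<Rightarrow> 'k::euclidean_space set \<Rightarrow>
   ('k \<Rightarrow> 'm) \<Rightarrow> bool" where
  "injective_immersion_on A W \<phi> \<longleftrightarrow> open W \<and> continuous_on W \<phi> \<and> inj_on \<phi> W \<and>
     (\<forall>(V, \<psi>)\<in>A. smooth_on (W \<inter> \<phi> -` V) (\<psi> \<circ> \<phi>)) \<and>
     (\<forall>x\<in>W. inj (param_differential A \<phi> x))"

text \<open>A distribution is integrable if through every point there passes an integral manifold, that
  is, an immersed submanifold whose tangent space at each of its points is the given one. Since only
  existence near the point matters, the submanifold is given by a parametrization on an open subset
  of the Euclidean space \<open>'k\<close>, whose dimension is the rank of the distribution.\<close>

definition integrable_distribution ::
  "'k::euclidean_space itself \<Rightarrow> ('m::topological_space, 'e::euclidean_space) atlas \<Rightarrow>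
   ('m \<Rightarrow> 'm tvec set) \<Rightarrow> bool" where
  "integrable_distribution _ A D \<longleftrightarrow>
     (\<forall>p. \<exists>(W :: 'k set) \<phi>. injective_immersion_on A W \<phi> \<and> p \<in> \<phi> ` W \<and>
        (\<forall>x\<in>W. range (param_differential A \<phi> x) = D (\<phi> x)))"


section \<open>Riemannian metrics and connections\<close>

type_synonym 'm metric = "'m \<Rightarrow> 'm tvec \<Rightarrow> 'm tvec \<Rightarrow> real"
type_synonym 'm conn = "('m \<Rightarrow> 'm tvec) \<Rightarrow> ('m \<Rightarrow> 'm tvec) \<Rightarrow> 'm \<Rightarrow> 'm tvec"

definition riemannian_metric ::
  "('m::topological_space, 'e::euclidean_space) atlas \<Rightarrow> 'm metric \<Rightarrow> bool" where
  "riemannian_metric A g \<longleftrightarrow>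
     (\<forall>p. \<forall>u\<in>tangent_space A p. \<forall>v\<in>tangent_space A p.
        g p u v = g p v u \<and>
        (\<forall>w\<in>tangent_space A p. g p (u + v) w = g p u w + g p v w) \<and>
        (\<forall>c. g p (c *\<^sub>R u) v = c * g p u v) \<and>
        (u \<noteq> 0 \<longrightarrow> g p u u > 0)) \<and>
     (\<forall>X Y. vector_field A X \<longrightarrow> vector_field A Y \<longrightarrow> smooth_fun A (\<lambda>p. g p (X p) (Y p)))"

definition riemannian_manifold ::
  "('m::{t2_space, second_countable_topology}, 'e::euclidean_space) atlas \<Rightarrow> 'm metric \<Rightarrow> bool" where
  "riemannian_manifold A g \<longleftrightarrow> smooth_manifold A \<and> riemannian_metric A g"

definition affine_connection ::
  "('m::topological_space, 'e::euclidean_space) atlas \<Rightarrow> 'm conn \<Rightarrow> bool" where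
  "affine_connection A nabla \<longleftrightarrow>
     (\<forall>X Y. vector_field A X \<longrightarrow> vector_field A Y \<longrightarrow> vector_field A (nabla X Y)) \<and>
     (\<forall>X X' Y. vector_field A X \<longrightarrow> vector_field A X' \<longrightarrow> vector_field A Y \<longrightarrow>
        nabla (X + X') Y = nabla X Y + nabla X' Y) \<and>
     (\<forall>f X Y. smooth_fun A f \<longrightarrow> vector_field A X \<longrightarrow> vector_field A Y \<longrightarrow>
        nabla (\<lambda>p. f p *\<^sub>R X p) Y = (\<lambda>p. f p *\<^sub>R nabla X Y p)) \<and>
     (\<forall>X Y Y'. vector_field A X \<longrightarrow> vector_field A Y \<longrightarrow> vector_field A Y' \<longrightarrow>
        nabla X (Y + Y') = nabla X Y + nabla X Y') \<and>
     (\<forall>f X Y. smooth_fun A f \<longrightarrow> vector_field A X \<longrightarrow> vector_field A Y \<longrightarrow>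
        nabla X (\<lambda>p. f p *\<^sub>R Y p) = (\<lambda>p. X p f *\<^sub>R Y p + f p *\<^sub>R nabla X Y p))"

text \<open>The Levi-Civita connection is the torsion-free metric connection. On arguments that are not
  smooth vector fields nothing is prescribed.\<close>

definition levi_civita ::
  "('m::topological_space, 'e::euclidean_space) atlas \<Rightarrow> 'm metric \<Rightarrow> 'm conn \<Rightarrow> bool" where
  "levi_civita A g nabla \<longleftrightarrow> affine_connection A nabla \<and>
     (\<forall>X Y. vector_field A X \<longrightarrow> vector_field A Y \<longrightarrow>
        nabla X Y - nabla Y X = lie_bracket X Y) \<and>
     (\<forall>X Y Z. vector_field A X \<longrightarrow> vector_field A Y \<longrightarrow> vector_field A Z \<longrightarrow>
        (\<forall>p. X p (\<lambda>q. g q (Y q) (Z q)) = g p (nabla X Y p) (Z p) + g p (Y p) (nabla X Z p)))"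

text \<open>The pullback to \<open>F\<^sup>-\<^sup>1TN\<close> of a connection \<open>nabla\<close> on \<open>N\<close>. The last clause says
  \<open>\<nabla>\<^sup>F\<^sub>X (W \<circ> F) = \<nabla>\<^bsub>F\<^sub>*X\<^esub> W\<close>; here the right-hand side, which at a point depends only on the
  vector \<open>F\<^sub>*X\<close>, is computed with any field \<open>Z\<close> on \<open>N\<close> having that value.\<close>

definition pullback_connection ::
  "('m::topological_space, 'e::euclidean_space) atlas \<Rightarrow>
   ('n::topological_space, 'f::euclidean_space) atlas \<Rightarrow> ('m \<Rightarrow> 'n) \<Rightarrow> 'n conn \<Rightarrow>
   (('m \<Rightarrow> 'm tvec) \<Rightarrow> ('m \<Rightarrow> 'n tvec) \<Rightarrow> 'm \<Rightarrow> 'n tvec) \<Rightarrow> bool" where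
  "pullback_connection A B F nabla nablaF \<longleftrightarrow>
     (\<forall>X s. vector_field A X \<longrightarrow> section_along A B F s \<longrightarrow> section_along A B F (nablaF X s)) \<and>
     (\<forall>X X' s. vector_field A X \<longrightarrow> vector_field A X' \<longrightarrow> section_along A B F s \<longrightarrow>
        nablaF (X + X') s = nablaF X s + nablaF X' s) \<and>
     (\<forall>f X s. smooth_fun A f \<longrightarrow> vector_field A X \<longrightarrow> section_along A B F s \<longrightarrow>
        nablaF (\<lambda>p. f p *\<^sub>R X p) s = (\<lambda>p. f p *\<^sub>R nablaF X s p)) \<and>
     (\<forall>X s s'. vector_field A X \<longrightarrow> section_along A B F s \<longrightarrow> section_along A B F s' \<longrightarrow>
        nablaF X (s + s') = nablaF X s + nablaF X s') \<and>
     (\<forall>f X s. smooth_fun A f \<longrightarrow> vector_field A X \<longrightarrow> section_along A B F s \<longrightarrow>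
        nablaF X (\<lambda>p. f p *\<^sub>R s p) = (\<lambda>p. X p f *\<^sub>R s p + f p *\<^sub>R nablaF X s p)) \<and>
     (\<forall>X W Z p. vector_field A X \<longrightarrow> vector_field B W \<longrightarrow> vector_field B Z \<longrightarrow>
        Z (F p) = pushforward B F (X p) \<longrightarrow> nablaF X (W \<circ> F) p = nabla Z W (F p))"

definition gradient ::
  "('m::topological_space, 'e::euclidean_space) atlas \<Rightarrow> 'm metric \<Rightarrow> ('m \<Rightarrow> real) \<Rightarrow>
   'm \<Rightarrow> 'm tvec" where
  "gradient A g f p =
     (THE v. v \<in> tangent_space A p \<and> (\<forall>w\<in>tangent_space A p. g p v w = w f))"

definition orth_proj :: "'m metric \<Rightarrow> 'm \<Rightarrow> 'm tvec set \<Rightarrow> 'm tvec \<Rightarrow> 'm tvec" where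
  "orth_proj g p S v = (THE w. w \<in> S \<and> (\<forall>u\<in>S. g p (v - w) u = 0))"


section \<open>Kaehler manifolds\<close>

definition tensor_field_11 ::
  "('m::topological_space, 'e::euclidean_space) atlas \<Rightarrow> ('m \<Rightarrow> 'm tvec \<Rightarrow> 'm tvec) \<Rightarrow> bool" where
  "tensor_field_11 A J \<longleftrightarrow>
     (\<forall>p. \<forall>u\<in>tangent_space A p. J p u \<in> tangent_space A p \<and>
        (\<forall>v\<in>tangent_space A p. J p (u + v) = J p u + J p v) \<and>
        (\<forall>c. J p (c *\<^sub>R u) = c *\<^sub>R J p u)) \<and>
     (\<forall>X. vector_field A X \<longrightarrow> vector_field A (\<lambda>p. J p (X p)))"

definition kaehler_manifold ::
  "('m::{t2_space, second_countable_topology}, 'e::euclidean_space) atlas \<Rightarrow> 'm metric \<Rightarrow>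
   'm conn \<Rightarrow> ('m \<Rightarrow> 'm tvec \<Rightarrow> 'm tvec) \<Rightarrow> bool" where
  "kaehler_manifold A g nabla J \<longleftrightarrow>
     riemannian_manifold A g \<and> levi_civita A g nabla \<and> tensor_field_11 A J \<and>
     (\<forall>p. \<forall>u\<in>tangent_space A p. J p (J p u) = - u) \<and>
     (\<forall>p. \<forall>u\<in>tangent_space A p. \<forall>v\<in>tangent_space A p. g p (J p u) (J p v) = g p u v) \<and>
     (\<forall>X Y. vector_field A X \<longrightarrow> vector_field A Y \<longrightarrow>
        nabla X (\<lambda>p. J p (Y p)) = (\<lambda>p. J p (nabla X Y p)))"


section \<open>Conformal anti-invariant submersions\<close>

definition smooth_submersion ::
  "('m::topological_space, 'e::euclidean_space) atlas \<Rightarrow>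
   ('n::topological_space, 'f::euclidean_space) atlas \<Rightarrow> ('m \<Rightarrow> 'n) \<Rightarrow> bool" where
  "smooth_submersion A B F \<longleftrightarrow> smooth_map A B F \<and>
     (\<forall>p. pushforward B F ` tangent_space A p = tangent_space B (F p))"

text \<open>The vertical distribution \<open>ker F\<^sub>*\<close> and the horizontal distribution
  \<open>(ker F\<^sub>*)\<^sup>\<bottom>\<close>.\<close>

definition ver ::
  "('m::topological_space, 'e::euclidean_space) atlas \<Rightarrow>
   ('n::topological_space, 'f::euclidean_space) atlas \<Rightarrow> ('m \<Rightarrow> 'n) \<Rightarrow> 'm \<Rightarrow> 'm tvec set" where
  "ver A B F p = {v \<in> tangent_space A p. pushforward B F v = 0}"

definition hor ::
  "('m::topological_space, 'e::euclidean_space) atlas \<Rightarrow> 'm metric \<Rightarrow>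
   ('n::topological_space, 'f::euclidean_space) atlas \<Rightarrow> ('m \<Rightarrow> 'n) \<Rightarrow> 'm \<Rightarrow> 'm tvec set" where
  "hor A g B F p = {v \<in> tangent_space A p. \<forall>w\<in>ver A B F p. g p v w = 0}"

definition ver_part ::
  "('m::topological_space, 'e::euclidean_space) atlas \<Rightarrow> 'm metric \<Rightarrow>
   ('n::topological_space, 'f::euclidean_space) atlas \<Rightarrow> ('m \<Rightarrow> 'n) \<Rightarrow> ('m \<Rightarrow> 'm tvec) \<Rightarrow>
   'm \<Rightarrow> 'm tvec" where
  "ver_part A g B F X = (\<lambda>p. orth_proj g p (ver A B F p) (X p))"

definition hor_part ::
  "('m::topological_space, 'e::euclidean_space) atlas \<Rightarrow> 'm metric \<Rightarrow>
   ('n::topological_space, 'f::euclidean_space) atlas \<Rightarrow> ('m \<Rightarrow> 'n) \<Rightarrow> ('m \<Rightarrow> 'm tvec) \<Rightarrow>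
   'm \<Rightarrow> 'm tvec" where
  "hor_part A g B F X = (\<lambda>p. orth_proj g p (hor A g B F p) (X p))"

definition horizontally_conformal ::
  "('m::topological_space, 'e::euclidean_space) atlas \<Rightarrow> 'm metric \<Rightarrow>
   ('n::topological_space, 'f::euclidean_space) atlas \<Rightarrow> 'n metric \<Rightarrow> ('m \<Rightarrow> 'n) \<Rightarrow>
   ('m \<Rightarrow> real) \<Rightarrow> bool" where
  "horizontally_conformal A g B g' F lam \<longleftrightarrow>
     smooth_submersion A B F \<and> smooth_fun A lam \<and> (\<forall>p. lam p > 0) \<and>
     (\<forall>p. \<forall>u\<in>hor A g B F p. \<forall>v\<in>hor A g B F p.
        g' (F p) (pushforward B F u) (pushforward B F v) = (lam p)\<^sup>2 * g p u v)"

definition conformal_anti_invariant_submersion ::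
  "('m::topological_space, 'e::euclidean_space) atlas \<Rightarrow> 'm metric \<Rightarrow>
   ('m \<Rightarrow> 'm tvec \<Rightarrow> 'm tvec) \<Rightarrow> ('n::topological_space, 'f::euclidean_space) atlas \<Rightarrow>
   'n metric \<Rightarrow> ('m \<Rightarrow> 'n) \<Rightarrow> ('m \<Rightarrow> real) \<Rightarrow> bool" where
  "conformal_anti_invariant_submersion A g J B g' F lam \<longleftrightarrow>
     horizontally_conformal A g B g' F lam \<and>
     (\<forall>p. J p ` ver A B F p \<subseteq> hor A g B F p)"

text \<open>The orthogonal complement \<open>\<mu>\<close> of \<open>J (ker F\<^sub>*)\<close> in \<open>(ker F\<^sub>*)\<^sup>\<bottom>\<close>, and the decomposition
  \<open>J X = B X + C X\<close> of a horizontal field \<open>X\<close> with \<open>B X\<close> in \<open>ker F\<^sub>*\<close> and \<open>C X\<close> in \<open>\<mu>\<close>.\<close>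

definition mu ::
  "('m::topological_space, 'e::euclidean_space) atlas \<Rightarrow> 'm metric \<Rightarrow>
   ('m \<Rightarrow> 'm tvec \<Rightarrow> 'm tvec) \<Rightarrow> ('n::topological_space, 'f::euclidean_space) atlas \<Rightarrow>
   ('m \<Rightarrow> 'n) \<Rightarrow> 'm \<Rightarrow> 'm tvec set" where
  "mu A g J B F p = {v \<in> hor A g B F p. \<forall>w\<in>J p ` ver A B F p. g p v w = 0}"

definition BC_part ::
  "('m::topological_space, 'e::euclidean_space) atlas \<Rightarrow> 'm metric \<Rightarrow>
   ('m \<Rightarrow> 'm tvec \<Rightarrow> 'm tvec) \<Rightarrow> ('n::topological_space, 'f::euclidean_space) atlas \<Rightarrow>
   ('m \<Rightarrow> 'n) \<Rightarrow> 'm \<Rightarrow> 'm tvec \<Rightarrow> 'm tvec \<times> 'm tvec" where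
  "BC_part A g J B F p u =
     (THE (b, c). b \<in> ver A B F p \<and> c \<in> mu A g J B F p \<and> J p u = b + c)"

definition B_part ::
  "('m::topological_space, 'e::euclidean_space) atlas \<Rightarrow> 'm metric \<Rightarrow>
   ('m \<Rightarrow> 'm tvec \<Rightarrow> 'm tvec) \<Rightarrow> ('n::topological_space, 'f::euclidean_space) atlas \<Rightarrow>
   ('m \<Rightarrow> 'n) \<Rightarrow> ('m \<Rightarrow> 'm tvec) \<Rightarrow> 'm \<Rightarrow> 'm tvec" where
  "B_part A g J B F X = (\<lambda>p. fst (BC_part A g J B F p (X p)))"

definition C_part ::
  "('m::topological_space, 'e::euclidean_space) atlas \<Rightarrow> 'm metric \<Rightarrow>
   ('m \<Rightarrow> 'm tvec \<Rightarrow> 'm tvec) \<Rightarrow> ('n::topological_space, 'f::euclidean_space) atlas \<Rightarrow>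
   ('m \<Rightarrow> 'n) \<Rightarrow> ('m \<Rightarrow> 'm tvec) \<Rightarrow> 'm \<Rightarrow> 'm tvec" where
  "C_part A g J B F X = (\<lambda>p. snd (BC_part A g J B F p (X p)))"

definition oneill_A ::
  "('m::topological_space, 'e::euclidean_space) atlas \<Rightarrow> 'm metric \<Rightarrow> 'm conn \<Rightarrow>
   ('n::topological_space, 'f::euclidean_space) atlas \<Rightarrow> ('m \<Rightarrow> 'n) \<Rightarrow>
   ('m \<Rightarrow> 'm tvec) \<Rightarrow> ('m \<Rightarrow> 'm tvec) \<Rightarrow> 'm \<Rightarrow> 'm tvec" where
  "oneill_A A g nabla B F E G =
     ver_part A g B F (nabla (hor_part A g B F E) (hor_part A g B F G)) +
     hor_part A g B F (nabla (hor_part A g B F E) (ver_part A g B F G))"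

end

theory Submission
  imports Defs
begin

text \<open>Both assertions are equivalent to the involutivity of the horizontal distribution.

  \<^emph>\<open>The identity in (b).\<close> For horizontal \<open>X\<close>, \<open>Y\<close> and vertical \<open>V\<close> the difference of the two sides of
  (b) is \<open>g([X, Y], V)\<close> (lemma \<open>integrability_identity\<close>). Indeed \<open>[X, Y] = \<nabla>\<^sub>X Y - \<nabla>\<^sub>Y X\<close>, and since \<open>J\<close>
  is orthogonal and parallel, \<open>g(\<nabla>\<^sub>X Y, V) = g(\<nabla>\<^sub>X BY, JV) + g(\<nabla>\<^sub>X CY, JV)\<close>. The first summand is the
  O'Neill term. In the second one all three fields are horizontal, so it is determined by the second
  fundamental form of the conformal map \<open>F\<close>,
  \<open>\<nabla>\<^sup>F\<^sub>X F\<^sub>*Y - F\<^sub>*(\<nabla>\<^sub>X Y) = X(ln \<lambda>) F\<^sub>*Y + Y(ln \<lambda>) F\<^sub>*X - g(X, Y) F\<^sub>*(grad ln \<lambda>)\<close>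
  (lemma \<open>second_fundamental_form\<close>). That formula is the difference of two Koszul formulas: the pullback
  connection is compatible with the metric of the base and its torsion is \<open>F\<^sub>*[X, Y]\<close>, and on horizontal
  vectors the metric of the base is \<open>\<lambda>\<^sup>2\<close> times that of the total space.

  \<^emph>\<open>Integrable implies involutive.\<close> A vertical field \<open>V\<close> defines the one-form \<open>\<omega> = g(V, -)\<close>, which
  vanishes on integral manifolds. So does \<open>d\<omega>\<close>, and \<open>d\<omega>(X, Y) = - g(V, [X, Y])\<close>
  (lemma \<open>integrable_imp_involutive\<close>).

  \<^emph>\<open>Involutive implies integrable.\<close> This is a case of Frobenius' theorem in which the distribution is a
  complement of the fibres of \<open>F\<close>. The horizontal lifts of coordinate fields of the base form a smooth
  horizontal frame. Their brackets are horizontal by involutivity and vertical since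
  coordinate fields commute, hence they vanish. In a chart it remains to find a map whose partial
  derivatives are given commuting vector fields (lemma \<open>commuting_fields_integral_map\<close>). It is the limit
  of the Picard iterates of the integral equation along rays from the origin. The error
  \<open>d\<phi> - field(\<phi>)\<close> of an iterate contracts because the fields commute, so the derivatives of the iterates
  converge uniformly as well. In coordinates of the base the resulting map is a translation, hence it is an
  injective immersion.

  Tangent vectors are derivations of globally defined smooth functions. Cut-off functions localize them,
  and Hadamard's lemma identifies them with directional derivatives in charts
  (lemmas \<open>exists_cutoff\<close> and \<open>tangent_eq_sum_partials\<close>). Horizontal and vertical parts of fields are smooth
  because the horizontal spaces are spanned by the gradients of the functions \<open>h \<circ> F\<close>
  (lemma \<open>exists_horizontal_frame\<close>).\<close>


section \<open>Calculus of smooth maps on open sets\<close>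

lemma frechet_derivative_cong_open:
  assumes "open S" "x \<in> S" "\<And>y. y \<in> S \<Longrightarrow> f y = g y"
  shows "frechet_derivative f (at x) = frechet_derivative g (at x)"
proof -
  have "(f has_derivative D) (at x) \<longleftrightarrow> (g has_derivative D) (at x)" for D
    using assms by (auto intro: has_derivative_transform_within_open[of _ _ x UNIV S])
  then show ?thesis by (simp add: frechet_derivative_def)
qed

lemma differentiable_cong_open:
  assumes "open S" "x \<in> S" "\<And>y. y \<in> S \<Longrightarrow> f y = g y" "f differentiable (at x)"
  shows "g differentiable (at x)"
  using assms by (auto simp: differentiable_def intro: has_derivative_transform_within_open[of f _ x UNIV S])

lemma Ck_on_cong:
  assumes "open S" "\<And>y. y \<in> S \<Longrightarrow> f y = g y" "Ck_on k S f"
  shows "Ck_on k S g"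
  using assms(2,3)
proof (induction k arbitrary: f g)
  case 0
  then show ?case by (simp cong: continuous_on_cong_simp)
next
  case (Suc k)
  have eq: "frechet_derivative f (at x) = frechet_derivative g (at x)" if "x \<in> S" for x
    using frechet_derivative_cong_open[OF assms(1) that] Suc.prems(1) by blast
  have "Ck_on k S (\<lambda>x. frechet_derivative g (at x) v)" for v
    by (rule Suc.IH[of "\<lambda>x. frechet_derivative f (at x) v"]) (use Suc.prems(2) eq in simp_all)
  moreover have "g differentiable (at x)" if "x \<in> S" for x
    using differentiable_cong_open[OF assms(1) that, of f g] Suc.prems that by auto
  ultimately show ?case by auto
qed

text \<open>An explicit derivative may replace the one chosen by \<open>frechet_derivative\<close>.\<close>

lemma Ck_on_SucI:
  assumes "open S" "\<And>x. x \<in> S \<Longrightarrow> (f has_derivative D x) (at x)" "\<And>v. Ck_on k S (\<lambda>x. D x v)"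
  shows "Ck_on (Suc k) S f"
proof -
  have eq: "frechet_derivative f (at x) = D x" if "x \<in> S" for x
    using frechet_derivative_at[OF assms(2)[OF that]] by simp
  have "Ck_on k S (\<lambda>x. frechet_derivative f (at x) v)" for v
    by (rule Ck_on_cong[OF assms(1) _ assms(3)[of v]]) (simp add: eq)
  then show ?thesis using assms(2) by (auto simp: differentiable_def)
qed

lemma Ck_on_subset: "Ck_on k S f \<Longrightarrow> T \<subseteq> S \<Longrightarrow> Ck_on k T f"
  by (induction k arbitrary: f) (auto intro: continuous_on_subset)

lemma Ck_on_SucD: "Ck_on (Suc k) S f \<Longrightarrow> Ck_on k S f"
proof (induction k arbitrary: f)
  case 0
  then show ?case
    by (auto intro!: continuous_at_imp_continuous_on differentiable_imp_continuous_within)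
qed auto

lemma Ck_on_has_derivative:
  "Ck_on (Suc k) S f \<Longrightarrow> x \<in> S \<Longrightarrow> (f has_derivative frechet_derivative f (at x)) (at x)"
  by (simp add: frechet_derivative_works)

lemma Ck_on_local:
  assumes "\<And>x. x \<in> S \<Longrightarrow> \<exists>T. open T \<and> x \<in> T \<and> Ck_on k T f"
  shows "Ck_on k S f"
  using assms
proof (induction k arbitrary: f)
  case 0
  show ?case unfolding Ck_on.simps
  proof (rule continuous_at_imp_continuous_on, rule ballI)
    fix x assume "x \<in> S"
    then obtain T where "open T" "x \<in> T" "continuous_on T f" using 0 by auto
    then show "isCont f x" by (simp add: continuous_on_eq_continuous_at)
  qed
next
  case (Suc k)
  have "Ck_on k S (\<lambda>x. frechet_derivative f (at x) v)" for v
  proof (rule Suc.IH)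
    fix x assume "x \<in> S"
    then obtain T where "open T" "x \<in> T" "Ck_on (Suc k) T f" using Suc.prems by blast
    then show "\<exists>T. open T \<and> x \<in> T \<and> Ck_on k T (\<lambda>x. frechet_derivative f (at x) v)" by auto
  qed
  moreover have "f differentiable (at x)" if "x \<in> S" for x
    using Suc.prems[OF that] by auto
  ultimately show ?case by simp
qed

lemma Ck_on_const: "open S \<Longrightarrow> Ck_on k S (\<lambda>x. c)"
proof (induction k arbitrary: c)
  case (Suc k)
  show ?case by (rule Ck_on_SucI[where D="\<lambda>x v. 0"]) (auto simp: Suc)
qed simp

lemma Ck_on_bounded_linear:
  assumes "open S" "bounded_linear L"
  shows "Ck_on k S L"
proof (cases k)
  case 0
  then show ?thesis using assms by (simp add: linear_continuous_on)
next
  case (Suc n)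
  show ?thesis unfolding Suc
    by (rule Ck_on_SucI[where D="\<lambda>x. L"])
      (use assms in \<open>auto intro: bounded_linear_imp_has_derivative Ck_on_const\<close>)
qed

lemma Ck_on_add:
  assumes "open S"
  shows "Ck_on k S f \<Longrightarrow> Ck_on k S g \<Longrightarrow> Ck_on k S (\<lambda>x. f x + g x)"
proof (induction k arbitrary: f g)
  case (Suc k)
  show ?case
    by (rule Ck_on_SucI[OF assms, where D="\<lambda>x v. frechet_derivative f (at x) v + frechet_derivative g (at x) v"])
      (intro has_derivative_add Ck_on_has_derivative[OF Suc.prems(1)] Ck_on_has_derivative[OF Suc.prems(2)],
        assumption+, rule Suc.IH, use Suc.prems in simp_all)
qed (auto intro: continuous_on_add)

lemma Ck_on_sum:
  assumes "open S"
  shows "(\<And>i. i \<in> I \<Longrightarrow> Ck_on k S (f i)) \<Longrightarrow> Ck_on k S (\<lambda>x. \<Sum>i\<in>I. f i x)"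
  by (induction I rule: infinite_finite_induct)
    (auto intro: Ck_on_const[OF assms] Ck_on_add[OF assms])

lemma Ck_on_bilinear:
  assumes "open S" "bounded_bilinear B"
  shows "Ck_on k S f \<Longrightarrow> Ck_on k S g \<Longrightarrow> Ck_on k S (\<lambda>x. B (f x) (g x))"
proof (induction k arbitrary: f g)
  case 0
  then show ?case using bounded_bilinear.continuous_on[OF assms(2)] by auto
next
  case (Suc k)
  show ?case
    by (rule Ck_on_SucI[OF assms(1), where D="\<lambda>x v. B (f x) (frechet_derivative g (at x) v) +
          B (frechet_derivative f (at x) v) (g x)"])
      (rule bounded_bilinear.FDERIV[OF assms(2) Ck_on_has_derivative[OF Suc.prems(1)] Ck_on_has_derivative[OF Suc.prems(2)]],
        assumption+, intro Ck_on_add[OF assms(1)] Suc.IH,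
        use Suc.prems Ck_on_SucD[OF Suc.prems(1)] Ck_on_SucD[OF Suc.prems(2)] in simp_all)
qed

text \<open>The derivative of \<open>f \<circ> g\<close> in direction \<open>v\<close> is the sum of the partial derivatives of \<open>f\<close>, composed with
  \<open>g\<close>, times the components of \<open>Dg v\<close>. The induction hypothesis applies to the former, which is why it
  quantifies over \<open>f\<close>.\<close>

lemma Ck_on_compose:
  fixes g :: "'a::euclidean_space \<Rightarrow> 'b::euclidean_space" and f :: "'b \<Rightarrow> 'c::real_normed_vector"
  assumes "open S" "g ` S \<subseteq> T"
  shows "Ck_on k S g \<Longrightarrow> Ck_on k T f \<Longrightarrow> Ck_on k S (\<lambda>x. f (g x))"
proof (induction k arbitrary: f)
  case 0
  then show ?case using continuous_on_compose2 assms by auto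
next
  case (Suc k)
  let ?D = "\<lambda>x v. \<Sum>b\<in>Basis. (frechet_derivative g (at x) v \<bullet> b) *\<^sub>R frechet_derivative f (at (g x)) b"
  have gk: "Ck_on k S g" using Ck_on_SucD[OF Suc.prems(1)] .
  have D: "((\<lambda>x. f (g x)) has_derivative ?D x) (at x)" if "x \<in> S" for x
  proof -
    have "g x \<in> T" using that assms by auto
    then have f: "(f has_derivative frechet_derivative f (at (g x))) (at (g x))"
      by (rule Ck_on_has_derivative[OF Suc.prems(2)])
    have g: "(g has_derivative frechet_derivative g (at x)) (at x)"
      by (rule Ck_on_has_derivative[OF Suc.prems(1) that])
    have comp: "((\<lambda>x. f (g x)) has_derivative (\<lambda>v. frechet_derivative f (at (g x)) (frechet_derivative g (at x) v))) (at x)"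
      using has_derivative_compose[OF g f] .
    have "frechet_derivative f (at (g x)) w = (\<Sum>b\<in>Basis. (w \<bullet> b) *\<^sub>R frechet_derivative f (at (g x)) b)" for w
    proof -
      have "linear (frechet_derivative f (at (g x)))" using f has_derivative_linear by blast
      then have "frechet_derivative f (at (g x)) (\<Sum>b\<in>Basis. (w \<bullet> b) *\<^sub>R b)
          = (\<Sum>b\<in>Basis. (w \<bullet> b) *\<^sub>R frechet_derivative f (at (g x)) b)"
        by (simp add: linear_sum linear_cmul)
      then show ?thesis by (simp add: euclidean_representation)
    qed
    then have "(\<lambda>v. frechet_derivative f (at (g x)) (frechet_derivative g (at x) v)) = ?D x"
      by (intro ext)
    with comp show ?thesis by (simp only:)
  qed
  show ?case
  proof (rule Ck_on_SucI[OF assms(1) D])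
    fix v
    show "Ck_on k S (\<lambda>x. ?D x v)"
    proof (rule Ck_on_sum[OF assms(1)], rule Ck_on_bilinear[OF assms(1) bounded_bilinear_scaleR])
      fix b :: 'b
      show "Ck_on k S (\<lambda>x. frechet_derivative f (at (g x)) b)"
        using Suc.IH[OF gk, of "\<lambda>y. frechet_derivative f (at y) b"] Suc.prems by auto
      show "Ck_on k S (\<lambda>x. frechet_derivative g (at x) v \<bullet> b)"
        by (rule Ck_on_bilinear[OF assms(1) bounded_bilinear_inner _ Ck_on_const[OF assms(1)]])
          (use Suc.prems in auto)
    qed
  qed auto
qed

lemma smooth_on_cong:
  "open S \<Longrightarrow> (\<And>y. y \<in> S \<Longrightarrow> f y = g y) \<Longrightarrow> smooth_on S f \<Longrightarrow> smooth_on S g"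
  unfolding smooth_on_def by (rule allI, rule Ck_on_cong[of S f g]) simp_all

lemma smooth_on_subset: "smooth_on S f \<Longrightarrow> T \<subseteq> S \<Longrightarrow> smooth_on T f"
  unfolding smooth_on_def by (rule allI, rule Ck_on_subset[of _ S]) simp_all

lemma smooth_on_local:
  assumes "\<And>x. x \<in> S \<Longrightarrow> \<exists>T. open T \<and> x \<in> T \<and> smooth_on T f"
  shows "smooth_on S f"
  unfolding smooth_on_def
proof (rule allI, rule Ck_on_local)
  fix k x assume "x \<in> S"
  then obtain T where T: "open T" "x \<in> T" "smooth_on T f" using assms by blast
  then have "Ck_on k T f" by (simp add: smooth_on_def)
  with T show "\<exists>T. open T \<and> x \<in> T \<and> Ck_on k T f" by blast
qed

lemma smooth_on_const: "open S \<Longrightarrow> smooth_on S (\<lambda>x. c)"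
  by (simp add: smooth_on_def Ck_on_const)

lemma smooth_on_linear: "open S \<Longrightarrow> bounded_linear L \<Longrightarrow> smooth_on S L"
  by (simp add: smooth_on_def Ck_on_bounded_linear)

lemma smooth_on_add: "open S \<Longrightarrow> smooth_on S f \<Longrightarrow> smooth_on S g \<Longrightarrow> smooth_on S (\<lambda>x. f x + g x)"
  by (simp add: smooth_on_def Ck_on_add)

lemma smooth_on_sum:
  "open S \<Longrightarrow> (\<And>i. i \<in> I \<Longrightarrow> smooth_on S (f i)) \<Longrightarrow> smooth_on S (\<lambda>x. \<Sum>i\<in>I. f i x)"
  by (simp add: smooth_on_def Ck_on_sum)

lemma smooth_on_bilinear:
  "open S \<Longrightarrow> bounded_bilinear B \<Longrightarrow> smooth_on S f \<Longrightarrow> smooth_on S g \<Longrightarrow> smooth_on S (\<lambda>x. B (f x) (g x))"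
  unfolding smooth_on_def by (rule allI, rule Ck_on_bilinear) simp_all

lemmas smooth_on_mult = smooth_on_bilinear[OF _ bounded_bilinear_mult]
lemmas smooth_on_scaleR = smooth_on_bilinear[OF _ bounded_bilinear_scaleR]
lemmas smooth_on_inner = smooth_on_bilinear[OF _ bounded_bilinear_inner]

lemma smooth_on_diff:
  assumes "open S" "smooth_on S f" "smooth_on S g"
  shows "smooth_on S (\<lambda>x. f x - g x)"
  using smooth_on_add[OF assms(1,2) smooth_on_scaleR[OF assms(1) smooth_on_const[OF assms(1), of "-1"] assms(3)]]
  by simp

lemma smooth_on_compose:
  fixes g :: "'a::euclidean_space \<Rightarrow> 'b::euclidean_space"
  shows "open S \<Longrightarrow> g ` S \<subseteq> T \<Longrightarrow> smooth_on S g \<Longrightarrow> smooth_on T f \<Longrightarrow> smooth_on S (\<lambda>x. f (g x))"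
  unfolding smooth_on_def by (rule allI, rule Ck_on_compose[of S g T]) simp_all

lemma smooth_on_has_derivative:
  assumes "smooth_on S f" "x \<in> S"
  shows "(f has_derivative frechet_derivative f (at x)) (at x)"
  using assms by (intro Ck_on_has_derivative[of 0 S f]) (simp_all add: smooth_on_def del: Ck_on.simps)

lemma smooth_on_frechet:
  assumes "smooth_on S f"
  shows "smooth_on S (\<lambda>x. frechet_derivative f (at x) v)"
proof -
  have "Ck_on (Suc k) S f" for k using assms by (simp add: smooth_on_def del: Ck_on.simps)
  then show ?thesis by (simp add: smooth_on_def)
qed

lemma smooth_on_continuous:
  assumes "smooth_on S f"
  shows "continuous_on S f"
proof -
  have "Ck_on 0 S f" using assms by (simp add: smooth_on_def del: Ck_on.simps)
  then show ?thesis by simp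
qed

text \<open>A function whose derivative is as regular as the function itself gains one derivative in each step.\<close>

lemma smooth_on_real_deriv:
  fixes f :: "real \<Rightarrow> real"
  assumes "open S" "\<And>x. x \<in> S \<Longrightarrow> (f has_real_derivative f' x) (at x)"
    and "\<And>k. Ck_on k S f \<Longrightarrow> Ck_on k S f'"
  shows "smooth_on S f"
  unfolding smooth_on_def
proof
  fix k show "Ck_on k S f"
  proof (induction k)
    case 0
    show ?case using assms(2) by (auto intro!: continuous_at_imp_continuous_on DERIV_isCont)
  next
    case (Suc k)
    show ?case
    proof (rule Ck_on_SucI[OF assms(1), where D="\<lambda>x v. f' x * v"])
      fix x assume "x \<in> S"
      then show "(f has_derivative (*) (f' x)) (at x)"
        using assms(2) by (simp add: has_field_derivative_def)
    next
      fix v show "Ck_on k S (\<lambda>x. f' x * v)"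
        by (rule Ck_on_bilinear[OF assms(1) bounded_bilinear_mult assms(3)[OF Suc] Ck_on_const[OF assms(1)]])
    qed
  qed
qed

lemma smooth_on_inverse: "smooth_on (-{0}) (inverse :: real \<Rightarrow> real)"
proof (rule smooth_on_real_deriv)
  show "(inverse has_real_derivative (- 1) * (inverse x * inverse x)) (at x)" if "x \<in> - {0}" for x :: real
    using DERIV_inverse[of x] that by (simp add: power2_eq_square)
  show "Ck_on k (-{0}) (\<lambda>x::real. (- 1) * (inverse x * inverse x))" if "Ck_on k (-{0}) (inverse :: real \<Rightarrow> real)" for k
    by (intro Ck_on_bilinear[OF _ bounded_bilinear_mult] Ck_on_const that) auto
qed auto

lemma smooth_on_ln: "smooth_on {0<..} (ln :: real \<Rightarrow> real)"
proof (rule smooth_on_real_deriv)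
  show "(ln has_real_derivative inverse x) (at x)" if "x \<in> {0<..}" for x :: real
    using DERIV_ln[of x] that by auto
  show "Ck_on k {0<..} (inverse :: real \<Rightarrow> real)" for k
    by (rule Ck_on_subset[of _ "-{0}"]) (use smooth_on_inverse in \<open>auto simp: smooth_on_def\<close>)
qed auto

lemma smooth_on_exp: "smooth_on UNIV (exp :: real \<Rightarrow> real)"
  by (rule smooth_on_real_deriv[where f'=exp]) auto

text \<open>This function normalizes the vectors in the Gram-Schmidt process.\<close>

lemma smooth_on_inverse_sqrt: "smooth_on {0<..} (\<lambda>x::real. 1 / sqrt x)"
proof (rule smooth_on_cong[of _ "\<lambda>x. exp (- (1/2) * ln x)"])
  show "exp (- (1/2) * ln x) = 1 / sqrt x" if "x \<in> {0<..}" for x :: real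
  proof -
    have "sqrt x = exp (1/2 * ln x)" using powr_half_sqrt[of x] that by (simp add: powr_def)
    then show ?thesis using exp_minus[of "1/2 * ln x"] by (simp add: inverse_eq_divide)
  qed
  have "smooth_on {0<..} (\<lambda>x::real. - (1/2) * ln x)"
    by (rule smooth_on_mult[OF _ smooth_on_const smooth_on_ln]) auto
  then show "smooth_on {0<..} (\<lambda>x::real. exp (- (1/2) * ln x))"
    by (rule smooth_on_compose[OF _ _ _ smooth_on_exp, rotated 2]) auto
qed simp

text \<open>The flat function \<open>exp (-1/x)\<close>; the weights \<open>x\<^sup>-\<^sup>n\<close> make the family closed under
  differentiation.\<close>

definition flat :: "nat \<Rightarrow> real \<Rightarrow> real" where
  "flat n x = (if x > 0 then inverse x ^ n * exp (- inverse x) else 0)"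

lemma flat_tendsto_0: "(flat n \<longlongrightarrow> 0) (at 0)"
proof -
  have "((\<lambda>x. inverse x ^ n * exp (- inverse x)) \<longlongrightarrow> (0::real)) (at_right 0)"
    using filterlim_compose[OF tendsto_power_div_exp_0[of n] filterlim_inverse_at_top_right]
    by (simp add: exp_minus divide_inverse)
  then have "(flat n \<longlongrightarrow> 0) (at_right 0)"
    by (rule Lim_transform_eventually) (auto simp: flat_def eventually_at_filter)
  moreover have "(flat n \<longlongrightarrow> 0) (at_left 0)"
    by (rule Lim_transform_eventually[OF tendsto_const])
      (auto simp: flat_def eventually_at_filter)
  ultimately show ?thesis by (simp add: filterlim_at_split)
qed

lemma flat_deriv: "(flat n has_real_derivative (flat (n + 2) x - real n * flat (n + 1) x)) (at x)"
proof -
  consider "x > 0" | "x < 0" | "x = 0" by linarith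
  then show ?thesis
  proof cases
    case 1
    have i: "(inverse has_real_derivative - (inverse x * inverse x)) (at x)"
      using DERIV_inverse[of x] 1 by (simp add: power2_eq_square)
    have "((\<lambda>x. inverse x ^ n * exp (- inverse x)) has_real_derivative
        (flat (n + 2) x - real n * flat (n + 1) x)) (at x)"
      by (rule DERIV_cong[OF DERIV_mult[OF DERIV_power[OF i] DERIV_chain2[OF DERIV_exp DERIV_minus[OF i]]]])
        (cases n; use 1 in \<open>simp add: flat_def algebra_simps del: inverse_eq_divide\<close>)
    then show ?thesis
      by (rule has_field_derivative_transform_within_open[of _ _ _ "{0<..}"]) (use 1 in \<open>auto simp: flat_def\<close>)
  next
    case 2
    then show ?thesis
      using has_field_derivative_transform_within_open[of "\<lambda>x. 0" 0 x "{..<0}" "flat n"]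
      by (auto simp: flat_def)
  next
    case 3
    \<comment> \<open>The difference quotient of \<open>flat n\<close> at \<open>0\<close> is \<open>flat (n + 1)\<close>.\<close>
    have "((\<lambda>y. (flat n y - flat n 0) / (y - 0)) \<longlongrightarrow> 0) (at 0)"
      by (rule Lim_transform_eventually[OF flat_tendsto_0[of "n+1"]])
        (auto simp: flat_def eventually_at_filter divide_inverse)
    then show ?thesis using 3 by (simp add: has_field_derivative_iff flat_def)
  qed
qed

lemma smooth_on_flat: "smooth_on UNIV (flat n)"
proof -
  have "Ck_on k UNIV (flat n)" for k n
  proof (induction k arbitrary: n)
    case 0
    show ?case using DERIV_isCont[OF flat_deriv] by (simp add: continuous_at_imp_continuous_on)
  next
    case (Suc k)
    have "Ck_on k UNIV (\<lambda>x. (flat (n + 2) x + (- real n) * flat (n + 1) x) * v)" for v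
      by (intro Ck_on_bilinear[OF _ bounded_bilinear_mult] Ck_on_add Ck_on_const Suc) auto
    moreover have "(flat n has_derivative (\<lambda>v. (flat (n + 2) x + (- real n) * flat (n + 1) x) * v)) (at x)" for x
      using flat_deriv[of n x] by (simp add: has_field_derivative_def)
    ultimately show ?case
      by (intro Ck_on_SucI[where D="\<lambda>x v. (flat (n + 2) x + (- real n) * flat (n + 1) x) * v"]) auto
  qed
  then show ?thesis by (simp add: smooth_on_def)
qed

text \<open>With \<open>f = flat 0\<close> and the squared distance \<open>N\<close> from \<open>a\<close>, the function is
  \<open>f(4r\<^sup>2 - N) / (f(4r\<^sup>2 - N) + f(N - r\<^sup>2))\<close>. Using the squared distance avoids the singularity of the
  norm.\<close>

lemma exists_bump_euclidean:
  fixes a :: "'a::euclidean_space"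
  assumes "r > 0"
  shows "\<exists>\<beta>. smooth_on UNIV (\<beta> :: 'a \<Rightarrow> real) \<and> (\<forall>y\<in>ball a r. \<beta> y = 1) \<and> (\<forall>y. y \<notin> ball a (2 * r) \<longrightarrow> \<beta> y = 0)"
proof (intro exI conjI)
  let ?N = "\<lambda>y. (y - a) \<bullet> (y - a)"
  let ?s = "\<lambda>y. 4 * r\<^sup>2 - ?N y" and ?t = "\<lambda>y. ?N y - r\<^sup>2"
  let ?d = "\<lambda>y. flat 0 (?s y) + flat 0 (?t y)"
  let ?b = "\<lambda>y. flat 0 (?s y) * inverse (?d y)"
  have N: "?N y = (dist a y)\<^sup>2" for y
    by (simp add: dist_norm power2_norm_eq_inner inner_commute algebra_simps)
  have nn: "flat 0 x \<ge> 0" and pos: "x > 0 \<Longrightarrow> flat 0 x > 0" and zero: "x \<le> 0 \<Longrightarrow> flat 0 x = 0" for x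
    by (auto simp: flat_def)
  have d: "?d y > 0" for y
  proof -
    have "?s y + ?t y > 0" using assms by simp
    then have "?s y > 0 \<or> ?t y > 0" by linarith
    then show ?thesis using nn pos by (metis add_pos_nonneg add_nonneg_pos)
  qed
  have sN: "smooth_on UNIV ?N"
    by (intro smooth_on_inner smooth_on_diff smooth_on_linear smooth_on_const) (auto intro: bounded_linear_ident)
  have s: "smooth_on UNIV (\<lambda>y. flat 0 (?s y))" and t: "smooth_on UNIV (\<lambda>y. flat 0 (?t y))"
    by (rule smooth_on_compose[OF _ _ _ smooth_on_flat]; auto intro!: smooth_on_diff smooth_on_const sN)+
  show "smooth_on UNIV ?b"
    by (intro smooth_on_mult s smooth_on_compose[OF _ _ _ smooth_on_inverse] smooth_on_add t)
      (use d in \<open>auto simp: less_imp_neq[symmetric]\<close>)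
  show "\<forall>y\<in>ball a r. ?b y = 1"
  proof
    fix y assume "y \<in> ball a r"
    then have "?N y \<le> r\<^sup>2" unfolding N using assms by (intro power_mono) auto
    then have "flat 0 (?t y) = 0" by (intro zero) simp
    then show "?b y = 1" using d[of y] by simp
  qed
  show "\<forall>y. y \<notin> ball a (2 * r) \<longrightarrow> ?b y = 0"
  proof (intro allI impI)
    fix y assume "y \<notin> ball a (2 * r)"
    then have "(2 * r)\<^sup>2 \<le> ?N y" unfolding N using assms by (intro power_mono) auto
    then have "flat 0 (?s y) = 0" by (intro zero) (simp add: power_mult_distrib)
    then show "?b y = 0" by simp
  qed
qed


section \<open>Derivations of smooth functions on a ball\<close>

lemma frechet_derivative_add:
  assumes "smooth_on S f" "smooth_on S g" "x \<in> S"
  shows "frechet_derivative (\<lambda>x. f x + g x) (at x) v = frechet_derivative f (at x) v + frechet_derivative g (at x) v"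
  using frechet_derivative_at[OF has_derivative_add[OF smooth_on_has_derivative[OF assms(1,3)] smooth_on_has_derivative[OF assms(2,3)]]]
  by metis

lemma frechet_derivative_mult:
  fixes f g :: "_ \<Rightarrow> real"
  assumes "smooth_on S f" "smooth_on S g" "x \<in> S"
  shows "frechet_derivative (\<lambda>x. f x * g x) (at x) v = f x * frechet_derivative g (at x) v + frechet_derivative f (at x) v * g x"
  using frechet_derivative_at[OF has_derivative_mult[OF smooth_on_has_derivative[OF assms(1,3)] smooth_on_has_derivative[OF assms(2,3)]]]
  by metis

lemma frechet_derivative_inner_const: "frechet_derivative (\<lambda>y. y \<bullet> i) (at x) v = v \<bullet> i"
proof -
  have "((\<lambda>y. y \<bullet> i) has_derivative (\<lambda>v. v \<bullet> i)) (at x)"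
    by (intro bounded_linear_imp_has_derivative bounded_linear_inner_left)
  from frechet_derivative_at[OF this] show ?thesis by metis
qed

lemma frechet_derivative_basis_expansion:
  fixes f :: "'a::euclidean_space \<Rightarrow> 'b::real_normed_vector"
  assumes "(f has_derivative frechet_derivative f (at x)) (at x)"
  shows "frechet_derivative f (at x) w = (\<Sum>b\<in>Basis. (w \<bullet> b) *\<^sub>R frechet_derivative f (at x) b)"
proof -
  have "linear (frechet_derivative f (at x))" using assms has_derivative_linear by blast
  then have "frechet_derivative f (at x) (\<Sum>b\<in>Basis. (w \<bullet> b) *\<^sub>R b)
      = (\<Sum>b\<in>Basis. (w \<bullet> b) *\<^sub>R frechet_derivative f (at x) b)"
    by (simp add: linear_sum linear_cmul)
  then show ?thesis by (simp add: euclidean_representation)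
qed

text \<open>Weighted averages along rays from \<open>a\<close>. The weight \<open>t\<^sup>j\<close> makes the family closed under
  differentiation in \<open>y\<close>, so these averages inherit smoothness.\<close>

definition ray_integral ::
  "nat \<Rightarrow> 'a::euclidean_space \<Rightarrow> ('a \<Rightarrow> 'b::euclidean_space) \<Rightarrow> 'a \<Rightarrow> 'b" where
  "ray_integral j a h y = integral (cbox 0 1) (\<lambda>t. t ^ j *\<^sub>R h (a + t *\<^sub>R (y - a)))"

lemma ray_in_ball:
  fixes a y :: "'a::real_normed_vector"
  assumes y: "y \<in> ball a r" and t: "t \<in> cbox 0 (1::real)"
  shows "a + t *\<^sub>R (y - a) \<in> ball a r"
proof -
  have "norm (t *\<^sub>R (y - a)) \<le> 1 * norm (y - a)"
    using t unfolding norm_scaleR by (intro mult_right_mono) auto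
  then show ?thesis using y by (simp add: dist_norm norm_minus_commute)
qed

lemma continuous_on_ray:
  fixes h :: "'a::euclidean_space \<Rightarrow> 'b::euclidean_space"
  assumes "continuous_on (ball a r) h" "continuous_on X p" "continuous_on X q"
    and "p ` X \<subseteq> ball a r" "q ` X \<subseteq> cbox 0 (1::real)"
  shows "continuous_on X (\<lambda>z. q z ^ j *\<^sub>R h (a + q z *\<^sub>R (p z - a)))"
proof -
  have "continuous_on X (\<lambda>z. a + q z *\<^sub>R (p z - a))"
    by (intro continuous_intros assms)
  moreover have "(\<lambda>z. a + q z *\<^sub>R (p z - a)) ` X \<subseteq> ball a r"
    using ray_in_ball assms(4,5) by blast
  ultimately have "continuous_on X (\<lambda>z. h (a + q z *\<^sub>R (p z - a)))"
    by (rule continuous_on_compose2[OF assms(1)])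
  then show ?thesis by (intro continuous_intros assms)
qed

lemma ray_integrable:
  fixes h :: "'a::euclidean_space \<Rightarrow> 'b::euclidean_space"
  assumes "continuous_on (ball a r) h" "y \<in> ball a r"
  shows "(\<lambda>t. t ^ j *\<^sub>R h (a + t *\<^sub>R (y - a))) integrable_on cbox 0 1"
  by (rule integrable_continuous, rule continuous_on_ray[OF assms(1)])
    (use assms(2) in \<open>auto intro: continuous_intros\<close>)

text \<open>Differentiation under the integral. The Leibniz rule asks for the derivative of the integrand as a
  continuous family of bounded linear operators, whereas continuity is known for each direction only; the
  family \<open>fx\<close> is therefore assembled from the finitely many partial derivatives.\<close>

lemma ray_integral_has_derivative:
  fixes h :: "'a::euclidean_space \<Rightarrow> 'b::euclidean_space"
  assumes h: "Ck_on (Suc 0) (ball a r) h" and y: "y \<in> ball a r"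
  shows "(ray_integral j a h has_derivative
    (\<lambda>w. ray_integral (Suc j) a (\<lambda>z. frechet_derivative h (at z) w) y)) (at y)"
proof -
  let ?U = "ball a r" and ?p = "\<lambda>y t. a + t *\<^sub>R (y - a)"
  define fx where "fx = (\<lambda>y (t::real). \<Sum>i\<in>Basis. blinfun_scaleR_left (t ^ Suc j *\<^sub>R frechet_derivative h (at (?p y t)) i) o\<^sub>L blinfun_inner_left i)"
  have Dh: "(h has_derivative frechet_derivative h (at z)) (at z)" if "z \<in> ?U" for z
    by (rule Ck_on_has_derivative[OF h that])
  have fx_apply: "blinfun_apply (fx y t) w = t ^ Suc j *\<^sub>R frechet_derivative h (at (?p y t)) w"
    if "y \<in> ?U" "t \<in> cbox 0 1" for y t w
  proof -
    have "blinfun_apply (fx y t) w = (\<Sum>i\<in>Basis. (w \<bullet> i) *\<^sub>R t ^ Suc j *\<^sub>R frechet_derivative h (at (?p y t)) i)"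
      by (simp add: fx_def blinfun.sum_left)
    also have "\<dots> = t ^ Suc j *\<^sub>R (\<Sum>i\<in>Basis. (w \<bullet> i) *\<^sub>R frechet_derivative h (at (?p y t)) i)"
      by (simp add: scaleR_sum_right mult_ac)
    also have "\<dots> = t ^ Suc j *\<^sub>R frechet_derivative h (at (?p y t)) w"
      using frechet_derivative_basis_expansion[OF Dh[OF ray_in_ball[OF that]], of w] by simp
    finally show ?thesis .
  qed
  have c0: "continuous_on ?U h" using Ck_on_SucD[OF h] by simp
  have c1: "continuous_on ?U (\<lambda>z. frechet_derivative h (at z) i)" for i using h by simp
  have cfx: "continuous_on (?U \<times> cbox 0 1) (\<lambda>(y, t). fx y t)"
    unfolding fx_def split_beta
    by (intro continuous_on_sum bounded_bilinear.continuous_on[OF bounded_bilinear_blinfun_compose]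
        bounded_linear.continuous_on[OF bounded_linear_blinfun_scaleR_left] continuous_on_const
        continuous_on_ray[OF c1]) (auto intro!: continuous_intros)
  have der: "((\<lambda>y. t ^ j *\<^sub>R h (?p y t)) has_derivative blinfun_apply (fx y t)) (at y within ?U)"
    if yt: "y \<in> ?U" "t \<in> cbox 0 1" for y t
  proof -
    have "((\<lambda>y. ?p y t) has_derivative (\<lambda>w. t *\<^sub>R w)) (at y within ?U)"
      by (auto intro!: derivative_eq_intros)
    from has_derivative_compose[OF this Dh[OF ray_in_ball[OF yt]]]
    have "((\<lambda>y. h (?p y t)) has_derivative (\<lambda>w. frechet_derivative h (at (?p y t)) (t *\<^sub>R w))) (at y within ?U)" .
    from has_derivative_scaleR_right[OF this, of "t ^ j"]
    have "((\<lambda>y. t ^ j *\<^sub>R h (?p y t)) has_derivative (\<lambda>w. t ^ j *\<^sub>R frechet_derivative h (at (?p y t)) (t *\<^sub>R w))) (at y within ?U)" .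
    moreover have "t ^ j *\<^sub>R frechet_derivative h (at (?p y t)) (t *\<^sub>R w) = blinfun_apply (fx y t) w" for w
      using linear_cmul[OF has_derivative_linear[OF Dh[OF ray_in_ball[OF yt]]]] fx_apply[OF yt]
      by (simp add: mult.commute)
    ultimately show ?thesis by (simp only:)
  qed
  have "((\<lambda>y. integral (cbox 0 1) (\<lambda>t. t ^ j *\<^sub>R h (?p y t))) has_derivative integral (cbox 0 1) (fx y)) (at y within ?U)"
    by (rule leibniz_rule[OF der ray_integrable[OF c0] cfx y convex_ball])
  moreover have eq: "blinfun_apply (integral (cbox 0 1) (fx y)) w = ray_integral (Suc j) a (\<lambda>z. frechet_derivative h (at z) w) y" for w
  proof -
    have "continuous_on (cbox 0 1) (\<lambda>t. case (y, t) of (y, t) \<Rightarrow> fx y t)"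
      by (rule continuous_on_compose2[OF cfx]) (use y in \<open>auto intro!: continuous_intros\<close>)
    then have "fx y integrable_on cbox 0 1" by (intro integrable_continuous) simp
    then have "blinfun_apply (integral (cbox 0 1) (fx y)) w = integral (cbox 0 1) (\<lambda>t. blinfun_apply (fx y t) w)"
      by (rule blinfun_apply_integral)
    also have "\<dots> = ray_integral (Suc j) a (\<lambda>z. frechet_derivative h (at z) w) y"
      unfolding ray_integral_def by (rule integral_cong) (rule fx_apply[OF y])
    finally show ?thesis .
  qed
  ultimately show ?thesis
    unfolding ext[of "blinfun_apply (integral (cbox 0 1) (fx y))", OF eq] at_within_open[OF y open_ball]
    by (simp only: ray_integral_def[abs_def])
qed

lemma Ck_on_ray_integral:
  fixes h :: "'a::euclidean_space \<Rightarrow> 'b::euclidean_space"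
  shows "Ck_on k (ball a r) h \<Longrightarrow> Ck_on k (ball a r) (ray_integral j a h)"
proof (induction k arbitrary: h j)
  case 0
  then have "continuous_on (ball a r) h" by simp
  then have "continuous_on (ball a r \<times> cbox 0 1) (\<lambda>(y, t). t ^ j *\<^sub>R h (a + t *\<^sub>R (y - a)))"
    unfolding split_beta by (rule continuous_on_ray) (auto intro!: continuous_intros)
  then show ?case unfolding ray_integral_def[abs_def] Ck_on.simps
    by (rule integral_continuous_on_param)
next
  case (Suc k)
  have "Ck_on (Suc 0) (ball a r) h"
    using Suc.prems
  proof (induction k)
    case (Suc k)
    then show ?case using Ck_on_SucD[OF Suc.prems] by blast
  qed
  then show ?case
    by (rule Ck_on_SucI[OF open_ball ray_integral_has_derivative]) (use Suc in simp_all)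
qed

lemma smooth_on_ray_integral:
  fixes h :: "'a::euclidean_space \<Rightarrow> 'b::euclidean_space"
  shows "smooth_on (ball a r) h \<Longrightarrow> smooth_on (ball a r) (ray_integral j a h)"
  unfolding smooth_on_def by (rule allI, rule Ck_on_ray_integral) simp

lemma has_derivative_ray_integral:
  fixes h :: "'a::euclidean_space \<Rightarrow> 'b::euclidean_space"
  assumes "smooth_on (ball a r) h" "y \<in> ball a r"
  shows "(ray_integral j a h has_derivative
    (\<lambda>w. ray_integral (Suc j) a (\<lambda>z. frechet_derivative h (at z) w) y)) (at y)"
proof -
  have "Ck_on (Suc 0) (ball a r) h" using assms(1) unfolding smooth_on_def by (rule spec)
  from ray_integral_has_derivative[OF this assms(2)] show ?thesis .
qed

lemma ray_vector_derivative:
  fixes h :: "'a::euclidean_space \<Rightarrow> 'b::euclidean_space"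
  assumes h: "smooth_on (ball a r) h" and y: "y \<in> ball a r" and t: "t \<in> cbox 0 1"
  shows "((\<lambda>t. h (a + t *\<^sub>R (y - a))) has_vector_derivative
     frechet_derivative h (at (a + t *\<^sub>R (y - a))) (y - a)) (at t within cbox 0 1)"
proof -
  note D = smooth_on_has_derivative[OF h ray_in_ball[OF y t]]
  have "((\<lambda>t. a + t *\<^sub>R (y - a)) has_derivative (\<lambda>s. s *\<^sub>R (y - a))) (at t within cbox 0 1)"
    by (auto intro!: derivative_eq_intros)
  from has_derivative_compose[OF this D]
  show ?thesis
    by (simp add: has_vector_derivative_def linear_cmul[OF has_derivative_linear[OF D]])
qed

lemma increment_eq_ray_integral:
  fixes h :: "'a::euclidean_space \<Rightarrow> 'b::euclidean_space"
  assumes h: "smooth_on (ball a r) h" and y: "y \<in> ball a r"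
  shows "h y - h a = ray_integral 0 a (\<lambda>z. frechet_derivative h (at z) (y - a)) y"
proof -
  have "((\<lambda>t. frechet_derivative h (at (a + t *\<^sub>R (y - a))) (y - a)) has_integral
      h (a + 1 *\<^sub>R (y - a)) - h (a + 0 *\<^sub>R (y - a))) {0..1}"
    using ray_vector_derivative[OF h y] by (intro fundamental_theorem_of_calculus) auto
  then show ?thesis by (simp add: ray_integral_def integral_unique)
qed

text \<open>The integral of the derivative of \<open>t *\<^sub>R h (a + t *\<^sub>R (y - a))\<close> over the unit interval.\<close>

lemma value_eq_ray_integral:
  fixes h :: "'a::euclidean_space \<Rightarrow> 'b::euclidean_space"
  assumes h: "smooth_on (ball a r) h" and y: "y \<in> ball a r"
  shows "h y = ray_integral 0 a h y + ray_integral 1 a (\<lambda>z. frechet_derivative h (at z) (y - a)) y"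
proof -
  let ?p = "\<lambda>t. a + t *\<^sub>R (y - a)"
  have "((\<lambda>t. t *\<^sub>R h (?p t)) has_vector_derivative
      (t *\<^sub>R frechet_derivative h (at (?p t)) (y - a) + 1 *\<^sub>R h (?p t))) (at t within {0..1})"
    if "t \<in> {0..1}" for t
    using has_vector_derivative_scaleR[OF DERIV_ident ray_vector_derivative[OF h y, of t]] that by simp
  then have "((\<lambda>t. t *\<^sub>R frechet_derivative h (at (?p t)) (y - a) + 1 *\<^sub>R h (?p t)) has_integral
      1 *\<^sub>R h (?p 1) - 0 *\<^sub>R h (?p 0)) {0..1}"
    by (intro fundamental_theorem_of_calculus) auto
  then have "h y = integral (cbox 0 1) (\<lambda>t. t ^ 1 *\<^sub>R frechet_derivative h (at (?p t)) (y - a) + t ^ 0 *\<^sub>R h (?p t))"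
    by (simp add: integral_unique)
  also have "\<dots> = ray_integral 1 a (\<lambda>z. frechet_derivative h (at z) (y - a)) y + ray_integral 0 a h y"
    unfolding ray_integral_def
    by (rule integral_add; rule ray_integrable[OF smooth_on_continuous])
      (use h y smooth_on_frechet in blast)+
  finally show ?thesis by simp
qed

text \<open>By Hadamard's lemma \<open>u(y) = u(a) + \<Sum> (y\<^sub>i - a\<^sub>i) g\<^sub>i(y)\<close> with smooth \<open>g\<^sub>i\<close>, a derivation at
  \<open>a\<close> is determined by its values on the coordinates.\<close>

lemma derivation_at_eq_sum_partials:
  fixes L :: "('a::euclidean_space \<Rightarrow> real) \<Rightarrow> real"
  assumes r: "r > 0"
    and add: "\<And>f g. smooth_on (ball a r) f \<Longrightarrow> smooth_on (ball a r) g \<Longrightarrow> L (\<lambda>y. f y + g y) = L f + L g"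
    and mult: "\<And>f g. smooth_on (ball a r) f \<Longrightarrow> smooth_on (ball a r) g \<Longrightarrow> L (\<lambda>y. f y * g y) = L f * g a + f a * L g"
    and const: "\<And>c. L (\<lambda>y. c) = 0"
    and cong: "\<And>f g. smooth_on (ball a r) f \<Longrightarrow> (\<And>y. y \<in> ball a r \<Longrightarrow> f y = g y) \<Longrightarrow> L f = L g"
    and u: "smooth_on (ball a r) u"
  shows "L u = (\<Sum>i\<in>Basis. L (\<lambda>y. y \<bullet> i) * frechet_derivative u (at a) i)"
proof -
  let ?S = "ball a r"
  define G where "G = (\<lambda>i. ray_integral 0 a (\<lambda>z. frechet_derivative u (at z) i))"
  have sG: "smooth_on ?S (G i)" for i
    unfolding G_def by (rule smooth_on_ray_integral[OF smooth_on_frechet[OF u]])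
  have Ga: "G i a = frechet_derivative u (at a) i" for i
    by (simp add: G_def ray_integral_def)
  have slin: "smooth_on ?S (\<lambda>y. y \<bullet> i)" for i
    by (rule smooth_on_linear) (auto intro: bounded_linear_inner_left)
  have sc: "smooth_on ?S (\<lambda>y. c)" for c :: real by (rule smooth_on_const) simp
  have s1: "smooth_on ?S (\<lambda>y. y \<bullet> i - a \<bullet> i)" for i
    by (rule smooth_on_diff[OF _ slin sc]) simp
  have L1: "L (\<lambda>y. y \<bullet> i - a \<bullet> i) = L (\<lambda>y. y \<bullet> i)" for i
    using add[OF slin sc[of "- (a \<bullet> i)"]] const by simp
  have s2: "smooth_on ?S (\<lambda>y. (y \<bullet> i - a \<bullet> i) * G i y)" for i
    by (rule smooth_on_mult[OF _ s1 sG]) simp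
  have s3: "smooth_on ?S (\<lambda>y. \<Sum>i\<in>I. (y \<bullet> i - a \<bullet> i) * G i y)" for I
    by (rule smooth_on_sum[OF _ s2]) simp
  have had: "u a + (\<Sum>i\<in>Basis. (y \<bullet> i - a \<bullet> i) * G i y) = u y" if y: "y \<in> ?S" for y
  proof -
    have "u y - u a = integral (cbox 0 1) (\<lambda>t. \<Sum>i\<in>Basis. ((y - a) \<bullet> i) *\<^sub>R (t ^ 0 *\<^sub>R frechet_derivative u (at (a + t *\<^sub>R (y - a))) i))"
      unfolding increment_eq_ray_integral[OF u y] ray_integral_def
      by (rule integral_cong)
        (use frechet_derivative_basis_expansion[OF smooth_on_has_derivative[OF u ray_in_ball[OF y]]] in simp)
    also have "\<dots> = (\<Sum>i\<in>Basis. integral (cbox 0 1) (\<lambda>t. ((y - a) \<bullet> i) *\<^sub>R (t ^ 0 *\<^sub>R frechet_derivative u (at (a + t *\<^sub>R (y - a))) i)))"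
      by (rule integral_sum[OF finite_Basis], rule integrable_cmul,
          rule ray_integrable[OF smooth_on_continuous[OF smooth_on_frechet[OF u]] y])
    also have "\<dots> = (\<Sum>i\<in>Basis. ((y - a) \<bullet> i) *\<^sub>R G i y)"
      unfolding G_def ray_integral_def integral_cmul ..
    finally have "u y - u a = (\<Sum>i\<in>Basis. ((y - a) \<bullet> i) *\<^sub>R G i y)" .
    then show ?thesis by (simp add: inner_diff_left algebra_simps)
  qed
  have Lsum: "L (\<lambda>y. \<Sum>i\<in>I. (y \<bullet> i - a \<bullet> i) * G i y) = (\<Sum>i\<in>I. L (\<lambda>y. (y \<bullet> i - a \<bullet> i) * G i y))" if "finite I" for I
    using that
  proof induction
    case empty
    then show ?case by (simp add: const)
  next
    case (insert i I)
    then show ?case by (simp add: add[OF s2 s3])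
  qed
  have "L u = L (\<lambda>y. u a + (\<Sum>i\<in>Basis. (y \<bullet> i - a \<bullet> i) * G i y))"
    by (rule cong[OF u]) (rule had[symmetric])
  also have "\<dots> = (\<Sum>i\<in>Basis. L (\<lambda>y. (y \<bullet> i - a \<bullet> i) * G i y))"
    by (simp add: add[OF sc s3] const Lsum)
  also have "\<dots> = (\<Sum>i\<in>Basis. L (\<lambda>y. y \<bullet> i) * frechet_derivative u (at a) i)"
    by (rule sum.cong[OF refl]) (simp add: mult[OF s1 sG] L1 Ga)
  finally show ?thesis .
qed

text \<open>The commutator of two constant vector fields is a derivation which kills the coordinates.\<close>

lemma second_derivative_symmetric:
  fixes u :: "'a::euclidean_space \<Rightarrow> real"
  assumes u: "smooth_on S u" and S: "open S" "a \<in> S"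
  shows "frechet_derivative (\<lambda>z. frechet_derivative u (at z) v) (at a) w =
         frechet_derivative (\<lambda>z. frechet_derivative u (at z) w) (at a) v"
proof -
  obtain r where r: "r > 0" "ball a r \<subseteq> S" using S openE by blast
  let ?B = "ball a r"
  have u: "smooth_on ?B u" by (rule smooth_on_subset[OF u r(2)])
  have a: "a \<in> ?B" using r by simp
  define D2 where "D2 = (\<lambda>v w (f :: 'a \<Rightarrow> real). frechet_derivative (\<lambda>z. frechet_derivative f (at z) v) (at a) w)"
  have D2_cong: "D2 v w f = D2 v w g" if "\<And>y. y \<in> ?B \<Longrightarrow> f y = g y" for v w f g
    unfolding D2_def
  proof (rule fun_cong[OF frechet_derivative_cong_open[OF open_ball a]])
    fix z assume z: "z \<in> ?B"
    show "frechet_derivative f (at z) v = frechet_derivative g (at z) v"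
      by (rule fun_cong[OF frechet_derivative_cong_open[OF open_ball z that]])
  qed
  have D2_add: "D2 v w (\<lambda>y. f y + g y) = D2 v w f + D2 v w g" if "smooth_on ?B f" "smooth_on ?B g" for v w f g
  proof -
    have "D2 v w (\<lambda>y. f y + g y) = frechet_derivative (\<lambda>z. frechet_derivative f (at z) v + frechet_derivative g (at z) v) (at a) w"
      unfolding D2_def
      by (rule fun_cong[OF frechet_derivative_cong_open[OF open_ball a frechet_derivative_add[OF that]]])
    also have "\<dots> = D2 v w f + D2 v w g"
      unfolding D2_def by (rule frechet_derivative_add[OF smooth_on_frechet[OF that(1)] smooth_on_frechet[OF that(2)] a])
    finally show ?thesis .
  qed
  have D2_mult: "D2 v w (\<lambda>y. f y * g y) = f a * D2 v w g + frechet_derivative f (at a) w * frechet_derivative g (at a) v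
      + (frechet_derivative f (at a) v * frechet_derivative g (at a) w + D2 v w f * g a)"
    if "smooth_on ?B f" "smooth_on ?B g" for v w f g
  proof -
    note sf = smooth_on_frechet[OF that(1)] and sg = smooth_on_frechet[OF that(2)]
    have "D2 v w (\<lambda>y. f y * g y) = frechet_derivative (\<lambda>z. f z * frechet_derivative g (at z) v + frechet_derivative f (at z) v * g z) (at a) w"
      unfolding D2_def
      by (rule fun_cong[OF frechet_derivative_cong_open[OF open_ball a frechet_derivative_mult[OF that]]])
    also have "\<dots> = frechet_derivative (\<lambda>z. f z * frechet_derivative g (at z) v) (at a) w
        + frechet_derivative (\<lambda>z. frechet_derivative f (at z) v * g z) (at a) w"
      by (rule frechet_derivative_add[OF smooth_on_mult smooth_on_mult a]) (use that sf sg in auto)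
    also have "\<dots> = f a * D2 v w g + frechet_derivative f (at a) w * frechet_derivative g (at a) v
      + (frechet_derivative f (at a) v * frechet_derivative g (at a) w + D2 v w f * g a)"
      unfolding D2_def
      by (simp add: frechet_derivative_mult[OF that(1) sg a] frechet_derivative_mult[OF sf that(2) a])
    finally show ?thesis .
  qed
  have D2_const: "D2 v w (\<lambda>y. c) = 0" for v w c by (simp add: D2_def)
  have D2_lin: "D2 v w (\<lambda>y. y \<bullet> i) = 0" for v w i
    by (simp add: D2_def frechet_derivative_inner_const)
  let ?L = "\<lambda>f. D2 v w f - D2 w v f"
  have "?L u = (\<Sum>i\<in>Basis. ?L (\<lambda>y. y \<bullet> i) * frechet_derivative u (at a) i)"
  proof (rule derivation_at_eq_sum_partials[OF r(1) _ _ _ _ u])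
    fix f g :: "'a \<Rightarrow> real" assume "\<And>y. y \<in> ?B \<Longrightarrow> f y = g y"
    then show "?L f = ?L g" using D2_cong[of f g] by simp
  qed (simp_all add: D2_add D2_mult D2_const algebra_simps)
  then show ?thesis by (simp add: D2_lin) (simp add: D2_def)
qed


section \<open>Integral manifolds of commuting vector fields in Euclidean space\<close>

lemma ray_integral_bound:
  fixes h :: "'a::euclidean_space \<Rightarrow> 'b::euclidean_space"
  assumes h: "continuous_on (ball a r) h" and y: "y \<in> ball a r" and K: "\<And>z. z \<in> ball a r \<Longrightarrow> norm (h z) \<le> K"
  shows "norm (ray_integral j a h y) \<le> K"
proof -
  have "norm (integral {0..1} (\<lambda>t. t ^ j *\<^sub>R h (a + t *\<^sub>R (y - a)))) \<le> K * (1 - 0)"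
  proof (rule integral_bound)
    show "continuous_on {0..1} (\<lambda>t. t ^ j *\<^sub>R h (a + t *\<^sub>R (y - a)))"
      by (rule continuous_on_ray[OF h]) (use y in \<open>auto intro!: continuous_intros\<close>)
    fix t :: real assume t: "t \<in> {0..1}"
    have "norm (t ^ j *\<^sub>R h (a + t *\<^sub>R (y - a))) = t ^ j * norm (h (a + t *\<^sub>R (y - a)))"
      using t by simp
    also have "\<dots> \<le> 1 * K"
      by (rule mult_mono) (use t K[OF ray_in_ball[OF y]] in \<open>auto simp: power_le_one\<close>)
    finally show "norm (t ^ j *\<^sub>R h (a + t *\<^sub>R (y - a))) \<le> K" by simp
  qed simp
  then show ?thesis by (simp add: ray_integral_def)
qed

lemma ray_integral_sum:
  fixes h :: "'i \<Rightarrow> 'a::euclidean_space \<Rightarrow> 'b::euclidean_space"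
  assumes "finite I" "\<And>i. i \<in> I \<Longrightarrow> continuous_on (ball a r) (h i)" "y \<in> ball a r"
  shows "ray_integral j a (\<lambda>z. \<Sum>i\<in>I. c i *\<^sub>R h i z) y = (\<Sum>i\<in>I. c i *\<^sub>R ray_integral j a (h i) y)"
proof -
  have "ray_integral j a (\<lambda>z. \<Sum>i\<in>I. c i *\<^sub>R h i z) y =
      integral (cbox 0 1) (\<lambda>t. \<Sum>i\<in>I. c i *\<^sub>R (t ^ j *\<^sub>R h i (a + t *\<^sub>R (y - a))))"
    by (simp add: ray_integral_def scaleR_sum_right mult.commute)
  also have "\<dots> = (\<Sum>i\<in>I. integral (cbox 0 1) (\<lambda>t. c i *\<^sub>R (t ^ j *\<^sub>R h i (a + t *\<^sub>R (y - a)))))"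
    by (rule integral_sum[OF assms(1)], rule integrable_cmul, rule ray_integrable[OF assms(2,3)])
  finally show ?thesis unfolding ray_integral_def integral_cmul .
qed

lemma ray_integral_diff:
  fixes f h :: "'a::euclidean_space \<Rightarrow> 'b::euclidean_space"
  assumes "continuous_on (ball a r) f" "continuous_on (ball a r) h" "y \<in> ball a r"
  shows "ray_integral j a (\<lambda>z. f z - h z) y = ray_integral j a f y - ray_integral j a h y"
  unfolding ray_integral_def
  by (subst integral_diff[OF ray_integrable[OF assms(1,3)] ray_integrable[OF assms(2,3)], symmetric])
    (simp add: algebra_simps)

text \<open>The ratio \<open>1/4\<close> is the contraction factor of the Picard map below.\<close>

lemma geometric_Cauchy_limit:
  fixes f :: "nat \<Rightarrow> 'a::banach"
  assumes step: "\<And>n. norm (f (Suc n) - f n) \<le> C * (1/4) ^ n" and C: "C \<ge> 0"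
  shows "\<exists>l. f \<longlonglongrightarrow> l \<and> (\<forall>n. norm (f n - l) \<le> 2 * C * (1/4) ^ n)"
proof -
  have k: "norm (f (n + k) - f n) \<le> 2 * C * (1/4) ^ n - 2 * C * (1/4) ^ (n + k)" for n k
  proof (induction k)
    case (Suc k)
    have "norm (f (n + Suc k) - f n) \<le> norm (f (Suc (n + k)) - f (n + k)) + norm (f (n + k) - f n)"
      using norm_triangle_ineq[of "f (Suc (n + k)) - f (n + k)" "f (n + k) - f n"] by simp
    also have "\<dots> \<le> C * (1/4) ^ (n + k) + (2 * C * (1/4) ^ n - 2 * C * (1/4) ^ (n + k))"
      using step[of "n + k"] Suc by linarith
    also have "\<dots> \<le> 2 * C * (1/4) ^ n - 2 * C * (1/4) ^ (n + Suc k)"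
      using C mult_nonneg_nonneg[OF C, of "(1/4) ^ (n + k)"] by simp
    finally show ?case .
  qed simp
  have b: "norm (f m - f n) \<le> 2 * C * (1/4) ^ n" if "m \<ge> n" for m n
    using k[of n "m - n"] that mult_nonneg_nonneg[OF C, of "(1/4) ^ m"] by simp
  have lim0: "(\<lambda>n. 2 * C * (1/4 :: real) ^ n) \<longlonglongrightarrow> 0"
    using tendsto_mult_right_zero[OF LIMSEQ_power_zero[of "1/4 :: real"], of "2 * C"] by simp
  have "Cauchy f"
  proof (rule metric_CauchyI)
    fix e :: real assume "e > 0"
    then have "0 < e / 2" by simp
    from order_tendstoD(2)[OF lim0 this] obtain N where N: "2 * C * (1/4) ^ N < e / 2" by (auto simp: eventually_sequentially)
    have "dist (f m) (f n) < e" if "m \<ge> N" "n \<ge> N" for m n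
    proof -
      have "dist (f m) (f n) \<le> norm (f m - f N) + norm (f n - f N)"
        using norm_triangle_ineq4[of "f m - f N" "f n - f N"] by (simp add: dist_norm)
      then show ?thesis using b[OF that(1)] b[OF that(2)] N by linarith
    qed
    then show "\<exists>M. \<forall>m\<ge>M. \<forall>n\<ge>M. dist (f m) (f n) < e" by blast
  qed
  then obtain l where l: "f \<longlonglongrightarrow> l" using convergent_eq_Cauchy by blast
  have "norm (f n - l) \<le> 2 * C * (1/4) ^ n" for n
  proof -
    have "(\<lambda>m. norm (f m - f n)) \<longlonglongrightarrow> norm (l - f n)" by (intro tendsto_intros l)
    then have "norm (l - f n) \<le> 2 * C * (1/4) ^ n"
      by (rule tendsto_upperbound) (use b in \<open>auto simp: eventually_sequentially\<close>)
    then show ?thesis by (simp add: norm_minus_commute)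
  qed
  with l show ?thesis by blast
qed

text \<open>Vector fields \<open>a i\<close>, indexed by the standard basis of the parameter space, which commute, together with
  the constants for Picard iteration on the parameter ball of radius \<open>r\<close>: a bound \<open>M\<close> for the fields and a
  Lipschitz constant \<open>L\<close> on \<open>cball y0 R\<close>. By \<open>M * r \<le> R\<close> the iterates stay in this ball, and
  \<open>4 * (L * r) \<le> 1\<close> makes the Picard map a contraction.\<close>

locale commuting_fields =
  fixes a :: "'f::euclidean_space \<Rightarrow> 'e::euclidean_space \<Rightarrow> 'e" and S :: "'e set" and y0 :: 'e
    and R L M r :: real
  assumes open_S: "open S" and smooth: "\<And>i. i \<in> Basis \<Longrightarrow> smooth_on S (a i)"
    and commute: "\<And>i j y. i \<in> Basis \<Longrightarrow> j \<in> Basis \<Longrightarrow> y \<in> S \<Longrightarrow>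
      frechet_derivative (a i) (at y) (a j y) = frechet_derivative (a j) (at y) (a i y)"
    and R: "R > 0" "cball y0 R \<subseteq> S"
    and M: "M \<ge> 0" "\<And>y h. y \<in> cball y0 R \<Longrightarrow> norm (\<Sum>i\<in>Basis. (h \<bullet> i) *\<^sub>R a i y) \<le> M * norm (h :: 'f)"
    and L: "L \<ge> 0" "\<And>y h w. y \<in> cball y0 R \<Longrightarrow>
      norm (\<Sum>i\<in>Basis. (h \<bullet> i) *\<^sub>R frechet_derivative (a i) (at y) w) \<le> L * norm (h :: 'f) * norm w"
    and r: "r > 0" "M * r \<le> R" "4 * (L * r) \<le> 1"
begin

text \<open>An integral map \<open>\<phi>\<close> is a solution of \<open>D\<phi>(x) = field (\<phi> x)\<close>; \<open>dfield y h\<close> is the derivative of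
  \<open>\<lambda>y. field y h\<close>.\<close>

definition field :: "'e \<Rightarrow> 'f \<Rightarrow> 'e" where
  "field y h = (\<Sum>i\<in>Basis. (h \<bullet> i) *\<^sub>R a i y)"

definition dfield :: "'e \<Rightarrow> 'f \<Rightarrow> 'e \<Rightarrow> 'e" where
  "dfield y h w = (\<Sum>i\<in>Basis. (h \<bullet> i) *\<^sub>R frechet_derivative (a i) (at y) w)"

text \<open>The integral equation \<open>\<phi>(x) = y0 + \<integral> field (\<phi>(tx)) x dt\<close> along rays. The components of \<open>x\<close> are taken
  out of the integral so that the smoothness of \<open>ray_integral\<close> applies.\<close>

definition picard :: "('f \<Rightarrow> 'e) \<Rightarrow> 'f \<Rightarrow> 'e" where
  "picard \<phi> x = y0 + (\<Sum>i\<in>Basis. (x \<bullet> i) *\<^sub>R ray_integral 0 0 (\<lambda>z. a i (\<phi> z)) x)"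

abbreviation "Bl \<equiv> ball (0::'f) r"

definition admissible :: "('f \<Rightarrow> 'e) \<Rightarrow> bool" where
  "admissible \<phi> \<longleftrightarrow> smooth_on Bl \<phi> \<and> (\<forall>x\<in>Bl. \<phi> x \<in> cball y0 R)"

lemma a_derivative: "y \<in> S \<Longrightarrow> i \<in> Basis \<Longrightarrow> (a i has_derivative frechet_derivative (a i) (at y)) (at y)"
  by (rule smooth_on_has_derivative[OF smooth])

lemma field_derivative:
  assumes "y \<in> S"
  shows "((\<lambda>y. field y h) has_derivative dfield y h) (at y)"
  unfolding field_def dfield_def
  by (rule has_derivative_sum, rule has_derivative_scaleR_right, rule a_derivative[OF assms])

lemma dfield_linear: "y \<in> S \<Longrightarrow> linear (dfield y h)"
  using field_derivative has_derivative_linear by blast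

lemma field_lipschitz:
  assumes "y \<in> cball y0 R" "z \<in> cball y0 R"
  shows "norm (field y h - field z h) \<le> L * norm h * norm (y - z)"
proof (rule differentiable_bound[OF convex_cball[of y0 R] _ _ assms])
  fix w assume w: "w \<in> cball y0 R"
  then show "((\<lambda>y. field y h) has_derivative dfield w h) (at w within cball y0 R)"
    using field_derivative R(2) by (blast intro: has_derivative_at_withinI)
  show "onorm (dfield w h) \<le> L * norm h"
    by (rule onorm_bound) (use L w in \<open>auto simp: dfield_def\<close>)
qed

text \<open>Commutativity of the fields as the compatibility condition for \<open>D\<phi> = field (\<phi>)\<close>.\<close>

lemma dfield_symmetric:
  assumes y: "y \<in> S"
  shows "dfield y h (field y k) = dfield y k (field y h)"
proof -
  have "dfield y h (field y k) = (\<Sum>i\<in>Basis. \<Sum>j\<in>Basis. ((h \<bullet> i) * (k \<bullet> j)) *\<^sub>R frechet_derivative (a i) (at y) (a j y))" for h k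
  proof -
    have "frechet_derivative (a i) (at y) (field y k) = (\<Sum>j\<in>Basis. (k \<bullet> j) *\<^sub>R frechet_derivative (a i) (at y) (a j y))"
      if "i \<in> Basis" for i
      using has_derivative_linear[OF a_derivative[OF y that]] by (simp add: field_def linear_sum linear_cmul)
    then show ?thesis by (simp add: dfield_def scaleR_sum_right)
  qed
  note e = this
  have "dfield y h (field y k) = (\<Sum>j\<in>Basis. \<Sum>i\<in>Basis. ((h \<bullet> i) * (k \<bullet> j)) *\<^sub>R frechet_derivative (a i) (at y) (a j y))"
    unfolding e by (rule sum.swap)
  also have "\<dots> = (\<Sum>j\<in>Basis. \<Sum>i\<in>Basis. ((k \<bullet> j) * (h \<bullet> i)) *\<^sub>R frechet_derivative (a j) (at y) (a i y))"
    by (intro sum.cong refl) (simp add: commute[OF _ _ y] mult.commute)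
  finally show ?thesis unfolding e .
qed

context
  fixes \<phi> assumes adm: "admissible \<phi>"
begin

lemma adm_S: "x \<in> Bl \<Longrightarrow> \<phi> x \<in> S" and adm_cball: "x \<in> Bl \<Longrightarrow> \<phi> x \<in> cball y0 R" and adm_smooth: "smooth_on Bl \<phi>"
  using adm R(2) by (auto simp: admissible_def)

lemma a_comp_smooth: "i \<in> Basis \<Longrightarrow> smooth_on Bl (\<lambda>z. a i (\<phi> z))"
  by (rule smooth_on_compose[OF open_ball _ adm_smooth smooth]) (use adm_S in auto)

lemma field_comp_smooth: "smooth_on Bl (\<lambda>z. field (\<phi> z) h)"
  unfolding field_def
  by (rule smooth_on_sum[OF open_ball], rule smooth_on_scaleR[OF open_ball smooth_on_const[OF open_ball] a_comp_smooth])

lemma a_comp_derivative: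
  assumes "z \<in> Bl" "i \<in> Basis"
  shows "frechet_derivative (\<lambda>z. a i (\<phi> z)) (at z) w = frechet_derivative (a i) (at (\<phi> z)) (frechet_derivative \<phi> (at z) w)"
  using frechet_derivative_at[OF has_derivative_compose[OF smooth_on_has_derivative[OF adm_smooth assms(1)] a_derivative[OF adm_S[OF assms(1)] assms(2)]]]
  by metis

lemma field_comp_derivative:
  assumes "z \<in> Bl"
  shows "frechet_derivative (\<lambda>z. field (\<phi> z) h) (at z) w = dfield (\<phi> z) h (frechet_derivative \<phi> (at z) w)"
  using frechet_derivative_at[OF has_derivative_compose[OF smooth_on_has_derivative[OF adm_smooth assms(1)] field_derivative[OF adm_S[OF assms(1)]]]]
  by metis

lemma picard_eq: "x \<in> Bl \<Longrightarrow> picard \<phi> x = y0 + ray_integral 0 0 (\<lambda>z. field (\<phi> z) x) x"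
  unfolding picard_def field_def
  by (subst ray_integral_sum[OF finite_Basis smooth_on_continuous[OF a_comp_smooth]]) auto

lemma picard_derivative:
  assumes x: "x \<in> Bl"
  shows "(picard \<phi> has_derivative (\<lambda>h. ray_integral 0 0 (\<lambda>z. field (\<phi> z) h) x
    + ray_integral 1 0 (\<lambda>z. dfield (\<phi> z) x (frechet_derivative \<phi> (at z) h)) x)) (at x)"
proof -
  have "((\<lambda>x. y0 + (\<Sum>i\<in>Basis. (x \<bullet> i) *\<^sub>R ray_integral 0 0 (\<lambda>z. a i (\<phi> z)) x)) has_derivative
    (\<lambda>h. 0 + (\<Sum>i\<in>Basis. (x \<bullet> i) *\<^sub>R ray_integral (Suc 0) 0 (\<lambda>z. frechet_derivative (\<lambda>z. a i (\<phi> z)) (at z) h) x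
      + (h \<bullet> i) *\<^sub>R ray_integral 0 0 (\<lambda>z. a i (\<phi> z)) x))) (at x)"
    by (rule has_derivative_add[OF has_derivative_const], rule has_derivative_sum,
        rule has_derivative_scaleR[OF bounded_linear_imp_has_derivative[OF bounded_linear_inner_left]
          has_derivative_ray_integral[OF a_comp_smooth x]])
  moreover have "0 + (\<Sum>i\<in>Basis. (x \<bullet> i) *\<^sub>R ray_integral (Suc 0) 0 (\<lambda>z. frechet_derivative (\<lambda>z. a i (\<phi> z)) (at z) h) x
      + (h \<bullet> i) *\<^sub>R ray_integral 0 0 (\<lambda>z. a i (\<phi> z)) x) =
    ray_integral 0 0 (\<lambda>z. field (\<phi> z) h) x + ray_integral 1 0 (\<lambda>z. dfield (\<phi> z) x (frechet_derivative \<phi> (at z) h)) x" for h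
  proof -
    have "ray_integral 1 0 (\<lambda>z. dfield (\<phi> z) x (frechet_derivative \<phi> (at z) h)) x =
      ray_integral 1 0 (\<lambda>z. \<Sum>i\<in>Basis. (x \<bullet> i) *\<^sub>R frechet_derivative (\<lambda>z. a i (\<phi> z)) (at z) h) x"
      unfolding ray_integral_def
      by (rule integral_cong) (use ray_in_ball[OF x] in \<open>simp add: dfield_def a_comp_derivative\<close>)
    also have "\<dots> = (\<Sum>i\<in>Basis. (x \<bullet> i) *\<^sub>R ray_integral 1 0 (\<lambda>z. frechet_derivative (\<lambda>z. a i (\<phi> z)) (at z) h) x)"
      by (rule ray_integral_sum[OF finite_Basis smooth_on_continuous[OF smooth_on_frechet[OF a_comp_smooth]] x])
    finally have 1: "ray_integral 1 0 (\<lambda>z. dfield (\<phi> z) x (frechet_derivative \<phi> (at z) h)) x =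
      (\<Sum>i\<in>Basis. (x \<bullet> i) *\<^sub>R ray_integral 1 0 (\<lambda>z. frechet_derivative (\<lambda>z. a i (\<phi> z)) (at z) h) x)" .
    have 2: "ray_integral 0 0 (\<lambda>z. field (\<phi> z) h) x = (\<Sum>i\<in>Basis. (h \<bullet> i) *\<^sub>R ray_integral 0 0 (\<lambda>z. a i (\<phi> z)) x)"
      unfolding field_def by (rule ray_integral_sum[OF finite_Basis smooth_on_continuous[OF a_comp_smooth] x])
    show ?thesis unfolding 1 2 by (simp add: sum.distrib)
  qed
  ultimately show ?thesis unfolding picard_def[abs_def] by (simp only:)
qed

lemma picard_admissible: "admissible (picard \<phi>)"
  unfolding admissible_def
proof (intro conjI ballI)
  show "smooth_on Bl (picard \<phi>)"
    unfolding picard_def[abs_def]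
    by (rule smooth_on_add[OF open_ball smooth_on_const[OF open_ball]], rule smooth_on_sum[OF open_ball],
        rule smooth_on_scaleR[OF open_ball smooth_on_linear[OF open_ball bounded_linear_inner_left]
          smooth_on_ray_integral[OF a_comp_smooth]])
  fix x assume x: "x \<in> Bl"
  have "norm (ray_integral 0 0 (\<lambda>z. field (\<phi> z) x) x) \<le> M * norm x"
    by (rule ray_integral_bound[OF smooth_on_continuous[OF field_comp_smooth] x])
      (use M(2) adm_cball in \<open>simp add: field_def\<close>)
  also have "\<dots> \<le> M * r" using x M(1) by (intro mult_left_mono) auto
  finally show "picard \<phi> x \<in> cball y0 R" using r(2) by (simp add: picard_eq[OF x] dist_norm)
qed

text \<open>Let \<open>e = D\<phi> - field (\<phi>)\<close> be the error of \<open>\<phi>\<close>. Both \<open>D(picard \<phi>) h\<close> and \<open>field (\<phi>) h\<close> are ray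
  integrals, and they differ by the ray integral of
  \<open>dfield (\<phi>) x (D\<phi> h) - dfield (\<phi>) h (D\<phi> x)\<close>. By the symmetry of \<open>dfield\<close> only the error
  survives in it, and \<open>2 * L * r \<le> 1/2\<close> halves the bound. The term \<open>L * \<delta>\<close> accounts for evaluating
  \<open>field\<close> at \<open>picard \<phi>\<close> in place of \<open>\<phi>\<close>.\<close>

lemma picard_error:
  assumes \<epsilon>: "\<epsilon> \<ge> 0" "\<And>z h. z \<in> Bl \<Longrightarrow> norm (frechet_derivative \<phi> (at z) h - field (\<phi> z) h) \<le> \<epsilon> * norm h"
    and \<delta>: "\<And>z. z \<in> Bl \<Longrightarrow> norm (picard \<phi> z - \<phi> z) \<le> \<delta>" and x: "x \<in> Bl"
  shows "norm (frechet_derivative (picard \<phi>) (at x) h - field (picard \<phi> x) h) \<le> (\<epsilon> / 2 + L * \<delta>) * norm h"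
proof -
  let ?D = "\<lambda>z h. frechet_derivative \<phi> (at z) h"
  let ?p = "\<lambda>z. dfield (\<phi> z) x (?D z h)" and ?q = "\<lambda>z. dfield (\<phi> z) h (?D z x)"
  have sq: "continuous_on Bl (\<lambda>z. dfield (\<phi> z) h (?D z k))" for h k
  proof -
    have "continuous_on Bl (\<lambda>z. frechet_derivative (\<lambda>z. field (\<phi> z) h) (at z) k)"
      by (rule smooth_on_continuous[OF smooth_on_frechet[OF field_comp_smooth]])
    then show ?thesis by (simp add: field_comp_derivative cong: continuous_on_cong_simp)
  qed
  have "field (\<phi> x) h = ray_integral 0 0 (\<lambda>z. field (\<phi> z) h) x
      + ray_integral 1 0 (\<lambda>z. frechet_derivative (\<lambda>z. field (\<phi> z) h) (at z) (x - 0)) x"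
    by (rule value_eq_ray_integral[OF field_comp_smooth x])
  also have "ray_integral 1 0 (\<lambda>z. frechet_derivative (\<lambda>z. field (\<phi> z) h) (at z) (x - 0)) x = ray_integral 1 0 ?q x"
    unfolding ray_integral_def
    by (rule integral_cong) (use ray_in_ball[OF x] in \<open>simp add: field_comp_derivative\<close>)
  finally have 1: "field (\<phi> x) h = ray_integral 0 0 (\<lambda>z. field (\<phi> z) h) x + ray_integral 1 0 ?q x" .
  have "frechet_derivative (picard \<phi>) (at x) h = ray_integral 0 0 (\<lambda>z. field (\<phi> z) h) x + ray_integral 1 0 ?p x"
    by (simp only: frechet_derivative_at[OF picard_derivative[OF x], symmetric])
  then have "frechet_derivative (picard \<phi>) (at x) h - field (\<phi> x) h = ray_integral 1 0 (\<lambda>z. ?p z - ?q z) x"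
    unfolding 1 ray_integral_diff[OF sq sq x] by simp
  also have "norm \<dots> \<le> \<epsilon> / 2 * norm h"
  proof (rule ray_integral_bound[OF continuous_on_diff[OF sq sq] x])
    fix z assume z: "z \<in> Bl"
    have S: "\<phi> z \<in> S" by (rule adm_S[OF z])
    let ?e = "\<lambda>h. ?D z h - field (\<phi> z) h"
    have "?p z - ?q z = dfield (\<phi> z) x (?e h) - dfield (\<phi> z) h (?e x)"
      using dfield_symmetric[OF S, of x h] by (simp add: linear_diff[OF dfield_linear[OF S]])
    also have "norm \<dots> \<le> norm (dfield (\<phi> z) x (?e h)) + norm (dfield (\<phi> z) h (?e x))"
      by (rule norm_triangle_ineq4)
    also have "\<dots> \<le> L * norm x * (\<epsilon> * norm h) + L * norm h * (\<epsilon> * norm x)"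
    proof (rule add_mono)
      have "norm (dfield (\<phi> z) u (?e k)) \<le> L * norm u * (\<epsilon> * norm k)" for u k
      proof -
        have "norm (dfield (\<phi> z) u (?e k)) \<le> L * norm u * norm (?e k)"
          unfolding dfield_def by (rule L(2)[OF adm_cball[OF z]])
        also have "\<dots> \<le> L * norm u * (\<epsilon> * norm k)"
          by (rule mult_left_mono[OF \<epsilon>(2)[OF z]]) (simp add: L(1))
        finally show ?thesis .
      qed
      then show "norm (dfield (\<phi> z) x (?e h)) \<le> L * norm x * (\<epsilon> * norm h)"
        "norm (dfield (\<phi> z) h (?e x)) \<le> L * norm h * (\<epsilon> * norm x)" by blast+
    qed
    also have "\<dots> = (2 * (L * norm x)) * (\<epsilon> * norm h)" by (simp add: algebra_simps)
    also have "\<dots> \<le> 1 / 2 * (\<epsilon> * norm h)"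
    proof (rule mult_right_mono)
      have "L * norm x \<le> L * r" using x L(1) by (intro mult_left_mono) auto
      then show "2 * (L * norm x) \<le> 1 / 2" using r(3) by linarith
    qed (use \<epsilon>(1) in simp)
    finally show "norm (?p z - ?q z) \<le> \<epsilon> / 2 * norm h" by simp
  qed
  finally have 2: "norm (frechet_derivative (picard \<phi>) (at x) h - field (\<phi> x) h) \<le> \<epsilon> / 2 * norm h" .
  have "picard \<phi> x \<in> cball y0 R" using picard_admissible x by (simp add: admissible_def)
  then have "norm (field (\<phi> x) h - field (picard \<phi> x) h) \<le> L * norm h * norm (\<phi> x - picard \<phi> x)"
    by (rule field_lipschitz[OF adm_cball[OF x]])
  also have "\<dots> \<le> L * norm h * \<delta>"
    by (rule mult_left_mono) (use \<delta>[OF x] L(1) in \<open>auto simp: norm_minus_commute\<close>)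
  finally have 3: "norm (field (\<phi> x) h - field (picard \<phi> x) h) \<le> L * \<delta> * norm h" by (simp add: algebra_simps)
  have "norm (frechet_derivative (picard \<phi>) (at x) h - field (picard \<phi> x) h) \<le>
      norm (frechet_derivative (picard \<phi>) (at x) h - field (\<phi> x) h) + norm (field (\<phi> x) h - field (picard \<phi> x) h)"
    using norm_triangle_ineq[of "frechet_derivative (picard \<phi>) (at x) h - field (\<phi> x) h" "field (\<phi> x) h - field (picard \<phi> x) h"] by simp
  then show ?thesis using 2 3 by (simp add: algebra_simps)
qed

end

lemma picard_contraction:
  assumes adm: "admissible \<phi>" "admissible \<psi>" and \<delta>: "\<And>z. z \<in> Bl \<Longrightarrow> norm (\<phi> z - \<psi> z) \<le> \<delta>" and x: "x \<in> Bl"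
  shows "norm (picard \<phi> x - picard \<psi> x) \<le> \<delta> / 4"
proof -
  note c = smooth_on_continuous[OF field_comp_smooth]
  have d0: "\<delta> \<ge> 0" using \<delta>[OF x] norm_ge_zero order_trans by blast
  have "picard \<phi> x - picard \<psi> x = ray_integral 0 0 (\<lambda>z. field (\<phi> z) x - field (\<psi> z) x) x"
    unfolding picard_eq[OF adm(1) x] picard_eq[OF adm(2) x] ray_integral_diff[OF c[OF adm(1)] c[OF adm(2)] x] by simp
  also have "norm \<dots> \<le> \<delta> / 4"
  proof (rule ray_integral_bound[OF continuous_on_diff[OF c[OF adm(1)] c[OF adm(2)]] x])
    fix z assume z: "z \<in> Bl"
    have "norm (field (\<phi> z) x - field (\<psi> z) x) \<le> L * norm x * norm (\<phi> z - \<psi> z)"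
      by (rule field_lipschitz[OF adm_cball[OF adm(1) z] adm_cball[OF adm(2) z]])
    also have "\<dots> \<le> (1 / 4) * \<delta>"
    proof (rule mult_mono)
      have "L * norm x \<le> L * r" using x L(1) by (intro mult_left_mono) auto
      then show "L * norm x \<le> 1 / 4" using r(3) by linarith
    qed (use \<delta>[OF z] d0 in auto)
    finally show "norm (field (\<phi> z) x - field (\<psi> z) x) \<le> \<delta> / 4" by simp
  qed
  finally show ?thesis .
qed

definition iterate :: "nat \<Rightarrow> 'f \<Rightarrow> 'e" where
  "iterate n = (picard ^^ n) (\<lambda>x. y0)"

lemma iterate_Suc: "iterate (Suc n) = picard (iterate n)"
  by (simp add: iterate_def)

lemma iterate_admissible: "admissible (iterate n)"
proof (induction n)
  case 0
  show ?case using R(1) by (simp add: iterate_def admissible_def smooth_on_const)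
next
  case (Suc n)
  then show ?case unfolding iterate_Suc by (rule picard_admissible)
qed

lemma iterate_step: "x \<in> Bl \<Longrightarrow> norm (iterate (Suc n) x - iterate n x) \<le> R * (1/4) ^ n"
proof (induction n arbitrary: x)
  case 0
  have "iterate (Suc 0) x \<in> cball y0 R" using iterate_admissible 0 by (simp add: admissible_def)
  then show ?case by (simp add: iterate_def dist_norm norm_minus_commute)
next
  case (Suc n)
  have "norm (picard (iterate (Suc n)) x - picard (iterate n) x) \<le> R * (1/4) ^ n / 4"
    by (rule picard_contraction[OF iterate_admissible iterate_admissible Suc.IH Suc.prems])
  then show ?case by (simp add: iterate_Suc)
qed

text \<open>The bound solves the recursion \<open>\<epsilon>\<^sub>0 = M\<close>, \<open>\<epsilon>\<^bsub>n+1\<^esub> = \<epsilon>\<^sub>n / 2 + L * R / 4\<^sup>n\<close> given by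
  \<open>picard_error\<close> and \<open>iterate_step\<close>.\<close>

lemma iterate_error:
  "z \<in> Bl \<Longrightarrow> norm (frechet_derivative (iterate n) (at z) h - field (iterate n z) h)
    \<le> ((M + 4 * L * R) * (1/2) ^ n - 4 * L * R * (1/4) ^ n) * norm h"
proof (induction n arbitrary: z h)
  case 0
  have "norm (field y0 h) \<le> M * norm h" using M(2)[of y0 h] R(1) by (simp add: field_def)
  then show ?case by (simp add: iterate_def)
next
  case (Suc n)
  let ?\<epsilon> = "(M + 4 * L * R) * (1/2) ^ n - 4 * L * R * (1/4) ^ n"
  have "(4 * L * R) * (1/4) ^ n \<le> (M + 4 * L * R) * (1/2 :: real) ^ n"
    using M(1) L(1) R(1) by (intro mult_mono power_mono) auto
  then have \<epsilon>: "?\<epsilon> \<ge> 0" by simp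
  have "norm (frechet_derivative (picard (iterate n)) (at z) h - field (picard (iterate n) z) h)
      \<le> (?\<epsilon> / 2 + L * (R * (1/4) ^ n)) * norm h"
    by (rule picard_error[OF iterate_admissible \<epsilon> Suc.IH _ Suc.prems])
      (use iterate_step in \<open>auto simp: iterate_Suc\<close>)
  also have "?\<epsilon> / 2 + L * (R * (1/4) ^ n) = (M + 4 * L * R) * (1/2) ^ Suc n - 4 * L * R * (1/4) ^ Suc n"
    by (simp add: field_simps)
  finally show ?case by (simp add: iterate_Suc)
qed

text \<open>The iterates converge to some \<open>\<phi>\<close> and, by the error bound, their derivatives converge uniformly to
  \<open>field (\<phi>)\<close>.\<close>

lemma exists_integral_map:
  "\<exists>\<phi>. \<phi> 0 = y0 \<and> (\<forall>x\<in>Bl. \<phi> x \<in> S \<and> (\<phi> has_derivative field (\<phi> x)) (at x))"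
proof -
  have "\<exists>l. (\<lambda>n. iterate n x) \<longlonglongrightarrow> l \<and> (\<forall>n. norm (iterate n x - l) \<le> 2 * R * (1/4) ^ n)" if "x \<in> Bl" for x
    by (rule geometric_Cauchy_limit[OF iterate_step[OF that]]) (use R in simp)
  then obtain \<phi> where lim: "\<And>x. x \<in> Bl \<Longrightarrow> (\<lambda>n. iterate n x) \<longlonglongrightarrow> \<phi> x"
    and rate: "\<And>x n. x \<in> Bl \<Longrightarrow> norm (iterate n x - \<phi> x) \<le> 2 * R * (1/4) ^ n"
    by metis
  have c: "\<phi> x \<in> cball y0 R" if "x \<in> Bl" for x
    by (rule closed_sequentially[OF closed_cball _ lim[OF that]])
      (use iterate_admissible that in \<open>simp add: admissible_def\<close>)
  have z0: "(0::'f) \<in> Bl" using r(1) by simp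
  have "iterate n 0 = y0" for n
    by (cases n) (simp_all add: iterate_def picard_def)
  then have p0: "\<phi> 0 = y0" using LIMSEQ_unique[OF lim[OF z0]] by simp
  let ?b = "\<lambda>n. (M + 4 * L * R) * (1/2) ^ n + L * (2 * R * (1/4) ^ n)"
  have b0: "?b \<longlonglongrightarrow> 0"
  proof -
    have "?b \<longlonglongrightarrow> (M + 4 * L * R) * 0 + L * (2 * R * 0)"
      by (intro tendsto_intros LIMSEQ_power_zero) simp_all
    then show ?thesis by simp
  qed
  have est: "norm (frechet_derivative (iterate n) (at x) h - field (\<phi> x) h) \<le> ?b n * norm h" if x: "x \<in> Bl" for n x h
  proof -
    have 1: "norm (frechet_derivative (iterate n) (at x) h - field (iterate n x) h) \<le> (M + 4 * L * R) * (1/2) ^ n * norm h"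
    proof (rule order_trans[OF iterate_error[OF x] mult_right_mono])
      show "(M + 4 * L * R) * (1/2) ^ n - 4 * L * R * (1/4) ^ n \<le> (M + 4 * L * R) * (1/2) ^ n"
        using L(1) R(1) by simp
    qed simp
    have "norm (field (iterate n x) h - field (\<phi> x) h) \<le> L * norm h * norm (iterate n x - \<phi> x)"
      by (rule field_lipschitz[OF adm_cball[OF iterate_admissible x] c[OF x]])
    also have "\<dots> \<le> L * norm h * (2 * R * (1/4) ^ n)"
      by (rule mult_left_mono[OF rate[OF x]]) (simp add: L(1))
    finally have 2: "norm (field (iterate n x) h - field (\<phi> x) h) \<le> L * (2 * R * (1/4) ^ n) * norm h"
      by (simp add: algebra_simps)
    have "norm (frechet_derivative (iterate n) (at x) h - field (\<phi> x) h) \<le>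
      norm (frechet_derivative (iterate n) (at x) h - field (iterate n x) h) + norm (field (iterate n x) h - field (\<phi> x) h)"
      using norm_triangle_ineq[of "frechet_derivative (iterate n) (at x) h - field (iterate n x) h" "field (iterate n x) h - field (\<phi> x) h"] by simp
    then show ?thesis using 1 2 by (simp add: distrib_right)
  qed
  have "\<exists>G. \<forall>x\<in>Bl. (\<lambda>n. iterate n x) \<longlonglongrightarrow> G x \<and> (G has_derivative field (\<phi> x)) (at x within Bl)"
  proof (rule has_derivative_sequence[where f=iterate and f'="\<lambda>n x. frechet_derivative (iterate n) (at x)"
        and g'="\<lambda>x. field (\<phi> x)", OF convex_ball _ _ z0 lim[OF z0]])
    show "(iterate n has_derivative frechet_derivative (iterate n) (at x)) (at x within Bl)" if "x \<in> Bl" for n x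
      by (rule has_derivative_at_withinI[OF smooth_on_has_derivative[OF adm_smooth[OF iterate_admissible] that]])
    fix e :: real assume "e > 0"
    then have "\<forall>\<^sub>F n in sequentially. ?b n < e" by (rule order_tendstoD(2)[OF b0])
    then show "\<forall>\<^sub>F n in sequentially. \<forall>x\<in>Bl. \<forall>h. norm (frechet_derivative (iterate n) (at x) h - field (\<phi> x) h) \<le> e * norm h"
    proof (rule eventually_mono)
      fix n assume n: "?b n < e"
      show "\<forall>x\<in>Bl. \<forall>h. norm (frechet_derivative (iterate n) (at x) h - field (\<phi> x) h) \<le> e * norm h"
      proof (intro ballI allI)
        fix x h assume "x \<in> Bl"
        then show "norm (frechet_derivative (iterate n) (at x) h - field (\<phi> x) h) \<le> e * norm h"
          using order_trans[OF est mult_right_mono[OF less_imp_le[OF n] norm_ge_zero]] by blast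
      qed
    qed
  qed
  then obtain G where G: "\<And>x. x \<in> Bl \<Longrightarrow> (\<lambda>n. iterate n x) \<longlonglongrightarrow> G x"
    "\<And>x. x \<in> Bl \<Longrightarrow> (G has_derivative field (\<phi> x)) (at x within Bl)" by blast
  have eq: "G x = \<phi> x" if "x \<in> Bl" for x using LIMSEQ_unique[OF G(1)[OF that] lim[OF that]] .
  have "(\<phi> has_derivative field (\<phi> x)) (at x)" if x: "x \<in> Bl" for x
  proof -
    have "(G has_derivative field (\<phi> x)) (at x)" using G(2)[OF x] at_within_open[OF x open_ball] by simp
    then show ?thesis by (rule has_derivative_transform_within_open[OF _ open_ball x]) (rule eq)
  qed
  then show ?thesis using p0 c R(2) by blast
qed

end

text \<open>Bootstrapping: the right-hand side of the equation is as regular as \<open>\<phi>\<close>.\<close>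

lemma smooth_integral_map:
  fixes \<phi> :: "'f::euclidean_space \<Rightarrow> 'e::euclidean_space"
  assumes "open W" "\<And>x. x \<in> W \<Longrightarrow> \<phi> x \<in> S" "\<And>i. i \<in> Basis \<Longrightarrow> smooth_on S (a i)"
    and D: "\<And>x. x \<in> W \<Longrightarrow> (\<phi> has_derivative (\<lambda>h. \<Sum>i\<in>Basis. (h \<bullet> i) *\<^sub>R a i (\<phi> x))) (at x)"
  shows "smooth_on W \<phi>"
proof -
  have "Ck_on k W \<phi>" for k
  proof (induction k)
    case 0
    show ?case unfolding Ck_on.simps
      by (rule continuous_at_imp_continuous_on) (use D has_derivative_continuous in blast)
  next
    case (Suc k)
    show ?case
    proof (rule Ck_on_SucI[OF assms(1) D])
      fix v :: 'f
      have a: "Ck_on k S (a i)" if "i \<in> Basis" for i using assms(3)[OF that] by (simp add: smooth_on_def)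
      show "Ck_on k W (\<lambda>x. \<Sum>i\<in>Basis. (v \<bullet> i) *\<^sub>R a i (\<phi> x))"
        by (rule Ck_on_sum[OF assms(1)], rule Ck_on_bilinear[OF assms(1) bounded_bilinear_scaleR Ck_on_const[OF assms(1)]],
            rule Ck_on_compose[OF assms(1) _ Suc a]) (use assms(2) in auto)
    qed
  qed
  then show ?thesis by (simp add: smooth_on_def)
qed

text \<open>Compactness of a closed ball in \<open>S\<close> provides the constants of the locale.\<close>

lemma commuting_fields_integral_map:
  fixes a :: "'f::euclidean_space \<Rightarrow> 'e::euclidean_space \<Rightarrow> 'e"
  assumes S: "open S" "y0 \<in> S" and smooth: "\<And>i. i \<in> Basis \<Longrightarrow> smooth_on S (a i)"
    and commute: "\<And>i j y. i \<in> Basis \<Longrightarrow> j \<in> Basis \<Longrightarrow> y \<in> S \<Longrightarrow>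
      frechet_derivative (a i) (at y) (a j y) = frechet_derivative (a j) (at y) (a i y)"
  shows "\<exists>r \<phi>. r > 0 \<and> \<phi> 0 = y0 \<and> smooth_on (ball 0 r) \<phi> \<and> (\<forall>x\<in>ball 0 r. \<phi> x \<in> S \<and>
    (\<phi> has_derivative (\<lambda>h. \<Sum>i\<in>Basis. (h \<bullet> i) *\<^sub>R a i (\<phi> x))) (at x))"
proof -
  obtain R where R: "R > 0" "cball y0 R \<subseteq> S" using S open_contains_cball by blast
  have bdd: "\<exists>K\<ge>0. \<forall>y\<in>cball y0 R. norm (f y) \<le> K" if "smooth_on S f" for f :: "'e \<Rightarrow> 'e"
  proof -
    have "bounded (f ` cball y0 R)"
      by (rule compact_imp_bounded[OF compact_continuous_image[OF continuous_on_subset[OF smooth_on_continuous[OF that] R(2)] compact_cball]])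
    then obtain K where "K > 0" "\<forall>x\<in>f ` cball y0 R. norm x \<le> K" using bounded_pos by blast
    then show ?thesis by (intro exI[of _ K]) auto
  qed
  have "\<forall>i\<in>Basis. \<exists>K\<ge>0. \<forall>y\<in>cball y0 R. norm (a i y) \<le> K" using bdd smooth by blast
  then obtain m where m: "\<And>i. i \<in> Basis \<Longrightarrow> m i \<ge> 0" "\<And>i y. i \<in> Basis \<Longrightarrow> y \<in> cball y0 R \<Longrightarrow> norm (a i y) \<le> m i"
    by metis
  have "\<forall>i\<in>Basis. \<forall>b\<in>Basis. \<exists>K\<ge>0. \<forall>y\<in>cball y0 R. norm (frechet_derivative (a i) (at y) b) \<le> K"
    using bdd smooth_on_frechet[OF smooth] by blast
  then obtain l where l: "\<And>i b. i \<in> Basis \<Longrightarrow> b \<in> Basis \<Longrightarrow> l i b \<ge> 0"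
    "\<And>i b y. i \<in> Basis \<Longrightarrow> b \<in> Basis \<Longrightarrow> y \<in> cball y0 R \<Longrightarrow> norm (frechet_derivative (a i) (at y) b) \<le> l i b"
    by metis
  define M where "M = (\<Sum>i\<in>Basis. m i)"
  define L where "L = (\<Sum>i\<in>Basis. \<Sum>b\<in>Basis. l i b)"
  have M0: "M \<ge> 0" unfolding M_def by (intro sum_nonneg m(1))
  have L0: "L \<ge> 0" unfolding L_def by (intro sum_nonneg l(1))
  have M: "norm (\<Sum>i\<in>Basis. (h \<bullet> i) *\<^sub>R a i y) \<le> M * norm h" if "y \<in> cball y0 R" for y and h :: 'f
  proof -
    have "norm (\<Sum>i\<in>Basis. (h \<bullet> i) *\<^sub>R a i y) \<le> (\<Sum>i\<in>Basis. m i * norm h)"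
    proof (rule sum_norm_le)
      fix i :: 'f assume i: "i \<in> Basis"
      have "\<bar>h \<bullet> i\<bar> * norm (a i y) \<le> norm h * m i"
        by (rule mult_mono) (use Basis_le_norm[OF i] m i that in auto)
      then show "norm ((h \<bullet> i) *\<^sub>R a i y) \<le> m i * norm h" by (simp add: mult.commute)
    qed
    then show ?thesis by (simp add: M_def sum_distrib_right)
  qed
  have Lb: "norm (\<Sum>i\<in>Basis. (h \<bullet> i) *\<^sub>R frechet_derivative (a i) (at y) w) \<le> L * norm h * norm w"
    if y: "y \<in> cball y0 R" for y w and h :: 'f
  proof -
    have "norm (\<Sum>i\<in>Basis. (h \<bullet> i) *\<^sub>R frechet_derivative (a i) (at y) w) \<le> (\<Sum>i\<in>Basis. norm h * ((\<Sum>b\<in>Basis. l i b) * norm w))"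
    proof (rule sum_norm_le)
      fix i :: 'f assume i: "i \<in> Basis"
      have "frechet_derivative (a i) (at y) w = (\<Sum>b\<in>Basis. (w \<bullet> b) *\<^sub>R frechet_derivative (a i) (at y) b)"
        by (rule frechet_derivative_basis_expansion[OF smooth_on_has_derivative[OF smooth[OF i]]]) (use y R in auto)
      also have "norm \<dots> \<le> (\<Sum>b\<in>Basis. l i b * norm w)"
      proof (rule sum_norm_le)
        fix b :: 'e assume b: "b \<in> Basis"
        have "\<bar>w \<bullet> b\<bar> * norm (frechet_derivative (a i) (at y) b) \<le> norm w * l i b"
          by (rule mult_mono) (use Basis_le_norm[OF b] l i b y in auto)
        then show "norm ((w \<bullet> b) *\<^sub>R frechet_derivative (a i) (at y) b) \<le> l i b * norm w" by (simp add: mult.commute)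
      qed
      finally have "norm (frechet_derivative (a i) (at y) w) \<le> (\<Sum>b\<in>Basis. l i b) * norm w"
        by (simp add: sum_distrib_right)
      then have "\<bar>h \<bullet> i\<bar> * norm (frechet_derivative (a i) (at y) w) \<le> norm h * ((\<Sum>b\<in>Basis. l i b) * norm w)"
        by (intro mult_mono Basis_le_norm[OF i]) auto
      then show "norm ((h \<bullet> i) *\<^sub>R frechet_derivative (a i) (at y) w) \<le> norm h * ((\<Sum>b\<in>Basis. l i b) * norm w)" by simp
    qed
    also have "\<dots> = L * norm h * norm w"
      by (simp add: L_def sum_distrib_left sum_distrib_right mult_ac)
    finally show ?thesis .
  qed
  define r where "r = min (R / (M + 1)) (1 / (4 * (L + 1)))"
  have r: "r > 0" using R M0 L0 by (simp add: r_def)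
  have "M * r \<le> M * (R / (M + 1))" using M0 by (intro mult_left_mono) (auto simp: r_def)
  also have "\<dots> \<le> R" using M0 R by (simp add: field_simps)
  finally have Mr: "M * r \<le> R" .
  have "4 * (L * r) \<le> 4 * (L * (1 / (4 * (L + 1))))" using L0 by (intro mult_left_mono) (auto simp: r_def)
  also have "\<dots> \<le> 1" using L0 by (simp add: field_simps)
  finally have Lr: "4 * (L * r) \<le> 1" .
  interpret commuting_fields a S y0 R L M r
    by unfold_locales (use S smooth commute R M0 M L0 Lb r Mr Lr in auto)
  obtain \<phi> where \<phi>: "\<phi> 0 = y0" "\<And>x. x \<in> ball 0 r \<Longrightarrow> \<phi> x \<in> S"
    "\<And>x. x \<in> ball 0 r \<Longrightarrow> (\<phi> has_derivative (\<lambda>h. \<Sum>i\<in>Basis. (h \<bullet> i) *\<^sub>R a i (\<phi> x))) (at x)"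
    using exists_integral_map unfolding field_def[abs_def] by blast
  have "smooth_on (ball 0 r) \<phi>"
    by (rule smooth_integral_map[OF open_ball \<phi>(2) smooth \<phi>(3)])
  then show ?thesis using r \<phi> by blast
qed


section \<open>Smooth functions, tangent vectors and local frames\<close>

lemma sum_fun_apply: "(\<Sum>i\<in>I. F i) x = (\<Sum>i\<in>I. F i x)"
  by (induction I rule: infinite_finite_induct) auto

lemma scaleR_fun_apply: "(c *\<^sub>R f) x = c *\<^sub>R f x"
  by (simp add: scaleR_fun_def)

locale manifold =
  fixes A :: "('m::{t2_space, second_countable_topology}, 'e::euclidean_space) atlas"
  assumes smooth_manifold: "smooth_manifold A"
begin

lemma chart_at: "\<exists>U \<phi>. (U, \<phi>) \<in> A \<and> q \<in> U"
proof -
  have "q \<in> (\<Union>c\<in>A. fst c)" using smooth_manifold by (simp add: smooth_manifold_def)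
  then show ?thesis by force
qed

context
  fixes U \<phi> assumes chart: "(U, \<phi>) \<in> A"
begin

lemma is_chart: "is_chart (U, \<phi>)"
  using smooth_manifold chart by (auto simp: smooth_manifold_def)

lemma open_domain: "open U" and open_image: "open (\<phi> ` U)"
  using is_chart by (auto simp: is_chart_def)

lemma chart_homeomorphism: "homeomorphism U (\<phi> ` U) \<phi> (inv_into U \<phi>)" and chart_inj: "inj_on \<phi> U"
proof -
  obtain \<psi> where h: "homeomorphism U (\<phi> ` U) \<phi> \<psi>" using is_chart by (auto simp: is_chart_def)
  show inj: "inj_on \<phi> U" using homeomorphism_apply1[OF h] by (metis inj_onI)
  show "homeomorphism U (\<phi> ` U) \<phi> (inv_into U \<phi>)"
    by (rule homeomorphism_cong[OF h])
      (use inj in \<open>auto simp: homeomorphism_apply1[OF h]\<close>)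
qed

lemma chart_inverse: "q \<in> U \<Longrightarrow> inv_into U \<phi> (\<phi> q) = q"
  using chart_inj by simp

lemma chart_continuous: "continuous_on U \<phi>" and chart_inv_continuous: "continuous_on (\<phi> ` U) (inv_into U \<phi>)"
  using chart_homeomorphism by (auto simp: homeomorphism_def)

lemma chart_image_open:
  assumes "open \<Omega>" "\<Omega> \<subseteq> U"
  shows "open (\<phi> ` \<Omega>)"
proof -
  have "openin (top_of_set U) \<Omega>" using assms by (simp add: open_domain openin_open_eq)
  from homeomorphism_imp_open_map[OF chart_homeomorphism this]
  show ?thesis using open_image openin_open_eq by blast
qed

lemma chart_preimage_open: "open T \<Longrightarrow> open (U \<inter> \<phi> -` T)"
  using continuous_open_preimage[OF chart_continuous open_domain] .

end

lemma transition_smooth: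
  assumes "(U, \<phi>) \<in> A" "(V, \<psi>) \<in> A"
  shows "smooth_on (\<phi> ` (U \<inter> V)) (\<psi> \<circ> inv_into U \<phi>)"
proof -
  have "\<forall>(U, \<phi>)\<in>A. \<forall>(V, \<psi>)\<in>A. smooth_on (\<phi> ` (U \<inter> V)) (\<psi> \<circ> inv_into U \<phi>)"
    using smooth_manifold by (simp add: smooth_manifold_def)
  from bspec[OF this assms(1)]
  have "\<forall>(V, \<psi>)\<in>A. smooth_on (\<phi> ` (U \<inter> V)) (\<psi> \<circ> inv_into U \<phi>)" by simp
  from bspec[OF this assms(2)] show ?thesis by simp
qed

text \<open>One chart suffices here because the transition maps are smooth, see \<open>smooth_near_in_chart\<close>.\<close>

definition smooth_near :: "('m \<Rightarrow> real) \<Rightarrow> 'm \<Rightarrow> bool" where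
  "smooth_near f q \<longleftrightarrow> (\<exists>U \<phi> \<Omega>. (U, \<phi>) \<in> A \<and> open \<Omega> \<and> q \<in> \<Omega> \<and> \<Omega> \<subseteq> U \<and>
     smooth_on (\<phi> ` \<Omega>) (f \<circ> inv_into U \<phi>))"

lemma smooth_near_in_chart:
  assumes "smooth_near f q" "(V, \<psi>) \<in> A" "q \<in> V"
  shows "\<exists>\<Omega>. open \<Omega> \<and> q \<in> \<Omega> \<and> \<Omega> \<subseteq> V \<and> smooth_on (\<psi> ` \<Omega>) (f \<circ> inv_into V \<psi>)"
proof -
  obtain U \<phi> \<Omega> where c: "(U, \<phi>) \<in> A" "open \<Omega>" "q \<in> \<Omega>" "\<Omega> \<subseteq> U" "smooth_on (\<phi> ` \<Omega>) (f \<circ> inv_into U \<phi>)"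
    using assms(1) unfolding smooth_near_def by blast
  let ?O = "\<Omega> \<inter> V"
  have O: "open ?O" "?O \<subseteq> V" "?O \<subseteq> U" using c open_domain[OF assms(2)] by auto
  have o: "open (\<psi> ` ?O)" by (rule chart_image_open[OF assms(2) O(1,2)])
  have tr: "smooth_on (\<psi> ` ?O) (\<phi> \<circ> inv_into V \<psi>)"
    by (rule smooth_on_subset[OF transition_smooth[OF assms(2) c(1)]]) (use O in blast)
  have inv: "inv_into V \<psi> (\<psi> x) = x" if "x \<in> ?O" for x
    using chart_inverse[OF assms(2)] that by blast
  have inv': "inv_into U \<phi> (\<phi> x) = x" if "x \<in> ?O" for x
    using chart_inverse[OF c(1)] that O by blast
  have "smooth_on (\<psi> ` ?O) (\<lambda>y. (f \<circ> inv_into U \<phi>) ((\<phi> \<circ> inv_into V \<psi>) y))"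
    by (rule smooth_on_compose[OF o _ tr c(5)]) (auto simp: inv)
  then have "smooth_on (\<psi> ` ?O) (f \<circ> inv_into V \<psi>)"
    by (rule smooth_on_cong[OF o, rotated]) (auto simp: inv inv')
  then show ?thesis using O c(3) assms(3) by blast
qed

lemma smooth_fun_iff_near: "smooth_fun A f \<longleftrightarrow> (\<forall>q. smooth_near f q)"
proof (intro iffI allI)
  fix q assume f: "smooth_fun A f"
  obtain U \<phi> where c: "(U, \<phi>) \<in> A" "q \<in> U" using chart_at by blast
  then have "smooth_on (\<phi> ` U) (f \<circ> inv_into U \<phi>)" using f by (auto simp: smooth_fun_def)
  then show "smooth_near f q" unfolding smooth_near_def using c open_domain[OF c(1)] by blast
next
  assume f: "\<forall>q. smooth_near f q"
  show "smooth_fun A f"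
    unfolding smooth_fun_def
  proof (clarify, rule smooth_on_local)
    fix V \<psi> x assume c: "(V, \<psi>) \<in> A" and "x \<in> \<psi> ` V"
    then obtain q where q: "q \<in> V" "x = \<psi> q" by blast
    obtain \<Omega> where "open \<Omega>" "q \<in> \<Omega>" "\<Omega> \<subseteq> V" "smooth_on (\<psi> ` \<Omega>) (f \<circ> inv_into V \<psi>)"
      using smooth_near_in_chart[OF f[rule_format] c q(1)] by blast
    then show "\<exists>T. open T \<and> x \<in> T \<and> smooth_on T (f \<circ> inv_into V \<psi>)"
      using chart_image_open[OF c] q(2) by blast
  qed
qed

lemma smooth_near_open:
  assumes "smooth_near f q"
  shows "\<exists>\<Omega>. open \<Omega> \<and> q \<in> \<Omega> \<and> (\<forall>x\<in>\<Omega>. smooth_near f x)"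
  using assms unfolding smooth_near_def by blast

lemma smooth_near_cong:
  assumes "open \<Omega>" "q \<in> \<Omega>" "\<And>x. x \<in> \<Omega> \<Longrightarrow> f x = g x" "smooth_near f q"
  shows "smooth_near g q"
proof -
  obtain U \<phi> \<Omega>' where c: "(U, \<phi>) \<in> A" "open \<Omega>'" "q \<in> \<Omega>'" "\<Omega>' \<subseteq> U" "smooth_on (\<phi> ` \<Omega>') (f \<circ> inv_into U \<phi>)"
    using assms(4) unfolding smooth_near_def by blast
  let ?O = "\<Omega> \<inter> \<Omega>'"
  have O: "open ?O" "?O \<subseteq> U" using assms(1) c by auto
  have "smooth_on (\<phi> ` ?O) (f \<circ> inv_into U \<phi>)" by (rule smooth_on_subset[OF c(5)]) blast
  then have "smooth_on (\<phi> ` ?O) (g \<circ> inv_into U \<phi>)"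
  proof (rule smooth_on_cong[OF chart_image_open[OF c(1) O], rotated])
    fix y assume "y \<in> \<phi> ` ?O"
    then obtain x where x: "x \<in> ?O" "y = \<phi> x" by blast
    then have "inv_into U \<phi> y = x" using chart_inverse[OF c(1)] O(2) by blast
    then show "(f \<circ> inv_into U \<phi>) y = (g \<circ> inv_into U \<phi>) y" using assms(3) x by simp
  qed
  then show ?thesis unfolding smooth_near_def using c O assms(2) by blast
qed

lemma smooth_fun_const: "smooth_fun A (\<lambda>q. c)"
  unfolding smooth_fun_def
  by (clarsimp simp: comp_def, rule smooth_on_const, rule open_image)

lemma smooth_fun_add: "smooth_fun A f \<Longrightarrow> smooth_fun A h \<Longrightarrow> smooth_fun A (\<lambda>q. f q + h q)"
  unfolding smooth_fun_def comp_def
  by (clarify, rule smooth_on_add[OF open_image]) auto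

lemma smooth_fun_mult: "smooth_fun A f \<Longrightarrow> smooth_fun A h \<Longrightarrow> smooth_fun A (\<lambda>q. f q * h q)"
  unfolding smooth_fun_def comp_def
  by (clarify, rule smooth_on_mult[OF open_image]) auto

lemma smooth_fun_cmult: "smooth_fun A f \<Longrightarrow> smooth_fun A (\<lambda>q. c * f q)"
  by (rule smooth_fun_mult[OF smooth_fun_const])

lemma smooth_fun_minus: "smooth_fun A f \<Longrightarrow> smooth_fun A (\<lambda>q. - f q)"
  using smooth_fun_cmult[of f "-1"] by simp

lemma smooth_fun_diff: "smooth_fun A f \<Longrightarrow> smooth_fun A h \<Longrightarrow> smooth_fun A (\<lambda>q. f q - h q)"
  using smooth_fun_add[OF _ smooth_fun_minus, of f h] by simp

lemma smooth_fun_sum: "(\<And>i. i \<in> I \<Longrightarrow> smooth_fun A (f i)) \<Longrightarrow> smooth_fun A (\<lambda>q. \<Sum>i\<in>I. f i q)"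
  by (induction I rule: infinite_finite_induct) (auto simp: smooth_fun_const smooth_fun_add)

lemma smooth_fun_compose:
  fixes \<xi> :: "real \<Rightarrow> real"
  assumes "smooth_fun A f" "smooth_on T \<xi>" "\<And>q. f q \<in> T"
  shows "smooth_fun A (\<lambda>q. \<xi> (f q))"
  unfolding smooth_fun_def comp_def
proof clarify
  fix U \<phi> assume c: "(U, \<phi>) \<in> A"
  have "smooth_on (\<phi> ` U) (\<lambda>y. f (inv_into U \<phi> y))" using assms(1) c by (auto simp: smooth_fun_def comp_def)
  from smooth_on_compose[OF open_image[OF c] _ this assms(2)]
  show "smooth_on (\<phi> ` U) (\<lambda>y. \<xi> (f (inv_into U \<phi> y)))" using assms(3) by blast
qed

lemma smooth_near_mult:
  assumes "smooth_near f q" "smooth_near h q"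
  shows "smooth_near (\<lambda>x. f x * h x) q"
proof -
  obtain U \<phi> where c: "(U, \<phi>) \<in> A" "q \<in> U" using chart_at by blast
  obtain \<Omega> where \<Omega>: "open \<Omega>" "q \<in> \<Omega>" "\<Omega> \<subseteq> U" "smooth_on (\<phi> ` \<Omega>) (f \<circ> inv_into U \<phi>)"
    using smooth_near_in_chart[OF assms(1) c] by blast
  obtain \<Omega>' where \<Omega>': "open \<Omega>'" "q \<in> \<Omega>'" "\<Omega>' \<subseteq> U" "smooth_on (\<phi> ` \<Omega>') (h \<circ> inv_into U \<phi>)"
    using smooth_near_in_chart[OF assms(2) c] by blast
  let ?O = "\<Omega> \<inter> \<Omega>'"
  have O: "open ?O" "q \<in> ?O" "?O \<subseteq> U" using \<Omega> \<Omega>' by auto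
  have "smooth_on (\<phi> ` ?O) (\<lambda>y. (f \<circ> inv_into U \<phi>) y * (h \<circ> inv_into U \<phi>) y)"
    by (rule smooth_on_mult[OF chart_image_open[OF c(1) O(1,3)] smooth_on_subset[OF \<Omega>(4)] smooth_on_subset[OF \<Omega>'(4)]]) auto
  then show ?thesis unfolding smooth_near_def using c(1) O by (auto simp: comp_def)
qed

lemma smooth_fun_local:
  assumes "\<And>q. \<exists>\<Omega> h. open \<Omega> \<and> q \<in> \<Omega> \<and> smooth_fun A h \<and> (\<forall>x\<in>\<Omega>. f x = h x)"
  shows "smooth_fun A f"
  unfolding smooth_fun_iff_near
proof
  fix q
  obtain \<Omega> h where h: "open \<Omega>" "q \<in> \<Omega>" "smooth_fun A h" "\<forall>x\<in>\<Omega>. f x = h x" using assms by blast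
  show "smooth_near f q"
    by (rule smooth_near_cong[OF h(1,2), of h]) (use h in \<open>auto simp: smooth_fun_iff_near\<close>)
qed

text \<open>By the last clause a cut-off function turns functions which are smooth on a neighbourhood into globally
  smooth ones; this is the form in which cut-offs are used.\<close>

definition cutoff_fun :: "'m set \<Rightarrow> 'm \<Rightarrow> ('m \<Rightarrow> real) \<Rightarrow> 'm set \<Rightarrow> bool" where
  "cutoff_fun \<Omega> q b \<Omega>' \<longleftrightarrow> smooth_fun A b \<and> open \<Omega>' \<and> q \<in> \<Omega>' \<and> \<Omega>' \<subseteq> \<Omega> \<and> (\<forall>x\<in>\<Omega>'. b x = 1) \<and>
     (\<forall>x. x \<notin> \<Omega> \<longrightarrow> b x = 0) \<and> (\<forall>f. (\<forall>x\<in>\<Omega>. smooth_near f x) \<longrightarrow> smooth_fun A (\<lambda>x. b x * f x))"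

lemma cutoff_funD:
  assumes "cutoff_fun \<Omega> q b \<Omega>'"
  shows "smooth_fun A b" "open \<Omega>'" "q \<in> \<Omega>'" "\<Omega>' \<subseteq> \<Omega>" "\<And>x. x \<in> \<Omega>' \<Longrightarrow> b x = 1"
    "\<And>x. x \<notin> \<Omega> \<Longrightarrow> b x = 0" "\<And>f. (\<And>x. x \<in> \<Omega> \<Longrightarrow> smooth_near f x) \<Longrightarrow> smooth_fun A (\<lambda>x. b x * f x)"
  using assms by (auto simp: cutoff_fun_def)

text \<open>A bump function in a chart is extended by \<open>0\<close>. Its support is compact, hence closed in the Hausdorff
  space \<open>M\<close>, so the extension vanishes near every other point.\<close>

lemma exists_cutoff:
  assumes "open \<Omega>" "q \<in> \<Omega>"
  shows "\<exists>b \<Omega>'. cutoff_fun \<Omega> q b \<Omega>'"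
proof -
  obtain U \<phi> where c: "(U, \<phi>) \<in> A" "q \<in> U" using chart_at by blast
  let ?O = "\<Omega> \<inter> U"
  have O: "open ?O" "?O \<subseteq> U" "q \<in> ?O" using assms c open_domain[OF c(1)] by auto
  have oO: "open (\<phi> ` ?O)" by (rule chart_image_open[OF c(1) O(1,2)])
  then obtain e where e: "e > 0" "cball (\<phi> q) e \<subseteq> \<phi> ` ?O" using O(3) open_contains_cball by blast
  define r where "r = e / 2"
  have r: "r > 0" "cball (\<phi> q) (2 * r) \<subseteq> \<phi> ` ?O" using e by (auto simp: r_def)
  obtain \<beta> where \<beta>: "smooth_on UNIV (\<beta> :: 'e \<Rightarrow> real)" "\<And>y. y \<in> ball (\<phi> q) r \<Longrightarrow> \<beta> y = 1"
    "\<And>y. y \<notin> ball (\<phi> q) (2 * r) \<Longrightarrow> \<beta> y = 0"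
    using exists_bump_euclidean[OF r(1), of "\<phi> q"] by blast
  define b where "b = (\<lambda>x. if x \<in> U then \<beta> (\<phi> x) else 0)"
  define K where "K = inv_into U \<phi> ` cball (\<phi> q) (2 * r)"
  have inv: "inv_into U \<phi> (\<phi> x) = x" if "x \<in> U" for x using chart_inverse[OF c(1) that] .
  have "compact K" unfolding K_def
    by (rule compact_continuous_image[OF continuous_on_subset[OF chart_inv_continuous[OF c(1)]] compact_cball])
      (use r in blast)
  then have K: "open (- K)" by (simp add: compact_imp_closed open_Compl)
  have KO: "K \<subseteq> ?O"
  proof
    fix x assume "x \<in> K"
    then obtain y where "y \<in> cball (\<phi> q) (2 * r)" "x = inv_into U \<phi> y" unfolding K_def by blast
    then show "x \<in> ?O" using r(2) inv by (smt (verit) IntD2 imageE in_mono)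
  qed
  have b0: "b x = 0" if "x \<notin> K" for x
  proof (cases "x \<in> U")
    case True
    then have "\<phi> x \<notin> cball (\<phi> q) (2 * r)" using that inv unfolding K_def by (metis image_eqI)
    then show ?thesis using \<beta>(3) by (simp add: b_def)
  qed (simp add: b_def)
  have near_b: "smooth_near b x" if "x \<in> ?O" for x
  proof -
    have "smooth_on (\<phi> ` ?O) \<beta>" by (rule smooth_on_subset[OF \<beta>(1)]) simp
    then have "smooth_on (\<phi> ` ?O) (b \<circ> inv_into U \<phi>)"
      by (rule smooth_on_cong[OF oO, rotated]) (auto simp: inv b_def)
    then show ?thesis unfolding smooth_near_def using c O that by blast
  qed
  have sm: "smooth_fun A (\<lambda>x. b x * f x)" if f: "\<And>x. x \<in> \<Omega> \<Longrightarrow> smooth_near f x" for f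
    unfolding smooth_fun_iff_near
  proof
    fix x
    show "smooth_near (\<lambda>x. b x * f x) x"
    proof (cases "x \<in> K")
      case True
      then have "x \<in> ?O" using KO by blast
      then show ?thesis using smooth_near_mult[OF near_b f] by blast
    next
      case False
      show ?thesis
        by (rule smooth_near_cong[OF K, of _ "\<lambda>x. 0"])
          (use False b0 smooth_fun_const[of 0] in \<open>auto simp: smooth_fun_iff_near\<close>)
    qed
  qed
  have "smooth_fun A b"
    using sm[of "\<lambda>x. 1"] smooth_fun_const[of 1] by (simp add: smooth_fun_iff_near)
  moreover have "open (?O \<inter> (U \<inter> \<phi> -` ball (\<phi> q) r))"
    by (intro open_Int O chart_preimage_open[OF c(1)] open_ball)
  moreover have "b x = 0" if "x \<notin> \<Omega>" for x using b0 KO that by blast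
  moreover have "q \<in> ?O \<inter> (U \<inter> \<phi> -` ball (\<phi> q) r)" using O c r by simp
  moreover have "b x = 1" if "x \<in> ?O \<inter> (U \<inter> \<phi> -` ball (\<phi> q) r)" for x
    using that \<beta>(2) by (simp add: b_def)
  ultimately have "cutoff_fun \<Omega> q b (?O \<inter> (U \<inter> \<phi> -` ball (\<phi> q) r))"
    unfolding cutoff_fun_def using sm by blast
  then show ?thesis by blast
qed

lemma smooth_near_extend:
  assumes "smooth_near f q"
  obtains h \<Omega> where "smooth_fun A h" "open \<Omega>" "q \<in> \<Omega>" "\<And>x. x \<in> \<Omega> \<Longrightarrow> h x = f x"
proof -
  obtain \<Omega>0 where o: "open \<Omega>0" "q \<in> \<Omega>0" "\<And>x. x \<in> \<Omega>0 \<Longrightarrow> smooth_near f x"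
    using smooth_near_open[OF assms] by blast
  obtain b \<Omega>' where "cutoff_fun \<Omega>0 q b \<Omega>'" using exists_cutoff[OF o(1,2)] by blast
  note b = cutoff_funD[OF this]
  show ?thesis using that[OF b(7)[OF o(3)] b(2,3)] b(5) by simp
qed


subsection \<open>Tangent vectors\<close>

context
  fixes p v assumes v: "v \<in> tangent_space A p"
begin

lemma tangent_add: "smooth_fun A f \<Longrightarrow> smooth_fun A h \<Longrightarrow> v (\<lambda>q. f q + h q) = v f + v h"
  and tangent_cmult: "smooth_fun A f \<Longrightarrow> v (\<lambda>q. c * f q) = c * v f"
  and tangent_mult: "smooth_fun A f \<Longrightarrow> smooth_fun A h \<Longrightarrow> v (\<lambda>q. f q * h q) = v f * h p + f p * v h"
  and tangent_nonsmooth: "\<not> smooth_fun A f \<Longrightarrow> v f = 0"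
  using v by (auto simp: tangent_space_def)

lemma tangent_const: "v (\<lambda>q. c) = 0"
proof -
  have "v (\<lambda>q. 1 * 1) = v (\<lambda>q. 1) * 1 + 1 * v (\<lambda>q. 1)"
    by (rule tangent_mult[OF smooth_fun_const smooth_fun_const])
  then have "v (\<lambda>q. 1) = 0" by simp
  then show ?thesis using tangent_cmult[OF smooth_fun_const[of 1], of c] by simp
qed

lemma tangent_minus: "smooth_fun A f \<Longrightarrow> v (\<lambda>q. - f q) = - v f"
  using tangent_cmult[of f "-1"] by simp

lemma tangent_diff: "smooth_fun A f \<Longrightarrow> smooth_fun A h \<Longrightarrow> v (\<lambda>q. f q - h q) = v f - v h"
  using tangent_add[of f "\<lambda>q. - h q"] tangent_minus[of h] smooth_fun_minus[of h] by simp

lemma tangent_sum: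
  "(\<And>i. i \<in> I \<Longrightarrow> smooth_fun A (f i)) \<Longrightarrow> v (\<lambda>q. \<Sum>i\<in>I. f i q) = (\<Sum>i\<in>I. v (f i))"
  by (induction I rule: infinite_finite_induct) (auto simp: tangent_const tangent_add smooth_fun_sum)

text \<open>If \<open>b\<close> is a cut-off function at \<open>p\<close>, then \<open>b * f = b * h\<close>, and the product rule gives \<open>v f = v h\<close>.\<close>

lemma tangent_local:
  assumes "open \<Omega>" "p \<in> \<Omega>" "\<And>x. x \<in> \<Omega> \<Longrightarrow> f x = h x" "smooth_fun A f" "smooth_fun A h"
  shows "v f = v h"
proof -
  obtain b \<Omega>' where "cutoff_fun \<Omega> p b \<Omega>'" using exists_cutoff[OF assms(1,2)] by blast
  note b = cutoff_funD[OF this]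
  have "(\<lambda>x. b x * f x) = (\<lambda>x. b x * h x)" using b(6) assms(3) by fastforce
  then have "v b * f p + b p * v f = v b * h p + b p * v h"
    using tangent_mult[OF b(1) assms(4)] tangent_mult[OF b(1) assms(5)] by metis
  then show ?thesis using b(3,5) assms(2,3) by simp
qed

end

lemma tangent_spaceI:
  assumes "\<And>f h. smooth_fun A f \<Longrightarrow> smooth_fun A h \<Longrightarrow> v (\<lambda>q. f q + h q) = v f + v h"
    and "\<And>c f. smooth_fun A f \<Longrightarrow> v (\<lambda>q. c * f q) = c * v f"
    and "\<And>f h. smooth_fun A f \<Longrightarrow> smooth_fun A h \<Longrightarrow> v (\<lambda>q. f q * h q) = v f * h p + f p * v h"
    and "\<And>f. \<not> smooth_fun A f \<Longrightarrow> v f = 0"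
  shows "v \<in> tangent_space A p"
  using assms by (auto simp: tangent_space_def)

lemma tangent_space_subspace: "subspace (tangent_space A p)"
  unfolding subspace_def
  by (auto intro!: tangent_spaceI simp: tangent_add tangent_cmult tangent_mult tangent_nonsmooth
      scaleR_fun_apply algebra_simps)

lemma tangent_ext:
  assumes "u \<in> tangent_space A p" "v \<in> tangent_space A p" "\<And>f. smooth_fun A f \<Longrightarrow> u f = v f"
  shows "u = v"
proof
  fix f show "u f = v f"
    by (cases "smooth_fun A f") (auto simp: assms(3) tangent_nonsmooth[OF assms(1)] tangent_nonsmooth[OF assms(2)])
qed

lemma smooth_fun_chart: "smooth_fun A f \<Longrightarrow> (U, \<phi>) \<in> A \<Longrightarrow> smooth_on (\<phi> ` U) (f \<circ> inv_into U \<phi>)"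
  by (auto simp: smooth_fun_def)

text \<open>Multiplication by a cut-off function transports \<open>v\<close> to a derivation of smooth functions on a ball in the
  chart, to which \<open>derivation_at_eq_sum_partials\<close> applies. The transport is multiplicative because the
  cut-off function is \<open>1\<close> near \<open>q\<close>.\<close>

lemma tangent_eq_sum_partials:
  assumes c: "(U, \<phi>) \<in> A" and \<Omega>: "open \<Omega>" "\<Omega> \<subseteq> U" "q \<in> \<Omega>"
    and x: "\<And>i. i \<in> Basis \<Longrightarrow> smooth_fun A (x i)" "\<And>i q. i \<in> Basis \<Longrightarrow> q \<in> \<Omega> \<Longrightarrow> x i q = \<phi> q \<bullet> i"
    and v: "v \<in> tangent_space A q" and f: "smooth_fun A f"
  shows "v f = (\<Sum>i\<in>Basis. v (x i) * frechet_derivative (f \<circ> inv_into U \<phi>) (at (\<phi> q)) i)"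
proof -
  note inv = chart_inverse[OF c]
  have "open (\<phi> ` \<Omega>)" by (rule chart_image_open[OF c \<Omega>(1,2)])
  then obtain r where r: "r > 0" "ball (\<phi> q) r \<subseteq> \<phi> ` \<Omega>" using \<Omega>(3) openE by blast
  let ?B = "ball (\<phi> q) r"
  define \<Omega>1 where "\<Omega>1 = \<Omega> \<inter> (U \<inter> \<phi> -` ?B)"
  have \<Omega>1: "open \<Omega>1" "q \<in> \<Omega>1"
    unfolding \<Omega>1_def using chart_preimage_open[OF c open_ball] \<Omega> r by auto
  have sub1: "\<Omega>1 \<subseteq> U" by (auto simp: \<Omega>1_def)
  have im: "\<phi> ` \<Omega>1 = ?B"
  proof (intro subset_antisym subsetI)
    fix y assume y: "y \<in> ?B"
    then obtain x where x: "x \<in> \<Omega>" "y = \<phi> x" using r(2) by blast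
    then have "x \<in> \<Omega>1" using y \<Omega>(2) by (auto simp: \<Omega>1_def)
    then show "y \<in> \<phi> ` \<Omega>1" using x(2) by blast
  qed (auto simp: \<Omega>1_def)
  obtain b \<Omega>' where "cutoff_fun \<Omega>1 q b \<Omega>'" using exists_cutoff[OF \<Omega>1] by blast
  note b = cutoff_funD[OF this]
  have near: "smooth_near (u \<circ> \<phi>) y" if u: "smooth_on ?B u" and y: "y \<in> \<Omega>1" for u y
  proof -
    have "smooth_on (\<phi> ` \<Omega>1) ((u \<circ> \<phi>) \<circ> inv_into U \<phi>)"
      by (rule smooth_on_cong[OF _ _ u[folded im]])
        (use chart_image_open[OF c \<Omega>1(1) sub1] inv sub1 in auto)
    then show ?thesis unfolding smooth_near_def using c \<Omega>1 y sub1 by blast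
  qed
  have sb: "smooth_fun A (\<lambda>x. b x * u (\<phi> x))" if "smooth_on ?B u" for u
    using b(7)[of "u \<circ> \<phi>"] near[OF that] by simp
  define L where "L = (\<lambda>u. v (\<lambda>x. b x * u (\<phi> x)))"
  have sub: "\<Omega>' \<subseteq> \<Omega>" "\<Omega>' \<subseteq> U" using b(4) by (auto simp: \<Omega>1_def)
  have "L (f \<circ> inv_into U \<phi>) = (\<Sum>i\<in>Basis. L (\<lambda>y. y \<bullet> i) * frechet_derivative (f \<circ> inv_into U \<phi>) (at (\<phi> q)) i)"
  proof (rule derivation_at_eq_sum_partials[OF r(1)])
    show "smooth_on ?B (f \<circ> inv_into U \<phi>)"
      by (rule smooth_on_subset[OF smooth_fun_chart[OF f c]]) (use r \<Omega> in blast)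
  next
    fix u w :: "'e \<Rightarrow> real" assume u: "smooth_on ?B u" and w: "smooth_on ?B w"
    show "L (\<lambda>y. u y + w y) = L u + L w"
      unfolding L_def distrib_left by (rule tangent_add[OF v sb[OF u] sb[OF w]])
    have uw: "smooth_on ?B (\<lambda>y. u y * w y)" by (rule smooth_on_mult[OF open_ball u w])
    have "v (\<lambda>x. b x * (u (\<phi> x) * w (\<phi> x))) = v (\<lambda>x. (b x * u (\<phi> x)) * (b x * w (\<phi> x)))"
      by (rule tangent_local[OF v b(2,3) _ sb[OF uw] smooth_fun_mult[OF sb[OF u] sb[OF w]]]) (simp add: b(5))
    also have "\<dots> = L u * w (\<phi> q) + u (\<phi> q) * L w"
      unfolding L_def using tangent_mult[OF v sb[OF u] sb[OF w]] b(3,5) by simp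
    finally show "L (\<lambda>y. u y * w y) = L u * w (\<phi> q) + u (\<phi> q) * L w" unfolding L_def .
  next
    fix c' :: real
    have "v (\<lambda>x. b x * c') = v (\<lambda>x. 1 * c')"
      by (rule tangent_local[OF v b(2,3) _ smooth_fun_mult[OF b(1) smooth_fun_const]])
        (simp_all add: b(5) smooth_fun_const)
    then show "L (\<lambda>y. c') = 0" unfolding L_def using tangent_const[OF v] by simp
  next
    fix u w :: "'e \<Rightarrow> real" assume "\<And>y. y \<in> ?B \<Longrightarrow> u y = w y"
    then have "(\<lambda>x. b x * u (\<phi> x)) = (\<lambda>x. b x * w (\<phi> x))" using b(6) im by fastforce
    then show "L u = L w" unfolding L_def by simp
  qed
  moreover have "L (\<lambda>y. y \<bullet> i) = v (x i)" if "i \<in> Basis" for i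
    unfolding L_def
  proof (rule tangent_local[OF v b(2,3) _ sb x(1)[OF that]])
    show "smooth_on ?B (\<lambda>y. y \<bullet> i)" by (rule smooth_on_linear) (auto intro: bounded_linear_inner_left)
    show "b y * (\<phi> y \<bullet> i) = x i y" if "y \<in> \<Omega>'" for y
      using that b(5) x(2)[OF \<open>i \<in> Basis\<close>] sub by auto
  qed
  moreover have "L (f \<circ> inv_into U \<phi>) = v f"
    unfolding L_def
  proof (rule tangent_local[OF v b(2,3) _ _ f])
    show "b y * (f \<circ> inv_into U \<phi>) (\<phi> y) = f y" if "y \<in> \<Omega>'" for y
      using that b(5) inv sub by auto
    show "smooth_fun A (\<lambda>x. b x * (f \<circ> inv_into U \<phi>) (\<phi> x))"
      by (rule sb[OF smooth_on_subset[OF smooth_fun_chart[OF f c]]]) (use r \<Omega> in blast)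
  qed
  ultimately show ?thesis by simp
qed


subsection \<open>Vector fields and coordinate frames\<close>

lemma vector_field_tangent: "vector_field A X \<Longrightarrow> X p \<in> tangent_space A p"
  and vector_field_smooth: "vector_field A X \<Longrightarrow> smooth_fun A f \<Longrightarrow> smooth_fun A (\<lambda>p. X p f)"
  by (auto simp: vector_field_def)

lemma vector_fieldI:
  "(\<And>p. X p \<in> tangent_space A p) \<Longrightarrow> (\<And>f. smooth_fun A f \<Longrightarrow> smooth_fun A (\<lambda>p. X p f)) \<Longrightarrow> vector_field A X"
  by (auto simp: vector_field_def)

lemma vector_field_add: "vector_field A X \<Longrightarrow> vector_field A Y \<Longrightarrow> vector_field A (\<lambda>p. X p + Y p)"
  by (rule vector_fieldI)
    (auto simp: vector_field_def smooth_fun_add intro: subspace_add[OF tangent_space_subspace])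

lemma vector_field_scale: "smooth_fun A f \<Longrightarrow> vector_field A X \<Longrightarrow> vector_field A (\<lambda>p. f p *\<^sub>R X p)"
  by (rule vector_fieldI)
    (auto simp: vector_field_def smooth_fun_mult scaleR_fun_apply intro: subspace_scale[OF tangent_space_subspace])

lemma vector_field_zero: "vector_field A (\<lambda>p. 0)"
  by (rule vector_fieldI) (auto simp: smooth_fun_const intro: subspace_0[OF tangent_space_subspace])

lemma vector_field_minus: "vector_field A X \<Longrightarrow> vector_field A (\<lambda>p. - X p)"
  using vector_field_scale[OF smooth_fun_const[of "-1"], of X] by simp

lemma vector_field_diff: "vector_field A X \<Longrightarrow> vector_field A Y \<Longrightarrow> vector_field A (\<lambda>p. X p - Y p)"
  using vector_field_add[OF _ vector_field_minus, of X Y] by simp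

lemma vector_field_sum:
  "(\<And>i. i \<in> I \<Longrightarrow> vector_field A (X i)) \<Longrightarrow> vector_field A (\<lambda>p. \<Sum>i\<in>I. X i p)"
  by (induction I rule: infinite_finite_induct) (auto simp: vector_field_zero vector_field_add)

lemma vector_field_local:
  assumes "\<And>p. \<exists>\<Omega> Y. open \<Omega> \<and> p \<in> \<Omega> \<and> vector_field A Y \<and> (\<forall>q\<in>\<Omega>. X q = Y q)"
  shows "vector_field A X"
proof (rule vector_fieldI)
  show "X p \<in> tangent_space A p" for p using assms[of p] vector_field_tangent by metis
  show "smooth_fun A (\<lambda>p. X p f)" if f: "smooth_fun A f" for f
  proof (rule smooth_fun_local)
    fix p
    obtain \<Omega> Y where "open \<Omega>" "p \<in> \<Omega>" "vector_field A Y" "\<forall>q\<in>\<Omega>. X q = Y q" using assms by blast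
    then show "\<exists>\<Omega> h. open \<Omega> \<and> p \<in> \<Omega> \<and> smooth_fun A h \<and> (\<forall>x\<in>\<Omega>. X x f = h x)"
      using vector_field_smooth[OF _ f, of Y] by (intro exI[of _ \<Omega>] exI[of _ "\<lambda>p. Y p f"]) simp
  qed
qed

lemma vector_field_lie_bracket:
  assumes X: "vector_field A X" and Y: "vector_field A Y"
  shows "vector_field A (lie_bracket X Y)"
proof (rule vector_fieldI)
  note sX = vector_field_smooth[OF X] and sY = vector_field_smooth[OF Y]
  note tX = vector_field_tangent[OF X] and tY = vector_field_tangent[OF Y]
  show "lie_bracket X Y p \<in> tangent_space A p" for p
  proof (rule tangent_spaceI)
    fix f h assume f: "smooth_fun A f" and h: "smooth_fun A h"
    show "lie_bracket X Y p (\<lambda>q. f q + h q) = lie_bracket X Y p f + lie_bracket X Y p h"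
      using f h by (simp add: lie_bracket_def tangent_add[OF tX] tangent_add[OF tY] sX sY)
    show "lie_bracket X Y p (\<lambda>q. f q * h q) = lie_bracket X Y p f * h p + f p * lie_bracket X Y p h"
      using f h
      by (simp add: lie_bracket_def tangent_add[OF tX] tangent_add[OF tY] tangent_mult[OF tX] tangent_mult[OF tY]
          sX sY smooth_fun_mult algebra_simps)
  next
    fix c f assume f: "smooth_fun A f"
    show "lie_bracket X Y p (\<lambda>q. c * f q) = c * lie_bracket X Y p f"
      using f by (simp add: lie_bracket_def tangent_cmult[OF tX] tangent_cmult[OF tY] sX sY algebra_simps)
  next
    fix f assume "\<not> smooth_fun A f"
    then show "lie_bracket X Y p f = 0"
      by (simp add: lie_bracket_def tangent_nonsmooth[OF tX] tangent_nonsmooth[OF tY] tangent_const[OF tX] tangent_const[OF tY])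
  qed
  show "smooth_fun A (\<lambda>p. lie_bracket X Y p f)" if "smooth_fun A f" for f
    unfolding lie_bracket_def using that by (intro smooth_fun_diff sX sY)
qed

text \<open>Globally defined functions and fields which on \<open>\<Omega>\<close> are a coordinate system with its coordinate
  vector fields. Functions and fields are defined on all of \<open>M\<close> because derivations act on such functions
  only.\<close>

definition coordinate_frame :: "'m set \<Rightarrow> ('e \<Rightarrow> 'm \<Rightarrow> real) \<Rightarrow> ('e \<Rightarrow> 'm \<Rightarrow> 'm tvec) \<Rightarrow> bool" where
  "coordinate_frame \<Omega> x E \<longleftrightarrow> open \<Omega> \<and> (\<forall>i\<in>Basis. smooth_fun A (x i) \<and> vector_field A (E i)) \<and>
     (\<forall>q\<in>\<Omega>. \<forall>i\<in>Basis. \<forall>j\<in>Basis. E i q (x j) = (if i = j then 1 else 0)) \<and>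
     (\<forall>q\<in>\<Omega>. \<forall>v\<in>tangent_space A q. v = (\<Sum>i\<in>Basis. v (x i) *\<^sub>R E i q))"

lemma exists_coordinate_frame_chart:
  obtains U \<phi> \<Omega> x E where "(U, \<phi>) \<in> A" "p \<in> \<Omega>" "\<Omega> \<subseteq> U" "coordinate_frame \<Omega> x E"
    "\<And>i q. i \<in> Basis \<Longrightarrow> q \<in> \<Omega> \<Longrightarrow> x i q = \<phi> q \<bullet> i"
    "\<And>i q f. i \<in> Basis \<Longrightarrow> q \<in> \<Omega> \<Longrightarrow> smooth_fun A f \<Longrightarrow> E i q f = frechet_derivative (f \<circ> inv_into U \<phi>) (at (\<phi> q)) i"
proof -
  obtain U \<phi> where c: "(U, \<phi>) \<in> A" "p \<in> U" using chart_at by blast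
  note inv = chart_inverse[OF c(1)]
  note oU = open_domain[OF c(1)] and oV = open_image[OF c(1)]
  obtain b \<Omega> where "cutoff_fun U p b \<Omega>" using exists_cutoff[OF oU c(2)] by blast
  note b = cutoff_funD[OF this]
  have sb: "smooth_fun A (\<lambda>x. b x * u (\<phi> x))" if u: "smooth_on (\<phi> ` U) u" for u
  proof (rule b(7))
    fix y assume "y \<in> U"
    moreover have "smooth_on (\<phi> ` U) ((\<lambda>x. u (\<phi> x)) \<circ> inv_into U \<phi>)"
      by (rule smooth_on_cong[OF oV _ u]) (auto simp: inv)
    ultimately show "smooth_near (\<lambda>x. u (\<phi> x)) y" unfolding smooth_near_def using c oU by blast
  qed
  define x where "x = (\<lambda>i q. b q * (\<phi> q \<bullet> i))"
  define d where "d = (\<lambda>(f :: 'm \<Rightarrow> real) q i. frechet_derivative (f \<circ> inv_into U \<phi>) (at (\<phi> q)) i)"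
  define E where "E = (\<lambda>i q f. if smooth_fun A f then b q * d f q i else 0)"
  have slin: "smooth_on (\<phi> ` U) (\<lambda>y. y \<bullet> i)" for i
    by (rule smooth_on_linear[OF oV]) (auto intro: bounded_linear_inner_left)
  have sx: "smooth_fun A (x i)" for i unfolding x_def by (rule sb[OF slin])
  have xeq: "x i q = \<phi> q \<bullet> i" if "q \<in> \<Omega>" for i q using b(5)[OF that] by (simp add: x_def)
  have sd: "smooth_fun A (\<lambda>q. b q * d f q i)" if "smooth_fun A f" for f i
    unfolding d_def using sb[OF smooth_on_frechet[OF smooth_fun_chart[OF that c(1)]]] .
  have d_add: "d (\<lambda>q. f q + h q) q i = d f q i + d h q i"
    and d_mult: "d (\<lambda>q. f q * h q) q i = f q * d h q i + d f q i * h q"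
    if "smooth_fun A f" "smooth_fun A h" "q \<in> U" for f h q i
    using frechet_derivative_add[OF smooth_fun_chart[OF that(1) c(1)] smooth_fun_chart[OF that(2) c(1)], of "\<phi> q" i]
      frechet_derivative_mult[OF smooth_fun_chart[OF that(1) c(1)] smooth_fun_chart[OF that(2) c(1)], of "\<phi> q" i]
      that(3) inv[OF that(3)] by (auto simp: d_def comp_def)
  have d_const: "d (\<lambda>q. c) q i = 0" for c q i by (simp add: d_def comp_def)
  have tE: "E i q \<in> tangent_space A q" for i q
  proof (cases "q \<in> U")
    case False
    then have "E i q = 0" using b(6) by (auto simp: E_def)
    then show ?thesis using subspace_0[OF tangent_space_subspace] by simp
  next
    case True
    show ?thesis
    proof (rule tangent_spaceI)
      fix c f assume f: "smooth_fun A f"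
      show "E i q (\<lambda>q. c * f q) = c * E i q f"
        using f by (simp add: E_def smooth_fun_cmult d_mult[OF smooth_fun_const f True] d_const)
    qed (auto simp: E_def smooth_fun_add smooth_fun_mult d_add d_mult True algebra_simps)
  qed
  have vE: "vector_field A (E i)" for i
    by (rule vector_fieldI[OF tE]) (simp add: E_def sd)
  have Eeq: "E i q f = d f q i" if "q \<in> \<Omega>" "smooth_fun A f" for i q f
    using that b(5) by (simp add: E_def)
  have "E i q (x j) = (if i = j then 1 else 0)" if q: "q \<in> \<Omega>" and ij: "i \<in> Basis" "j \<in> Basis" for i j q
  proof -
    have "d (x j) q i = frechet_derivative (\<lambda>y. y \<bullet> j) (at (\<phi> q)) i"
      unfolding d_def
    proof (rule fun_cong[OF frechet_derivative_cong_open[OF chart_image_open[OF c(1) b(2,4)]]])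
      show "\<phi> q \<in> \<phi> ` \<Omega>" using q by blast
      show "(x j \<circ> inv_into U \<phi>) y = y \<bullet> j" if "y \<in> \<phi> ` \<Omega>" for y
        using that b(4) inv xeq by auto
    qed
    then show ?thesis using Eeq[OF q sx] ij by (simp add: frechet_derivative_inner_const inner_Basis)
  qed
  moreover have "v = (\<Sum>i\<in>Basis. v (x i) *\<^sub>R E i q)" if q: "q \<in> \<Omega>" and v: "v \<in> tangent_space A q" for q v
  proof (rule tangent_ext[OF v])
    show "(\<Sum>i\<in>Basis. v (x i) *\<^sub>R E i q) \<in> tangent_space A q"
      by (intro subspace_sum[OF tangent_space_subspace] subspace_scale[OF tangent_space_subspace] tE)
    fix f assume f: "smooth_fun A f"
    have "v f = (\<Sum>i\<in>Basis. v (x i) * d f q i)"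
      unfolding d_def by (rule tangent_eq_sum_partials[OF c(1) b(2,4) q sx xeq v f])
    then show "v f = (\<Sum>i\<in>Basis. v (x i) *\<^sub>R E i q) f"
      using Eeq[OF q f] by (simp add: sum_fun_apply scaleR_fun_apply)
  qed
  ultimately have "coordinate_frame \<Omega> x E"
    using b(2) sx vE by (auto simp: coordinate_frame_def)
  then show ?thesis
    using that[OF c(1) b(3,4) _ xeq] Eeq unfolding d_def by blast
qed

context
  fixes \<Omega> x E assumes frame: "coordinate_frame \<Omega> x E"
begin

lemma frame_open: "open \<Omega>"
  and frame_smooth: "i \<in> Basis \<Longrightarrow> smooth_fun A (x i)"
  and frame_field: "i \<in> Basis \<Longrightarrow> vector_field A (E i)"
  and frame_dual: "q \<in> \<Omega> \<Longrightarrow> i \<in> Basis \<Longrightarrow> j \<in> Basis \<Longrightarrow> E i q (x j) = (if i = j then 1 else 0)"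
  and frame_expand: "q \<in> \<Omega> \<Longrightarrow> v \<in> tangent_space A q \<Longrightarrow> v = (\<Sum>i\<in>Basis. v (x i) *\<^sub>R E i q)"
  using frame unfolding coordinate_frame_def by blast+

lemma frame_ext:
  assumes "q \<in> \<Omega>" "u \<in> tangent_space A q" "v \<in> tangent_space A q" "\<And>i. i \<in> Basis \<Longrightarrow> u (x i) = v (x i)"
  shows "u = v"
proof -
  have "(\<Sum>i\<in>Basis. u (x i) *\<^sub>R E i q) = (\<Sum>i\<in>Basis. v (x i) *\<^sub>R E i q)"
    using assms(4) by (intro sum.cong) auto
  then show ?thesis using frame_expand[OF assms(1,2)] frame_expand[OF assms(1,3)] by simp
qed

text \<open>In particular coordinate fields commute: the bracket differentiates their constant components.\<close>

lemma lie_bracket_constant_coefficients: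
  assumes X: "vector_field A X" "\<And>q k. q \<in> \<Omega> \<Longrightarrow> k \<in> Basis \<Longrightarrow> X q (x k) = c k"
    and Y: "vector_field A Y" "\<And>q k. q \<in> \<Omega> \<Longrightarrow> k \<in> Basis \<Longrightarrow> Y q (x k) = d k"
    and q: "q \<in> \<Omega>"
  shows "lie_bracket X Y q = 0"
proof (rule frame_ext[OF q])
  show "lie_bracket X Y q \<in> tangent_space A q"
    by (rule vector_field_tangent[OF vector_field_lie_bracket[OF X(1) Y(1)]])
  show "0 \<in> tangent_space A q" by (rule subspace_0[OF tangent_space_subspace])
  fix k :: 'e assume k: "k \<in> Basis"
  have zero: "v (\<lambda>q. Z q (x k)) = 0"
    if v: "v \<in> tangent_space A q" and Z: "vector_field A Z" "\<And>q. q \<in> \<Omega> \<Longrightarrow> Z q (x k) = a" for v Z a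
  proof -
    have "v (\<lambda>q. Z q (x k)) = v (\<lambda>q. a)"
      by (rule tangent_local[OF v frame_open q Z(2) vector_field_smooth[OF Z(1) frame_smooth[OF k]] smooth_fun_const])
    then show ?thesis by (simp add: tangent_const[OF v])
  qed
  show "lie_bracket X Y q (x k) = 0 (x k)"
    using zero[OF vector_field_tangent[OF X(1)] Y(1) Y(2)[OF _ k]] zero[OF vector_field_tangent[OF Y(1)] X(1) X(2)[OF _ k]]
    by (simp add: lie_bracket_def)
qed

end

lemma exists_coordinate_frame: obtains \<Omega> x E where "p \<in> \<Omega>" "coordinate_frame \<Omega> x E"
  using exists_coordinate_frame_chart[of p] by metis

lemma tangent_vector_extends:
  assumes "v \<in> tangent_space A p"
  obtains X where "vector_field A X" "X p = v"
proof -
  obtain \<Omega> x E where f: "p \<in> \<Omega>" "coordinate_frame \<Omega> x E" using exists_coordinate_frame by blast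
  show ?thesis
  proof (rule that)
    show "vector_field A (\<lambda>q. \<Sum>i\<in>Basis. v (x i) *\<^sub>R E i q)"
      by (intro vector_field_sum vector_field_scale smooth_fun_const frame_field[OF f(2)])
    show "(\<Sum>i\<in>Basis. v (x i) *\<^sub>R E i p) = v" using frame_expand[OF f(2,1) assms] by simp
  qed
qed

lemma tangent_chain_rule:
  fixes \<xi> :: "real \<Rightarrow> real"
  assumes v: "v \<in> tangent_space A p" and f: "smooth_fun A f" and \<xi>: "smooth_on T \<xi>" "\<And>q. f q \<in> T"
    and D: "(\<xi> has_real_derivative c) (at (f p))"
  shows "v (\<lambda>q. \<xi> (f q)) = c * v f"
proof -
  obtain U \<phi> \<Omega> x E where ch: "(U, \<phi>) \<in> A" "p \<in> \<Omega>" "\<Omega> \<subseteq> U" and fr: "coordinate_frame \<Omega> x E"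
    and E: "\<And>i q f. i \<in> Basis \<Longrightarrow> q \<in> \<Omega> \<Longrightarrow> smooth_fun A f \<Longrightarrow> E i q f = frechet_derivative (f \<circ> inv_into U \<phi>) (at (\<phi> q)) i"
    using exists_coordinate_frame_chart[of p] by metis
  have p: "\<phi> p \<in> \<phi> ` U" "inv_into U \<phi> (\<phi> p) = p" using ch chart_inverse[OF ch(1)] by auto
  have s: "smooth_fun A (\<lambda>q. \<xi> (f q))" by (rule smooth_fun_compose[OF f \<xi>])
  have "E i p (\<lambda>q. \<xi> (f q)) = c * E i p f" if i: "i \<in> Basis" for i
  proof -
    have g: "((f \<circ> inv_into U \<phi>) has_derivative frechet_derivative (f \<circ> inv_into U \<phi>) (at (\<phi> p))) (at (\<phi> p))"
      by (rule smooth_on_has_derivative[OF smooth_fun_chart[OF f ch(1)] p(1)])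
    have "(\<xi> has_derivative (*) c) (at ((f \<circ> inv_into U \<phi>) (\<phi> p)))"
      using D p(2) by (simp add: has_field_derivative_def)
    from frechet_derivative_at[OF has_derivative_compose[OF g this]]
    have "frechet_derivative ((\<lambda>q. \<xi> (f q)) \<circ> inv_into U \<phi>) (at (\<phi> p)) = (\<lambda>w. c * frechet_derivative (f \<circ> inv_into U \<phi>) (at (\<phi> p)) w)"
      by (simp add: comp_def)
    then show ?thesis using E[OF i ch(2) s] E[OF i ch(2) f] by simp
  qed
  then have "(\<Sum>i\<in>Basis. v (x i) * E i p (\<lambda>q. \<xi> (f q))) = c * (\<Sum>i\<in>Basis. v (x i) * E i p f)"
    by (simp add: sum_distrib_left mult.left_commute)
  moreover have "v h = (\<Sum>i\<in>Basis. v (x i) * E i p h)" for h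
    using fun_cong[OF frame_expand[OF fr ch(2) v], of h] by (simp add: sum_fun_apply scaleR_fun_apply)
  ultimately show ?thesis by metis
qed

end


section \<open>Riemannian metrics: orthonormal frames and gradients\<close>

lemma span_image_combination:
  fixes f :: "'i \<Rightarrow> 'v::real_vector"
  assumes "finite I" "x \<in> span (f ` I)"
  obtains c where "x = (\<Sum>i\<in>I. c i *\<^sub>R f i)"
proof -
  let ?S = "{x. \<exists>c. x = (\<Sum>i\<in>I. c i *\<^sub>R f i)}"
  have "subspace ?S"
  proof (rule subspaceI)
    show "0 \<in> ?S" by (auto intro!: exI[of _ "\<lambda>i. 0"])
    fix x y c assume "x \<in> ?S" "y \<in> ?S"
    then obtain a b where "x = (\<Sum>i\<in>I. a i *\<^sub>R f i)" "y = (\<Sum>i\<in>I. b i *\<^sub>R f i)" by blast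
    then have "x + y = (\<Sum>i\<in>I. (a i + b i) *\<^sub>R f i)" "c *\<^sub>R x = (\<Sum>i\<in>I. (c * a i) *\<^sub>R f i)"
      by (simp_all add: scaleR_add_left sum.distrib scaleR_sum_right)
    then show "x + y \<in> ?S" "c *\<^sub>R x \<in> ?S"
      by (auto simp only: mem_Collect_eq)
  qed
  moreover have "f j \<in> ?S" if "j \<in> I" for j
  proof -
    have "f j = (\<Sum>i\<in>I. (if i = j then 1 else 0) *\<^sub>R f i)"
      using that assms(1) by (simp add: if_distrib[where f="\<lambda>c. c *\<^sub>R _"] sum.delta cong: if_cong)
    then show ?thesis by (intro CollectI exI)
  qed
  ultimately have "span (f ` I) \<subseteq> ?S" by (intro span_minimal) auto
  then show ?thesis using assms(2) that by blast
qed

lemma sum_kronecker: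
  fixes c :: "'i \<Rightarrow> real"
  assumes "finite I" "j \<in> I"
  shows "(\<Sum>i\<in>I. c i * (if i = j then 1 else 0)) = c j"
proof -
  have "(\<Sum>i\<in>I. c i * (if i = j then 1 else 0)) = (\<Sum>i\<in>I. if i = j then c i else 0)"
    by (rule sum.cong) auto
  then show ?thesis using assms by (simp add: sum.delta)
qed

context manifold
begin

lemma smooth_fun_continuous:
  assumes f: "smooth_fun A f"
  shows "continuous_on UNIV f"
proof (rule continuous_at_imp_continuous_on, rule ballI)
  fix q
  obtain U \<phi> where c: "(U, \<phi>) \<in> A" "q \<in> U" using chart_at by blast
  have "continuous_on U (\<lambda>x. (f \<circ> inv_into U \<phi>) (\<phi> x))"
    by (rule continuous_on_compose2[OF smooth_on_continuous[OF smooth_fun_chart[OF f c(1)]] chart_continuous[OF c(1)]]) simp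
  then have "continuous_on U f"
    using chart_inverse[OF c(1)] by (simp cong: continuous_on_cong_simp)
  then show "isCont f q" using open_domain[OF c(1)] c(2) by (simp add: continuous_on_eq_continuous_at)
qed

lemma open_smooth_preimage: "smooth_fun A f \<Longrightarrow> open T \<Longrightarrow> open (f -` T)"
  using continuous_open_preimage[OF smooth_fun_continuous open_UNIV, of f T] by simp

lemma smooth_near_compose:
  fixes \<xi> :: "real \<Rightarrow> real"
  assumes f: "smooth_fun A f" and \<xi>: "smooth_on T \<xi>" and T: "open T" "f p \<in> T"
  shows "smooth_near (\<lambda>q. \<xi> (f q)) p"
proof -
  obtain U \<phi> where c: "(U, \<phi>) \<in> A" "p \<in> U" using chart_at by blast
  let ?O = "U \<inter> f -` T"
  have O: "open ?O" "?O \<subseteq> U" "p \<in> ?O"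
    using open_domain[OF c(1)] open_smooth_preimage[OF f T(1)] c T by auto
  have "smooth_on (\<phi> ` ?O) (\<lambda>y. \<xi> ((f \<circ> inv_into U \<phi>) y))"
    by (rule smooth_on_compose[OF chart_image_open[OF c(1) O(1,2)] _ smooth_on_subset[OF smooth_fun_chart[OF f c(1)]] \<xi>])
      (auto simp: chart_inverse[OF c(1)])
  then show ?thesis unfolding smooth_near_def using c O by (auto simp: comp_def)
qed

end

locale riemannian = manifold A
  for A :: "('m::{t2_space, second_countable_topology}, 'e::euclidean_space) atlas" +
  fixes g :: "'m metric"
  assumes metric: "riemannian_metric A g"
begin

abbreviation "T \<equiv> tangent_space A"

lemmas T_subspace = tangent_space_subspace
lemmas T_zero [simp, intro] = subspace_0[OF T_subspace]
lemmas T_add [simp, intro] = subspace_add[OF T_subspace]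
lemmas T_diff [simp, intro] = subspace_diff[OF T_subspace]
lemmas T_scale [simp, intro] = subspace_scale[OF T_subspace]
lemmas T_neg [simp, intro] = subspace_neg[OF T_subspace]
lemmas T_sum = subspace_sum[OF T_subspace]

lemma g_sym: "u \<in> T p \<Longrightarrow> v \<in> T p \<Longrightarrow> g p u v = g p v u"
  and g_add_left: "u \<in> T p \<Longrightarrow> v \<in> T p \<Longrightarrow> w \<in> T p \<Longrightarrow> g p (u + v) w = g p u w + g p v w"
  and g_scale_left: "u \<in> T p \<Longrightarrow> v \<in> T p \<Longrightarrow> g p (c *\<^sub>R u) v = c * g p u v"
  and g_pos: "u \<in> T p \<Longrightarrow> u \<noteq> 0 \<Longrightarrow> g p u u > 0"
  and g_smooth: "vector_field A X \<Longrightarrow> vector_field A Y \<Longrightarrow> smooth_fun A (\<lambda>p. g p (X p) (Y p))"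
  using metric unfolding riemannian_metric_def by blast+

lemma g_add_right: "u \<in> T p \<Longrightarrow> v \<in> T p \<Longrightarrow> w \<in> T p \<Longrightarrow> g p w (u + v) = g p w u + g p w v"
  by (metis T_add g_add_left g_sym)

lemma g_scale_right: "u \<in> T p \<Longrightarrow> v \<in> T p \<Longrightarrow> g p v (c *\<^sub>R u) = c * g p v u"
  by (metis T_scale g_scale_left g_sym)

lemma g_zero_left [simp]: "v \<in> T p \<Longrightarrow> g p 0 v = 0"
  using g_scale_left[of 0 p v 0] by simp

lemma g_zero_right [simp]: "v \<in> T p \<Longrightarrow> g p v 0 = 0"
  using g_scale_right[of 0 p v 0] by simp

lemma g_minus_left: "u \<in> T p \<Longrightarrow> v \<in> T p \<Longrightarrow> g p (- u) v = - g p u v"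
  using g_scale_left[of u p v "-1"] by simp

lemma g_minus_right: "u \<in> T p \<Longrightarrow> v \<in> T p \<Longrightarrow> g p v (- u) = - g p v u"
  using g_scale_right[of u p v "-1"] by simp

lemma g_diff_left: "u \<in> T p \<Longrightarrow> v \<in> T p \<Longrightarrow> w \<in> T p \<Longrightarrow> g p (u - v) w = g p u w - g p v w"
  using g_add_left[of u p "- v" w] by (simp add: g_minus_left)

lemma g_sum_left:
  "(\<And>i. i \<in> I \<Longrightarrow> e i \<in> T p) \<Longrightarrow> w \<in> T p \<Longrightarrow> g p (\<Sum>i\<in>I. c i *\<^sub>R e i) w = (\<Sum>i\<in>I. c i * g p (e i) w)"
  by (induction I rule: infinite_finite_induct) (simp_all add: g_add_left g_scale_left T_sum)

lemma g_eq_0D: "u \<in> T p \<Longrightarrow> g p u u = 0 \<Longrightarrow> u = 0"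
  using g_pos by fastforce

lemma g_ext:
  assumes "u \<in> T p" "v \<in> T p" "\<And>w. w \<in> T p \<Longrightarrow> g p u w = g p v w"
  shows "u = v"
  using g_eq_0D[of "u - v" p] assms by (simp add: g_diff_left)

lemma orth_proj_eqI:
  assumes "subspace S" "S \<subseteq> T p" "v \<in> T p" "w \<in> S" "\<And>u. u \<in> S \<Longrightarrow> g p (v - w) u = 0"
  shows "orth_proj g p S v = w"
  unfolding orth_proj_def
proof (rule the_equality)
  fix w' assume w': "w' \<in> S \<and> (\<forall>u\<in>S. g p (v - w') u = 0)"
  let ?d = "w' - w"
  have d: "?d \<in> S" using w' assms(1,4) by (simp add: subspace_diff)
  have T: "?d \<in> T p" "v - w \<in> T p" "v - w' \<in> T p" using d w' assms by auto
  have "g p ((v - w) - (v - w')) ?d = g p (v - w) ?d - g p (v - w') ?d"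
    by (rule g_diff_left[OF T(2,3,1)])
  then have "g p ?d ?d = 0" using w' assms(5) d by simp
  then have "?d = 0" using g_eq_0D[OF T(1)] by simp
  then show "w' = w" by simp
qed (use assms in blast)

definition orthonormal_on :: "'m set \<Rightarrow> 'i set \<Rightarrow> ('i \<Rightarrow> 'm \<Rightarrow> 'm tvec) \<Rightarrow> bool" where
  "orthonormal_on \<Omega> I e \<longleftrightarrow> (\<forall>i\<in>I. vector_field A (e i)) \<and>
     (\<forall>q\<in>\<Omega>. \<forall>i\<in>I. \<forall>j\<in>I. g q (e i q) (e j q) = (if i = j then 1 else 0))"

lemma orthonormal_span_expand:
  assumes o: "orthonormal_on \<Omega> I e" "finite I" "q \<in> \<Omega>" and u: "u \<in> span ((\<lambda>i. e i q) ` I)"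
  shows "u = (\<Sum>i\<in>I. g q u (e i q) *\<^sub>R e i q)"
proof -
  obtain c where c: "u = (\<Sum>i\<in>I. c i *\<^sub>R e i q)" using span_image_combination[OF o(2) u] by blast
  have e: "e i q \<in> T q" if "i \<in> I" for i
    using o(1) that by (auto simp: orthonormal_on_def vector_field_tangent)
  have "g q u (e j q) = c j" if j: "j \<in> I" for j
  proof -
    have "g q u (e j q) = (\<Sum>i\<in>I. c i * g q (e i q) (e j q))"
      unfolding c by (rule g_sum_left[OF e e[OF j]])
    also have "\<dots> = (\<Sum>i\<in>I. c i * (if i = j then 1 else 0))"
      using o(1,3) j by (intro sum.cong) (auto simp: orthonormal_on_def)
    also have "\<dots> = c j" by (rule sum_kronecker[OF o(2) j])
    finally show ?thesis .
  qed
  then have "(\<Sum>i\<in>I. g q u (e i q) *\<^sub>R e i q) = (\<Sum>i\<in>I. c i *\<^sub>R e i q)"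
    by (intro sum.cong) auto
  then show ?thesis using c by simp
qed

definition same_span :: "'m set \<Rightarrow> 'i set \<Rightarrow> ('i \<Rightarrow> 'm \<Rightarrow> 'm tvec) \<Rightarrow> ('i \<Rightarrow> 'm \<Rightarrow> 'm tvec) \<Rightarrow> bool" where
  "same_span \<Omega> I Z e \<longleftrightarrow> (\<forall>q\<in>\<Omega>. \<forall>i\<in>I. Z i q \<in> span ((\<lambda>i. e i q) ` I) \<and> e i q \<in> span ((\<lambda>i. Z i q) ` I))"

text \<open>The usual process, carried out for fields. A normalizing factor is smooth where the remainder \<open>W\<close> of the
  new field does not vanish; linear independence at \<open>p\<close> ensures this near \<open>p\<close>, and the factor is extended
  from there to a smooth function on \<open>M\<close>.\<close>

lemma gram_schmidt:
  fixes Z :: "'i \<Rightarrow> 'm \<Rightarrow> 'm tvec"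
  assumes "finite I" "\<And>i. i \<in> I \<Longrightarrow> vector_field A (Z i)"
    and "\<And>c. (\<Sum>i\<in>I. c i *\<^sub>R Z i p) = 0 \<Longrightarrow> \<forall>i\<in>I. c i = 0"
  shows "\<exists>e \<Omega>. open \<Omega> \<and> p \<in> \<Omega> \<and> orthonormal_on \<Omega> I e \<and> same_span \<Omega> I Z e"
  using assms
proof (induction I rule: finite_induct)
  case empty
  show ?case by (rule exI, rule exI[of _ UNIV]) (simp add: orthonormal_on_def same_span_def)
next
  case (insert a I)
  have ind: "\<forall>i\<in>I. c i = 0" if c: "(\<Sum>i\<in>I. c i *\<^sub>R Z i p) = 0" for c
  proof -
    have "(\<Sum>i\<in>I. (c(a := 0)) i *\<^sub>R Z i p) = (\<Sum>i\<in>I. c i *\<^sub>R Z i p)"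
      using insert.hyps by (intro sum.cong) auto
    then have "(\<Sum>i\<in>insert a I. (c(a := 0)) i *\<^sub>R Z i p) = 0"
      using insert.hyps c by simp
    note * = insert.prems(2)[OF this]
    show ?thesis
    proof
      fix i assume "i \<in> I"
      then have "(c(a := 0)) i = 0" "i \<noteq> a" using * insert.hyps by blast+
      then show "c i = 0" by simp
    qed
  qed
  obtain e \<Omega>0 where e: "open \<Omega>0" "p \<in> \<Omega>0" "orthonormal_on \<Omega>0 I e" "same_span \<Omega>0 I Z e"
    using insert.IH[OF insert.prems(1)[OF insertI2] ind] by blast
  have sp: "Z i q \<in> span ((\<lambda>i. e i q) ` I)" "e i q \<in> span ((\<lambda>i. Z i q) ` I)" if "q \<in> \<Omega>0" "i \<in> I" for q i
    using e(4) that by (auto simp: same_span_def)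
  have ve: "vector_field A (e i)" if "i \<in> I" for i using e(3) that by (simp add: orthonormal_on_def)
  have vZ: "vector_field A (Z a)" using insert.prems(1) by simp
  define S where "S = (\<lambda>q. \<Sum>i\<in>I. g q (Z a q) (e i q) *\<^sub>R e i q)"
  define W where "W = (\<lambda>q. Z a q - S q)"
  have vS: "vector_field A S"
    unfolding S_def by (rule vector_field_sum, rule vector_field_scale[OF g_smooth[OF vZ]]) (rule ve, assumption)+
  have vW: "vector_field A W" unfolding W_def by (rule vector_field_diff[OF vZ vS])
  note tZ = vector_field_tangent[OF vZ] and tS = vector_field_tangent[OF vS] and tW = vector_field_tangent[OF vW]
    and te = vector_field_tangent[OF ve]
  define n where "n = (\<lambda>q. g q (W q) (W q))"
  have sn: "smooth_fun A n" unfolding n_def by (rule g_smooth[OF vW vW])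
  have S_span: "S q \<in> span ((\<lambda>i. e i q) ` I)" for q
    unfolding S_def by (intro span_sum span_scale span_base) auto
  have "W p \<noteq> 0"
  proof
    assume "W p = 0"
    then have "Z a p \<in> span ((\<lambda>i. e i p) ` I)" using S_span[of p] by (simp add: W_def)
    also have "span ((\<lambda>i. e i p) ` I) \<subseteq> span ((\<lambda>i. Z i p) ` I)"
      by (rule span_minimal) (use sp(2)[OF e(2)] in auto)
    finally obtain c where c: "Z a p = (\<Sum>i\<in>I. c i *\<^sub>R Z i p)"
      using span_image_combination[OF insert.hyps(1)] by metis
    have "(\<Sum>i\<in>I. (c(a := -1)) i *\<^sub>R Z i p) = (\<Sum>i\<in>I. c i *\<^sub>R Z i p)"
      using insert.hyps by (intro sum.cong) auto
    then have "(\<Sum>i\<in>insert a I. (c(a := -1)) i *\<^sub>R Z i p) = 0"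
      using insert.hyps c by simp
    from insert.prems(2)[OF this] show False by simp
  qed
  then have np: "n p \<in> {0<..}" using g_pos[OF tW] by (simp add: n_def)
  obtain s \<Omega>2 where s: "smooth_fun A s" "open \<Omega>2" "p \<in> \<Omega>2" "\<And>x. x \<in> \<Omega>2 \<Longrightarrow> s x = 1 / sqrt (n x)"
    by (rule smooth_near_extend[OF smooth_near_compose[OF sn smooth_on_inverse_sqrt open_greaterThan np]]) metis
  define \<Omega> where "\<Omega> = \<Omega>0 \<inter> \<Omega>2 \<inter> (n -` {0<..})"
  have \<Omega>: "open \<Omega>" "p \<in> \<Omega>"
    unfolding \<Omega>_def using e s np open_smooth_preimage[OF sn open_greaterThan] by auto
  define e' where "e' = e(a := (\<lambda>q. s q *\<^sub>R W q))"
  have e'a: "e' a q = s q *\<^sub>R W q" for q by (simp add: e'_def)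
  have e'i: "e' i = e i" if "i \<in> I" for i using that insert.hyps by (auto simp: e'_def)
  have img: "(\<lambda>i. e' i q) ` insert a I = insert (s q *\<^sub>R W q) ((\<lambda>i. e i q) ` I)" for q
    using e'i e'a by auto
  have orth: "g q (W q) (e j q) = 0" if q: "q \<in> \<Omega>" and j: "j \<in> I" for q j
  proof -
    have "g q (S q) (e j q) = (\<Sum>i\<in>I. g q (Z a q) (e i q) * g q (e i q) (e j q))"
      unfolding S_def by (rule g_sum_left) (use te j in auto)
    also have "\<dots> = (\<Sum>i\<in>I. g q (Z a q) (e i q) * (if i = j then 1 else 0))"
      using e(3) q j by (intro sum.cong) (auto simp: orthonormal_on_def \<Omega>_def)
    also have "\<dots> = g q (Z a q) (e j q)" by (rule sum_kronecker[OF insert.hyps(1) j])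
    finally show ?thesis using tZ tS te[OF j] by (simp add: W_def g_diff_left)
  qed
  have unit: "g q (s q *\<^sub>R W q) (s q *\<^sub>R W q) = 1" if "q \<in> \<Omega>" for q
  proof -
    have "n q > 0" "s q = 1 / sqrt (n q)" using that s by (auto simp: \<Omega>_def)
    then have "s q * (s q * n q) = 1" by (simp add: real_div_sqrt)
    then show ?thesis using tW by (simp add: g_scale_left g_scale_right n_def)
  qed
  have "orthonormal_on \<Omega> (insert a I) e'"
    unfolding orthonormal_on_def
  proof (intro conjI ballI)
    fix i assume "i \<in> insert a I"
    then show "vector_field A (e' i)"
      using e'i ve vector_field_scale[OF s(1) vW] by (auto simp: e'_def)
  next
    fix q i j assume q: "q \<in> \<Omega>" and i: "i \<in> insert a I" and j: "j \<in> insert a I"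
    have o: "g q (e i q) (e j q) = (if i = j then 1 else 0)" if "i \<in> I" "j \<in> I"
      using e(3) q that by (auto simp: orthonormal_on_def \<Omega>_def)
    have aI: "a \<notin> I" by fact
    consider "i = a" "j = a" | "i = a" "j \<in> I" | "i \<in> I" "j = a" | "i \<in> I" "j \<in> I" using i j by blast
    then show "g q (e' i q) (e' j q) = (if i = j then 1 else 0)"
    proof cases
      case 1 then show ?thesis using unit[OF q] by (simp add: e'a)
    next
      case 2
      then have "i \<noteq> j" using aI by blast
      then show ?thesis using 2 orth[OF q 2(2)] tW te[OF 2(2)] by (simp add: e'a e'i g_scale_left)
    next
      case 3
      then have "i \<noteq> j" using aI by blast
      then show ?thesis using 3 orth[OF q 3(1)] tW te[OF 3(1)] g_sym[OF te[OF 3(1)] tW]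
        by (simp add: e'a e'i g_scale_right)
    next
      case 4 then show ?thesis using o by (simp add: e'i)
    qed
  qed
  moreover have span: "Z i q \<in> span ((\<lambda>i. e' i q) ` insert a I) \<and> e' i q \<in> span ((\<lambda>i. Z i q) ` insert a I)"
    if q: "q \<in> \<Omega>" and i: "i \<in> insert a I" for q i
  proof -
    have q0: "q \<in> \<Omega>0" using q by (simp add: \<Omega>_def)
    have mono: "span ((\<lambda>i. e i q) ` I) \<subseteq> span ((\<lambda>i. e' i q) ` insert a I)"
      unfolding img by (rule span_mono) blast
    have mono': "span ((\<lambda>i. Z i q) ` I) \<subseteq> span ((\<lambda>i. Z i q) ` insert a I)"
      by (rule span_mono) blast
    have SZ: "S q \<in> span ((\<lambda>i. Z i q) ` insert a I)"
    proof -
      have "span ((\<lambda>i. e i q) ` I) \<subseteq> span ((\<lambda>i. Z i q) ` I)"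
        by (rule span_minimal) (use sp(2)[OF q0] in auto)
      then show ?thesis using S_span mono' by blast
    qed
    have n: "n q > 0" "s q = 1 / sqrt (n q)" using q s by (auto simp: \<Omega>_def)
    have "e' a q \<in> span ((\<lambda>i. Z i q) ` insert a I)"
      unfolding e'a W_def by (intro span_scale span_diff SZ span_base) simp
    moreover have "Z a q \<in> span ((\<lambda>i. e' i q) ` insert a I)"
    proof -
      have "Z a q = sqrt (n q) *\<^sub>R (s q *\<^sub>R W q) + S q"
        using n by (simp add: W_def)
      moreover have "s q *\<^sub>R W q \<in> span ((\<lambda>i. e' i q) ` insert a I)"
        unfolding img by (rule span_base) simp
      moreover have "S q \<in> span ((\<lambda>i. e' i q) ` insert a I)" using S_span mono by blast
      ultimately show ?thesis by (metis span_add span_scale)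
    qed
    moreover have "Z i q \<in> span ((\<lambda>i. e' i q) ` insert a I)" "e' i q \<in> span ((\<lambda>i. Z i q) ` insert a I)" if "i \<in> I"
      using sp[OF q0 that] mono mono' e'i[OF that] by auto
    ultimately show ?thesis using i by blast
  qed
  then have "same_span \<Omega> (insert a I) Z e'" unfolding same_span_def by blast
  ultimately show ?case using \<Omega> by blast
qed

definition orthonormal_frame :: "'m set \<Rightarrow> ('e \<Rightarrow> 'm \<Rightarrow> 'm tvec) \<Rightarrow> bool" where
  "orthonormal_frame \<Omega> e \<longleftrightarrow> open \<Omega> \<and> orthonormal_on \<Omega> Basis e \<and>
     (\<forall>q\<in>\<Omega>. \<forall>v\<in>T q. v = (\<Sum>i\<in>Basis. g q v (e i q) *\<^sub>R e i q))"

lemma exists_orthonormal_frame: "\<exists>\<Omega> e. p \<in> \<Omega> \<and> orthonormal_frame \<Omega> e"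
proof -
  obtain \<Omega>1 x E where f: "p \<in> \<Omega>1" "coordinate_frame \<Omega>1 x E" using exists_coordinate_frame by blast
  have ind: "\<forall>i\<in>Basis. c i = 0" if "(\<Sum>i\<in>Basis. c i *\<^sub>R E i p) = 0" for c
  proof
    fix j :: 'e assume j: "j \<in> Basis"
    have "0 = (\<Sum>i\<in>Basis. c i *\<^sub>R E i p) (x j)" using that by simp
    also have "\<dots> = (\<Sum>i\<in>Basis. c i * (if i = j then 1 else 0))"
      unfolding sum_fun_apply scaleR_fun_apply real_scaleR_def
      by (rule sum.cong[OF refl]) (simp only: frame_dual[OF f(2,1) _ j])
    also have "\<dots> = c j" by (rule sum_kronecker[OF finite_Basis j])
    finally show "c j = 0" by simp
  qed
  obtain e \<Omega>2 where e: "open \<Omega>2" "p \<in> \<Omega>2" "orthonormal_on \<Omega>2 Basis e" "same_span \<Omega>2 Basis E e"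
    using gram_schmidt[of Basis E p, OF finite_Basis frame_field[OF f(2)] ind] by blast
  have "v = (\<Sum>i\<in>Basis. g q v (e i q) *\<^sub>R e i q)" if q: "q \<in> \<Omega>1 \<inter> \<Omega>2" and v: "v \<in> T q" for q v
  proof -
    have "(\<Sum>i\<in>Basis. v (x i) *\<^sub>R E i q) \<in> span ((\<lambda>i. e i q) ` Basis)"
      by (intro span_sum span_scale) (use e(4) q in \<open>simp add: same_span_def\<close>)
    then have "v \<in> span ((\<lambda>i. e i q) ` Basis)"
      using frame_expand[OF f(2) _ v] q by simp
    then show "v = (\<Sum>i\<in>Basis. g q v (e i q) *\<^sub>R e i q)"
      by (intro orthonormal_span_expand[OF e(3)]) (use q in auto)
  qed
  moreover have "open (\<Omega>1 \<inter> \<Omega>2)" "p \<in> \<Omega>1 \<inter> \<Omega>2" using frame_open[OF f(2)] e f by auto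
  moreover have "orthonormal_on (\<Omega>1 \<inter> \<Omega>2) Basis e" using e(3) by (auto simp: orthonormal_on_def)
  ultimately show ?thesis
    by (intro exI[of _ "\<Omega>1 \<inter> \<Omega>2"] exI[of _ e]) (auto simp only: orthonormal_frame_def)
qed

definition frame_gradient :: "('e \<Rightarrow> 'm \<Rightarrow> 'm tvec) \<Rightarrow> ('m \<Rightarrow> real) \<Rightarrow> 'm \<Rightarrow> 'm tvec" where
  "frame_gradient e f q = (\<Sum>i\<in>Basis. e i q f *\<^sub>R e i q)"

lemma gradient_eq_frame_gradient:
  assumes fr: "orthonormal_frame \<Omega> e" and q: "q \<in> \<Omega>"
  shows "frame_gradient e f q \<in> T q" "w \<in> T q \<Longrightarrow> g q (frame_gradient e f q) w = w f"
    "gradient A g f q = frame_gradient e f q"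
proof -
  have te: "e i q \<in> T q" if "i \<in> Basis" for i
    using fr that by (simp add: orthonormal_frame_def orthonormal_on_def vector_field_tangent)
  show t: "frame_gradient e f q \<in> T q"
    unfolding frame_gradient_def by (intro T_sum T_scale te)
  have G: "g q (frame_gradient e f q) w = w f" if w: "w \<in> T q" for w
  proof -
    have "g q (frame_gradient e f q) w = (\<Sum>i\<in>Basis. e i q f * g q (e i q) w)"
      unfolding frame_gradient_def by (rule g_sum_left[OF te w])
    also have "\<dots> = (\<Sum>i\<in>Basis. g q w (e i q) * e i q f)"
      by (rule sum.cong[OF refl]) (simp add: g_sym[OF te w])
    also have "\<dots> = (\<Sum>i\<in>Basis. g q w (e i q) *\<^sub>R e i q) f"
      by (simp add: sum_fun_apply scaleR_fun_apply)
    also have "(\<Sum>i\<in>Basis. g q w (e i q) *\<^sub>R e i q) = w"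
      using fr q w unfolding orthonormal_frame_def by simp
    finally show ?thesis .
  qed
  then show "w \<in> T q \<Longrightarrow> g q (frame_gradient e f q) w = w f" .
  show "gradient A g f q = frame_gradient e f q"
    unfolding gradient_def
  proof (rule the_equality)
    fix v assume "v \<in> T q \<and> (\<forall>w\<in>T q. g q v w = w f)"
    then show "v = frame_gradient e f q" using t G by (intro g_ext[of v q]) simp_all
  qed (use t G in blast)
qed

lemma gradient_tangent: "gradient A g f p \<in> T p"
  and g_gradient: "w \<in> T p \<Longrightarrow> g p (gradient A g f p) w = w f"
  using exists_orthonormal_frame[of p] gradient_eq_frame_gradient by fastforce+

lemma gradient_field:
  assumes f: "smooth_fun A f"
  shows "vector_field A (gradient A g f)"
proof (rule vector_field_local)
  fix p
  obtain \<Omega> e where e: "p \<in> \<Omega>" "orthonormal_frame \<Omega> e" using exists_orthonormal_frame by blast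
  have "vector_field A (frame_gradient e f)"
    unfolding frame_gradient_def
    by (rule vector_field_sum, rule vector_field_scale, rule vector_field_smooth[OF _ f])
      (use e(2) in \<open>simp_all add: orthonormal_frame_def orthonormal_on_def\<close>)
  moreover have "open \<Omega>" using e(2) by (simp add: orthonormal_frame_def)
  ultimately show "\<exists>\<Omega> Y. open \<Omega> \<and> p \<in> \<Omega> \<and> vector_field A Y \<and> (\<forall>q\<in>\<Omega>. gradient A g f q = Y q)"
    using e gradient_eq_frame_gradient(3)[OF e(2)]
    by (intro exI[of _ \<Omega>] exI[of _ "frame_gradient e f"]) simp
qed

end


section \<open>Horizontal and vertical distributions of a conformal submersion\<close>

lemma pushforward_add: "pushforward B F (u + v) = pushforward B F u + pushforward B F v"
  and pushforward_scale: "pushforward B F (c *\<^sub>R u) = c *\<^sub>R pushforward B F u"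
  and pushforward_zero: "pushforward B F 0 = 0"
  and pushforward_diff: "pushforward B F (u - v) = pushforward B F u - pushforward B F v"
  by (auto simp: pushforward_def scaleR_fun_apply)

lemma pushforward_apply: "smooth_fun B h \<Longrightarrow> pushforward B F v h = v (\<lambda>q. h (F q))"
  by (simp add: pushforward_def comp_def)

locale conformal_submersion = M: riemannian A g + N: riemannian B g'
  for A :: "('m::{t2_space, second_countable_topology}, 'e::euclidean_space) atlas" and g :: "'m metric"
    and B :: "('n::{t2_space, second_countable_topology}, 'f::euclidean_space) atlas" and g' :: "'n metric" +
  fixes F :: "'m \<Rightarrow> 'n" and lam :: "'m \<Rightarrow> real"
  assumes conformal: "horizontally_conformal A g B g' F lam"
begin

abbreviation "Ver \<equiv> ver A B F"
abbreviation "Hor \<equiv> hor A g B F"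
abbreviation "push \<equiv> pushforward B F"
abbreviation "hpart \<equiv> hor_part A g B F"
abbreviation "vpart \<equiv> ver_part A g B F"

lemma submersion: "smooth_submersion A B F" and smooth_lam: "smooth_fun A lam" and lam_pos: "lam p > 0"
  and conformal_eq: "u \<in> Hor p \<Longrightarrow> v \<in> Hor p \<Longrightarrow> g' (F p) (push u) (push v) = (lam p)\<^sup>2 * g p u v"
  using conformal by (auto simp: horizontally_conformal_def)

lemma push_image: "push ` M.T p = N.T (F p)"
  using submersion unfolding smooth_submersion_def by simp

lemma push_tangent: "v \<in> M.T p \<Longrightarrow> push v \<in> N.T (F p)"
  using push_image[of p] by blast

lemma push_surj: "w \<in> N.T (F p) \<Longrightarrow> \<exists>v\<in>M.T p. push v = w"
  unfolding push_image[symmetric] by blast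

lemma continuous_F: "continuous_on UNIV F"
  using submersion by (simp add: smooth_submersion_def smooth_map_def)

lemma open_preimage_F: "open V \<Longrightarrow> open (F -` V)"
  using continuous_open_preimage[OF continuous_F open_UNIV, of V] by simp

lemma smooth_fun_comp_F:
  assumes h: "smooth_fun B h"
  shows "smooth_fun A (\<lambda>q. h (F q))"
  unfolding M.smooth_fun_iff_near
proof
  fix q
  obtain U \<phi> where c: "(U, \<phi>) \<in> A" "q \<in> U" using M.chart_at by blast
  obtain V \<psi> where d: "(V, \<psi>) \<in> B" "F q \<in> V" using N.chart_at by blast
  let ?O = "U \<inter> F -` V"
  have O: "open ?O" "?O \<subseteq> U" "q \<in> ?O"
    using M.open_domain[OF c(1)] open_preimage_F[OF N.open_domain[OF d(1)]] c d by auto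
  have "\<forall>(U, \<phi>)\<in>A. \<forall>(V, \<psi>)\<in>B. smooth_on (\<phi> ` (U \<inter> F -` V)) (\<psi> \<circ> F \<circ> inv_into U \<phi>)"
    using submersion by (simp add: smooth_submersion_def smooth_map_def)
  from bspec[OF this c(1)]
  have "\<forall>(V, \<psi>)\<in>B. smooth_on (\<phi> ` (U \<inter> F -` V)) (\<psi> \<circ> F \<circ> inv_into U \<phi>)" by simp
  from bspec[OF this d(1)]
  have sF: "smooth_on (\<phi> ` ?O) (\<psi> \<circ> F \<circ> inv_into U \<phi>)" by simp
  have o: "open (\<phi> ` ?O)" by (rule M.chart_image_open[OF c(1) O(1,2)])
  have inv: "inv_into U \<phi> (\<phi> x) = x" if "x \<in> U" for x using M.chart_inverse[OF c(1) that] .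
  have "smooth_on (\<phi> ` ?O) (\<lambda>y. (h \<circ> inv_into V \<psi>) ((\<psi> \<circ> F \<circ> inv_into U \<phi>) y))"
    by (rule smooth_on_compose[OF o _ sF N.smooth_fun_chart[OF h d(1)]]) (auto simp: inv)
  then have "smooth_on (\<phi> ` ?O) ((\<lambda>q. h (F q)) \<circ> inv_into U \<phi>)"
    by (rule smooth_on_cong[OF o, rotated]) (auto simp: inv N.chart_inverse[OF d(1)])
  then show "M.smooth_near (\<lambda>q. h (F q)) q" unfolding M.smooth_near_def using c O by blast
qed

lemma Ver_iff: "v \<in> Ver p \<longleftrightarrow> v \<in> M.T p \<and> push v = 0"
  by (simp add: ver_def)

lemma Ver_tangent: "v \<in> Ver p \<Longrightarrow> v \<in> M.T p" and Hor_tangent: "v \<in> Hor p \<Longrightarrow> v \<in> M.T p"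
  by (auto simp: ver_def hor_def)

lemma Hor_Ver_orthogonal: "u \<in> Hor p \<Longrightarrow> v \<in> Ver p \<Longrightarrow> g p u v = 0"
  by (auto simp: hor_def)

lemma Ver_Hor_orthogonal: "v \<in> Ver p \<Longrightarrow> u \<in> Hor p \<Longrightarrow> g p v u = 0"
  using Hor_Ver_orthogonal M.g_sym Ver_tangent Hor_tangent by metis

lemma Ver_subspace: "subspace (Ver p)"
  by (rule subspaceI) (auto simp: Ver_iff pushforward_add pushforward_scale pushforward_zero)

lemma Hor_subspace: "subspace (Hor p)"
  by (rule subspaceI) (auto simp: hor_def ver_def M.g_add_left M.g_scale_left)

lemma Hor_Ver_zero: "v \<in> Hor p \<Longrightarrow> v \<in> Ver p \<Longrightarrow> v = 0"
  using Hor_Ver_orthogonal M.g_eq_0D Ver_tangent by metis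

text \<open>The gradients of the functions \<open>h \<circ> F\<close> are horizontal and span the horizontal spaces; hence
  these spaces have smooth orthonormal frames.\<close>

definition horizontal_frame :: "'m set \<Rightarrow> ('f \<Rightarrow> 'm \<Rightarrow> 'm tvec) \<Rightarrow> bool" where
  "horizontal_frame \<Omega> e \<longleftrightarrow> open \<Omega> \<and> M.orthonormal_on \<Omega> Basis e \<and>
     (\<forall>q\<in>\<Omega>. \<forall>i\<in>Basis. e i q \<in> Hor q) \<and>
     (\<forall>q\<in>\<Omega>. \<forall>v\<in>M.T q. v - (\<Sum>i\<in>Basis. g q v (e i q) *\<^sub>R e i q) \<in> Ver q)"

lemma exists_horizontal_frame: "\<exists>\<Omega> e. p \<in> \<Omega> \<and> horizontal_frame \<Omega> e"
proof -
  obtain \<Omega>1 y E where f: "F p \<in> \<Omega>1" "N.coordinate_frame \<Omega>1 y E" using N.exists_coordinate_frame by blast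
  define Z where "Z = (\<lambda>i. gradient A g (\<lambda>q. y i (F q)))"
  have sy: "smooth_fun A (\<lambda>q. y i (F q))" if "i \<in> Basis" for i
    by (rule smooth_fun_comp_F[OF N.frame_smooth[OF f(2) that]])
  have vZ: "vector_field A (Z i)" if "i \<in> Basis" for i
    unfolding Z_def by (rule M.gradient_field[OF sy[OF that]])
  have gZ: "g q (Z i q) w = push w (y i)" if "i \<in> Basis" "w \<in> M.T q" for i q w
    unfolding Z_def M.g_gradient[OF that(2)] pushforward_apply[OF N.frame_smooth[OF f(2) that(1)]] ..
  have ind: "\<forall>i\<in>Basis. c i = 0" if "(\<Sum>i\<in>Basis. c i *\<^sub>R Z i p) = 0" for c
  proof
    fix j :: 'f assume j: "j \<in> Basis"
    obtain w where w: "w \<in> M.T p" "push w = E j (F p)"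
      using push_surj[OF N.vector_field_tangent[OF N.frame_field[OF f(2) j]]] by blast
    have "0 = g p (\<Sum>i\<in>Basis. c i *\<^sub>R Z i p) w" using that w by simp
    also have "\<dots> = (\<Sum>i\<in>Basis. c i * g p (Z i p) w)"
      by (rule M.g_sum_left[OF M.vector_field_tangent[OF vZ] w(1)])
    also have "\<dots> = (\<Sum>i\<in>Basis. c i * (if i = j then 1 else 0))"
      by (rule sum.cong[OF refl]) (auto simp: gZ[OF _ w(1)] w(2) N.frame_dual[OF f(2,1) j])
    also have "\<dots> = c j" by (rule sum_kronecker[OF finite_Basis j])
    finally show "c j = 0" by simp
  qed
  obtain e \<Omega>2 where e: "open \<Omega>2" "p \<in> \<Omega>2" "M.orthonormal_on \<Omega>2 Basis e" "M.same_span \<Omega>2 Basis Z e"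
    using M.gram_schmidt[of Basis Z p, OF finite_Basis vZ ind] by blast
  have te: "e i q \<in> M.T q" if "i \<in> Basis" for i q
    using e(3) that by (simp add: M.orthonormal_on_def M.vector_field_tangent)
  let ?O = "\<Omega>2 \<inter> F -` \<Omega>1"
  have ZH: "Z i q \<in> Hor q" if "i \<in> Basis" for i q
    using M.vector_field_tangent[OF vZ[OF that]] gZ[OF that] by (auto simp: hor_def Ver_iff)
  have eH: "e i q \<in> Hor q" if "q \<in> ?O" "i \<in> Basis" for q i
  proof -
    have "span ((\<lambda>i. Z i q) ` Basis) \<subseteq> Hor q"
      by (rule span_minimal[OF _ Hor_subspace]) (use ZH in auto)
    then show ?thesis using e(4) that by (auto simp: M.same_span_def)
  qed
  have "v - (\<Sum>i\<in>Basis. g q v (e i q) *\<^sub>R e i q) \<in> Ver q" (is "?d \<in> _") if q: "q \<in> ?O" and v: "v \<in> M.T q" for q v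
  proof -
    let ?s = "\<Sum>i\<in>Basis. g q v (e i q) *\<^sub>R e i q"
    have ts: "?s \<in> M.T q" by (intro M.T_sum M.T_scale te)
    then have d: "?d \<in> M.T q" using v by simp
    have "g q ?s (e j q) = g q v (e j q)" if j: "j \<in> Basis" for j
    proof -
      have "g q ?s (e j q) = (\<Sum>i\<in>Basis. g q v (e i q) * g q (e i q) (e j q))"
        by (rule M.g_sum_left[OF te te[OF j]])
      also have "\<dots> = (\<Sum>i\<in>Basis. g q v (e i q) * (if i = j then 1 else 0))"
        using e(3) q j by (intro sum.cong) (auto simp: M.orthonormal_on_def)
      also have "\<dots> = g q v (e j q)" by (rule sum_kronecker[OF finite_Basis j])
      finally show ?thesis .
    qed
    then have de: "g q (e j q) ?d = 0" if "j \<in> Basis" for j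
      using that te[OF that] ts v d M.g_sym[OF te[OF that] d] by (simp add: M.g_diff_left)
    have "subspace {u \<in> M.T q. g q u ?d = 0}"
      by (rule subspaceI) (use d in \<open>auto simp: M.g_add_left M.g_scale_left\<close>)
    then have "span ((\<lambda>i. e i q) ` Basis) \<subseteq> {u \<in> M.T q. g q u ?d = 0}"
      by (intro span_minimal) (use de te in auto)
    then have "g q (Z i q) ?d = 0" if "i \<in> Basis" for i
      using e(4) q that by (auto simp: M.same_span_def)
    then have "push ?d (y i) = 0" if "i \<in> Basis" for i using gZ[OF that d] that by simp
    then have "push ?d = 0"
      by (intro N.frame_ext[OF f(2) _ push_tangent[OF d]]) (use q in auto)
    then show ?thesis using d by (simp add: Ver_iff)
  qed
  moreover have "open ?O" "p \<in> ?O"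
    using e f open_preimage_F[OF N.frame_open[OF f(2)]] by auto
  moreover have "M.orthonormal_on ?O Basis e" using e(3) by (auto simp: M.orthonormal_on_def)
  ultimately show ?thesis
    using eH by (intro exI[of _ ?O] exI[of _ e]) (simp add: horizontal_frame_def)
qed

lemma hor_proj_eqI:
  assumes "v \<in> M.T p" "w \<in> Hor p" "v - w \<in> Ver p"
  shows "orth_proj g p (Hor p) v = w"
  by (rule M.orth_proj_eqI[OF Hor_subspace]) (use assms Ver_Hor_orthogonal Hor_tangent in auto)

lemma ver_proj_eqI:
  assumes "v \<in> M.T p" "w \<in> Ver p" "v - w \<in> Hor p"
  shows "orth_proj g p (Ver p) v = w"
  by (rule M.orth_proj_eqI[OF Ver_subspace]) (use assms Hor_Ver_orthogonal Ver_tangent in auto)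

lemma hor_frame_sum:
  assumes "M.orthonormal_on \<Omega> (Basis :: 'f set) e" "\<And>i. i \<in> Basis \<Longrightarrow> e i q \<in> Hor q"
  shows "(\<Sum>i\<in>Basis. c i *\<^sub>R e i q) \<in> Hor q"
  by (intro subspace_sum[OF Hor_subspace] subspace_scale[OF Hor_subspace] assms)

lemma decomposition:
  assumes v: "v \<in> M.T p"
  shows "orth_proj g p (Hor p) v \<in> Hor p" "orth_proj g p (Ver p) v \<in> Ver p"
    "v = orth_proj g p (Ver p) v + orth_proj g p (Hor p) v"
proof -
  obtain \<Omega> e where fr: "p \<in> \<Omega>" "horizontal_frame \<Omega> e" using exists_horizontal_frame by blast
  then have e: "open \<Omega>" "p \<in> \<Omega>" "M.orthonormal_on \<Omega> Basis e"
    "\<And>q i. q \<in> \<Omega> \<Longrightarrow> i \<in> Basis \<Longrightarrow> e i q \<in> Hor q"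
    "\<And>q v. q \<in> \<Omega> \<Longrightarrow> v \<in> M.T q \<Longrightarrow> v - (\<Sum>i\<in>Basis. g q v (e i q) *\<^sub>R e i q) \<in> Ver q"
    by (auto simp: horizontal_frame_def)
  let ?h = "\<Sum>i\<in>Basis. g p v (e i p) *\<^sub>R e i p"
  have h: "?h \<in> Hor p" by (rule hor_frame_sum[OF e(3) e(4)[OF e(2)]])
  have d: "v - ?h \<in> Ver p" by (rule e(5)[OF e(2) v])
  have "orth_proj g p (Hor p) v = ?h" by (rule hor_proj_eqI[OF v h d])
  moreover have "orth_proj g p (Ver p) v = v - ?h" by (rule ver_proj_eqI[OF v d]) (use h in simp)
  ultimately show "orth_proj g p (Hor p) v \<in> Hor p" "orth_proj g p (Ver p) v \<in> Ver p"
    "v = orth_proj g p (Ver p) v + orth_proj g p (Hor p) v"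
    using h d by simp_all
qed

lemma hpart_field:
  assumes X: "vector_field A X"
  shows "vector_field A (hpart X)"
proof (rule M.vector_field_local)
  fix p
  obtain \<Omega> e where fr: "p \<in> \<Omega>" "horizontal_frame \<Omega> e" using exists_horizontal_frame by blast
  then have e: "open \<Omega>" "p \<in> \<Omega>" "M.orthonormal_on \<Omega> Basis e"
    "\<And>q i. q \<in> \<Omega> \<Longrightarrow> i \<in> Basis \<Longrightarrow> e i q \<in> Hor q"
    "\<And>q v. q \<in> \<Omega> \<Longrightarrow> v \<in> M.T q \<Longrightarrow> v - (\<Sum>i\<in>Basis. g q v (e i q) *\<^sub>R e i q) \<in> Ver q"
    by (auto simp: horizontal_frame_def)
  let ?Y = "\<lambda>q. \<Sum>i\<in>Basis. g q (X q) (e i q) *\<^sub>R e i q"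
  have "vector_field A ?Y"
    by (intro M.vector_field_sum M.vector_field_scale M.g_smooth X) (use e(3) in \<open>auto simp: M.orthonormal_on_def\<close>)
  moreover have "hpart X q = ?Y q" if q: "q \<in> \<Omega>" for q
    unfolding hor_part_def
    by (rule hor_proj_eqI[OF M.vector_field_tangent[OF X] hor_frame_sum[OF e(3) e(4)[OF q]] e(5)[OF q M.vector_field_tangent[OF X]]])
  ultimately show "\<exists>\<Omega> Y. open \<Omega> \<and> p \<in> \<Omega> \<and> vector_field A Y \<and> (\<forall>q\<in>\<Omega>. hpart X q = Y q)"
    using e(1,2) by blast
qed

lemma hpart_Hor: "vector_field A X \<Longrightarrow> hpart X p \<in> Hor p"
  and vpart_Ver: "vector_field A X \<Longrightarrow> vpart X p \<in> Ver p"
  and hpart_vpart: "vector_field A X \<Longrightarrow> X p = vpart X p + hpart X p"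
  unfolding hor_part_def ver_part_def by (rule decomposition; rule M.vector_field_tangent; assumption)+

lemma vpart_field:
  assumes "vector_field A X"
  shows "vector_field A (vpart X)"
proof -
  have "vpart X = (\<lambda>p. X p - hpart X p)"
    using hpart_vpart[OF assms] by (metis (no_types) add_diff_cancel ext)
  then show ?thesis using M.vector_field_diff[OF assms hpart_field[OF assms]] by simp
qed

lemma hpart_eqI: "X p \<in> Hor p \<Longrightarrow> hpart X p = X p" and vpart_Hor: "X p \<in> Hor p \<Longrightarrow> vpart X p = 0"
  unfolding hor_part_def ver_part_def
  by (auto intro!: hor_proj_eqI ver_proj_eqI Hor_tangent subspace_0[OF Ver_subspace])

lemma vpart_eqI: "X p \<in> Ver p \<Longrightarrow> vpart X p = X p" and hpart_Ver: "X p \<in> Ver p \<Longrightarrow> hpart X p = 0"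
  unfolding hor_part_def ver_part_def
  by (auto intro!: hor_proj_eqI ver_proj_eqI Ver_tangent subspace_0[OF Hor_subspace])

lemma vertical_extends:
  assumes "v \<in> Ver p"
  obtains X where "section_of A Ver X" "X p = v"
proof -
  obtain X where X: "vector_field A X" "X p = v" using M.tangent_vector_extends[OF Ver_tangent[OF assms]] by blast
  show ?thesis using that[of "vpart X"] vpart_field[OF X(1)] vpart_Ver[OF X(1)] vpart_eqI[of X p] X assms
    by (simp add: section_of_def)
qed

end


section \<open>Connections on the total space and along the submersion\<close>

text \<open>The Koszul formula follows from compatibility with the metric and control of the torsion alone. With
  \<open>a\<^sub>1, \<dots>, a\<^sub>6\<close> the inner products of covariant derivatives, it serves the Levi-Civita connection and
  the pullback connection alike.\<close>

lemma Koszul_algebra: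
  fixes xyz :: real
  assumes "xyz = a1 + a2" "yxz = a3 + a4" "zxy = a5 + a6"
    and "a1 - a3 = t1" "a2 - a5 = t2" "a4 - a6 = t3"
  shows "2 * a1 = xyz + yxz - zxy + t1 - t2 - t3"
  using assms by linarith

locale submersion_connections = conformal_submersion A g B g' F lam
  for A :: "('m::{t2_space, second_countable_topology}, 'e::euclidean_space) atlas" and g :: "'m metric"
    and B :: "('n::{t2_space, second_countable_topology}, 'f::euclidean_space) atlas" and g' :: "'n metric"
    and F lam +
  fixes nabla :: "'m conn" and nablaN :: "'n conn"
    and nablaF :: "('m \<Rightarrow> 'm tvec) \<Rightarrow> ('m \<Rightarrow> 'n tvec) \<Rightarrow> 'm \<Rightarrow> 'n tvec"
  assumes lc: "levi_civita A g nabla" and lcN: "levi_civita B g' nablaN"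
    and pullback: "pullback_connection A B F nablaN nablaF"
begin

abbreviation "vf \<equiv> vector_field A"
abbreviation "vfN \<equiv> vector_field B"
abbreviation "sec \<equiv> section_along A B F"

lemma nabla_field: "vf X \<Longrightarrow> vf Y \<Longrightarrow> vf (nabla X Y)"
  and nabla_add: "vf X \<Longrightarrow> vf Y \<Longrightarrow> vf Y' \<Longrightarrow> nabla X (Y + Y') = nabla X Y + nabla X Y'"
  and nabla_scale: "smooth_fun A f \<Longrightarrow> vf X \<Longrightarrow> vf Y \<Longrightarrow>
    nabla X (\<lambda>p. f p *\<^sub>R Y p) = (\<lambda>p. X p f *\<^sub>R Y p + f p *\<^sub>R nabla X Y p)"
  and nabla_torsion: "vf X \<Longrightarrow> vf Y \<Longrightarrow> nabla X Y - nabla Y X = lie_bracket X Y"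
  and nabla_metric: "vf X \<Longrightarrow> vf Y \<Longrightarrow> vf Z \<Longrightarrow>
    X p (\<lambda>q. g q (Y q) (Z q)) = g p (nabla X Y p) (Z p) + g p (Y p) (nabla X Z p)"
  using lc unfolding levi_civita_def affine_connection_def by (elim conjE; meson)+

lemma nablaN_torsion: "vfN X \<Longrightarrow> vfN Y \<Longrightarrow> nablaN X Y - nablaN Y X = lie_bracket X Y"
  and nablaN_metric: "vfN X \<Longrightarrow> vfN Y \<Longrightarrow> vfN Z \<Longrightarrow>
    X p (\<lambda>q. g' q (Y q) (Z q)) = g' p (nablaN X Y p) (Z p) + g' p (Y p) (nablaN X Z p)"
  using lcN unfolding levi_civita_def affine_connection_def by (elim conjE; meson)+

lemma nablaF_section: "vf X \<Longrightarrow> sec s \<Longrightarrow> sec (nablaF X s)"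
  and nablaF_add: "vf X \<Longrightarrow> sec s \<Longrightarrow> sec s' \<Longrightarrow> nablaF X (s + s') = nablaF X s + nablaF X s'"
  and nablaF_scale: "smooth_fun A f \<Longrightarrow> vf X \<Longrightarrow> sec s \<Longrightarrow>
    nablaF X (\<lambda>p. f p *\<^sub>R s p) = (\<lambda>p. X p f *\<^sub>R s p + f p *\<^sub>R nablaF X s p)"
  and nablaF_comp: "vf X \<Longrightarrow> vfN W \<Longrightarrow> vfN Z \<Longrightarrow> Z (F p) = push (X p) \<Longrightarrow>
    nablaF X (W \<circ> F) p = nablaN Z W (F p)"
  using pullback unfolding pullback_connection_def by (elim conjE; meson)+

lemma sec_tangent: "sec s \<Longrightarrow> s p \<in> N.T (F p)"
  and sec_smooth: "sec s \<Longrightarrow> smooth_fun B h \<Longrightarrow> smooth_fun A (\<lambda>p. s p h)"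
  by (auto simp: section_along_def)

lemma sec_push: "vf Y \<Longrightarrow> sec (push_field B F Y)"
  unfolding section_along_def push_field_def
  using push_tangent M.vector_field_tangent M.vector_field_smooth[OF _ smooth_fun_comp_F]
  by (simp add: pushforward_apply)

lemma sec_comp: "vfN W \<Longrightarrow> sec (W \<circ> F)"
  unfolding section_along_def
  using N.vector_field_tangent smooth_fun_comp_F[OF N.vector_field_smooth] by simp

lemma sec_add: "sec s \<Longrightarrow> sec t \<Longrightarrow> sec (s + t)"
  unfolding section_along_def by (simp add: N.T_add M.smooth_fun_add)

lemma sec_scale: "smooth_fun A f \<Longrightarrow> sec s \<Longrightarrow> sec (\<lambda>p. f p *\<^sub>R s p)"
  unfolding section_along_def by (simp add: N.T_scale M.smooth_fun_mult scaleR_fun_apply)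

lemma sec_zero: "sec (\<lambda>p. 0)"
  unfolding section_along_def by (simp add: M.smooth_fun_const)

lemma nabla_zero: "vf X \<Longrightarrow> nabla X (\<lambda>p. 0) = (\<lambda>p. 0)"
  using nabla_scale[OF M.smooth_fun_const[of 0], of X X]
  by (simp add: M.tangent_const[OF M.vector_field_tangent])

lemma nablaF_zero:
  assumes "vf X"
  shows "nablaF X (\<lambda>p. 0) = (\<lambda>p. 0)"
  using nablaF_scale[OF M.smooth_fun_const[of 0] assms sec_zero]
  by (simp add: M.tangent_const[OF M.vector_field_tangent[OF assms]])

text \<open>Multiplication of both sections by a cut-off function makes them equal; the product rule recovers the
  values at \<open>p\<close>.\<close>

lemma nablaF_local:
  assumes X: "vf X" and s: "sec s" "sec t" and \<Omega>: "open \<Omega>" "p \<in> \<Omega>" "\<And>q. q \<in> \<Omega> \<Longrightarrow> s q = t q"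
  shows "nablaF X s p = nablaF X t p"
proof -
  obtain b \<Omega>' where "M.cutoff_fun \<Omega> p b \<Omega>'" using M.exists_cutoff[OF \<Omega>(1,2)] by blast
  note b = M.cutoff_funD[OF this]
  have "(\<lambda>q. b q *\<^sub>R s q) = (\<lambda>q. b q *\<^sub>R t q)"
  proof
    fix q show "b q *\<^sub>R s q = b q *\<^sub>R t q" using \<Omega>(3) b(6) by (cases "q \<in> \<Omega>") auto
  qed
  then have "nablaF X (\<lambda>q. b q *\<^sub>R s q) p = nablaF X (\<lambda>q. b q *\<^sub>R t q) p" by (simp only:)
  then show ?thesis
    unfolding nablaF_scale[OF b(1) X s(1)] nablaF_scale[OF b(1) X s(2)]
    using b(3,5) \<Omega>(2,3) by simp
qed

lemma sec_frame_expand: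
  assumes "N.coordinate_frame \<Omega> y E" "F q \<in> \<Omega>" "sec s"
  shows "s q = (\<Sum>j\<in>Basis. s q (y j) *\<^sub>R E j (F q))"
  by (rule N.frame_expand[OF assms(1,2) sec_tangent[OF assms(3)]])

lemma sec_frame_sum:
  assumes "\<And>j. j \<in> I \<Longrightarrow> smooth_fun A (f j)" "\<And>j. j \<in> I \<Longrightarrow> vfN (W j)"
  shows "sec (\<lambda>q. \<Sum>j\<in>I. f j q *\<^sub>R W j (F q))"
  using assms
proof (induction I rule: infinite_finite_induct)
  case (insert j I)
  have "sec ((\<lambda>q. f j q *\<^sub>R (W j \<circ> F) q) + (\<lambda>q. \<Sum>j\<in>I. f j q *\<^sub>R W j (F q)))"
    by (rule sec_add[OF sec_scale[OF _ sec_comp]]) (use insert in auto)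
  then show ?case using insert.hyps by (simp add: plus_fun_def)
qed (simp_all add: sec_zero)

lemma nablaF_frame_sum_zero:
  assumes "\<And>j. j \<in> I \<Longrightarrow> smooth_fun A (f j)" "\<And>j. j \<in> I \<Longrightarrow> f j p = 0" "\<And>j. j \<in> I \<Longrightarrow> vfN (W j)" and X: "vf X"
  shows "nablaF X (\<lambda>q. \<Sum>j\<in>I. f j q *\<^sub>R W j (F q)) p = (\<Sum>j\<in>I. X p (f j) *\<^sub>R W j (F p))"
  using assms(1-3)
proof (induction I rule: infinite_finite_induct)
  case (insert j I)
  have s: "sec (\<lambda>q. f j q *\<^sub>R (W j \<circ> F) q)" "sec (\<lambda>q. \<Sum>j\<in>I. f j q *\<^sub>R W j (F q))"
    by (rule sec_scale[OF _ sec_comp], use insert in auto) (rule sec_frame_sum, use insert in auto)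
  have "nablaF X (\<lambda>q. \<Sum>j\<in>insert j I. f j q *\<^sub>R W j (F q)) p =
    nablaF X ((\<lambda>q. f j q *\<^sub>R (W j \<circ> F) q) + (\<lambda>q. \<Sum>j\<in>I. f j q *\<^sub>R W j (F q))) p"
    using insert.hyps by (simp add: plus_fun_def)
  also have "\<dots> = nablaF X (\<lambda>q. f j q *\<^sub>R (W j \<circ> F) q) p + nablaF X (\<lambda>q. \<Sum>j\<in>I. f j q *\<^sub>R W j (F q)) p"
    by (simp only: nablaF_add[OF X s] plus_fun_apply)
  also have "nablaF X (\<lambda>q. f j q *\<^sub>R (W j \<circ> F) q) p = X p (f j) *\<^sub>R W j (F p)"
    using insert.prems by (simp only: nablaF_scale[OF _ X sec_comp] insertI1) (simp)
  finally show ?case using insert by simp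
qed (simp_all add: nablaF_zero[OF X])

text \<open>Freezing the coefficients of \<open>s\<close> at \<open>p\<close> gives a section \<open>W \<circ> F\<close>; the remainder vanishes at
  \<open>p\<close>, so only the derivatives of its coefficients contribute.\<close>

lemma nablaF_frame:
  assumes fr: "N.coordinate_frame \<Omega> y E" "F p \<in> \<Omega>" and X: "vf X" and s: "sec s"
    and Z: "vfN Z" "Z (F p) = push (X p)"
  shows "nablaF X s p = nablaN Z (\<lambda>r. \<Sum>j\<in>Basis. s p (y j) *\<^sub>R E j r) (F p)
    + (\<Sum>j\<in>Basis. X p (\<lambda>q. s q (y j)) *\<^sub>R E j (F p))"
proof -
  let ?W = "\<lambda>r. \<Sum>j\<in>Basis. s p (y j) *\<^sub>R E j r"
  let ?f = "\<lambda>j q. s q (y j) - s p (y j)"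
  let ?R = "\<lambda>q. \<Sum>j\<in>Basis. ?f j q *\<^sub>R E j (F q)"
  have sy: "smooth_fun A (\<lambda>q. s q (y j))" if "j \<in> Basis" for j
    by (rule sec_smooth[OF s N.frame_smooth[OF fr(1) that]])
  have W: "vfN ?W"
    by (rule N.vector_field_sum, rule N.vector_field_scale[OF N.smooth_fun_const N.frame_field[OF fr(1)]])
  have f: "smooth_fun A (?f j)" if "j \<in> Basis" for j
    by (rule M.smooth_fun_diff[OF sy[OF that] M.smooth_fun_const])
  have R: "sec ?R" by (rule sec_frame_sum[OF f N.frame_field[OF fr(1)]])
  have "nablaF X s p = nablaF X ((?W \<circ> F) + ?R) p"
  proof (rule nablaF_local[OF X s sec_add[OF sec_comp[OF W] R] open_preimage_F[OF N.frame_open[OF fr(1)]]])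
    show "p \<in> F -` \<Omega>" using fr(2) by simp
    fix q assume "q \<in> F -` \<Omega>"
    then have "s q = (\<Sum>j\<in>Basis. s q (y j) *\<^sub>R E j (F q))"
      by (intro sec_frame_expand[OF fr(1) _ s]) simp
    then show "s q = ((?W \<circ> F) + ?R) q"
      by (simp add: sum.distrib[symmetric] scaleR_add_left[symmetric])
  qed
  also have "\<dots> = nablaF X (?W \<circ> F) p + nablaF X ?R p"
    by (simp only: nablaF_add[OF X sec_comp[OF W] R] plus_fun_apply)
  also have "nablaF X (?W \<circ> F) p = nablaN Z ?W (F p)"
    by (rule nablaF_comp[OF X W Z])
  also have "nablaF X ?R p = (\<Sum>j\<in>Basis. X p (?f j) *\<^sub>R E j (F p))"
    by (rule nablaF_frame_sum_zero[OF f _ N.frame_field[OF fr(1)] X]) simp_all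
  also have "\<dots> = (\<Sum>j\<in>Basis. X p (\<lambda>q. s q (y j)) *\<^sub>R E j (F p))"
    by (rule sum.cong[OF refl])
      (simp add: M.tangent_diff[OF M.vector_field_tangent[OF X] sy M.smooth_fun_const]
        M.tangent_const[OF M.vector_field_tangent[OF X]])
  finally show ?thesis .
qed

text \<open>Extend the vectors \<open>F\<^sub>* X\<^sub>p\<close> and \<open>F\<^sub>* Y\<^sub>p\<close> to fields on \<open>N\<close> with constant coefficients in a coordinate
  frame. They commute, so the terms with \<open>nablaN\<close> in \<open>nablaF_frame\<close> cancel.\<close>

lemma nablaF_torsion:
  assumes X: "vf X" and Y: "vf Y"
  shows "nablaF X (push_field B F Y) p - nablaF Y (push_field B F X) p = push (lie_bracket X Y p)"
proof -
  obtain \<Omega> y E where fr: "F p \<in> \<Omega>" "N.coordinate_frame \<Omega> y E" using N.exists_coordinate_frame by blast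
  note sy = N.frame_smooth[OF fr(2)]
  define Z where "Z = (\<lambda>X r. \<Sum>j\<in>Basis. push_field B F X p (y j) *\<^sub>R E j r)"
  have Z: "vfN (Z X)" "Z X (F p) = push (X p)" if "vf X" for X
    unfolding Z_def
    by (rule N.vector_field_sum, rule N.vector_field_scale[OF N.smooth_fun_const N.frame_field[OF fr(2)]], assumption)
      (use sec_frame_expand[OF fr(2,1) sec_push[OF that]] in \<open>simp add: push_field_def\<close>)
  have Zc: "Z X r (y k) = push_field B F X p (y k)" if "r \<in> \<Omega>" "k \<in> Basis" for X r k
  proof -
    have "Z X r (y k) = (\<Sum>j\<in>Basis. push_field B F X p (y j) * (if j = k then 1 else 0))"
      unfolding Z_def sum_fun_apply scaleR_fun_apply real_scaleR_def
      by (rule sum.cong[OF refl]) (simp only: N.frame_dual[OF fr(2) that(1) _ that(2)])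
    then show ?thesis by (simp only: sum_kronecker[OF finite_Basis that(2)])
  qed
  have "lie_bracket (Z X) (Z Y) (F p) = 0"
    by (rule N.lie_bracket_constant_coefficients[OF fr(2) Z(1)[OF X] Zc Z(1)[OF Y] Zc fr(1)])
  then have T: "nablaN (Z X) (Z Y) (F p) = nablaN (Z Y) (Z X) (F p)"
    using fun_cong[OF nablaN_torsion[OF Z(1)[OF X] Z(1)[OF Y]], of "F p"] by simp
  have pf: "push_field B F X q (y j) = X q (\<lambda>r. y j (F r))" if "j \<in> Basis" for X q j
    by (simp add: push_field_def pushforward_apply[OF sy[OF that]])
  have eq: "nablaF X (push_field B F Y) p = nablaN (Z X) (Z Y) (F p) + (\<Sum>j\<in>Basis. X p (\<lambda>q. Y q (\<lambda>r. y j (F r))) *\<^sub>R E j (F p))"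
    if "vf X" "vf Y" for X Y
    using nablaF_frame[OF fr(2,1) that(1) sec_push[OF that(2)] Z[OF that(1)]] pf by (simp add: Z_def cong: sum.cong)
  have "push (lie_bracket X Y p) = (\<Sum>j\<in>Basis. push (lie_bracket X Y p) (y j) *\<^sub>R E j (F p))"
    by (rule N.frame_expand[OF fr(2,1) push_tangent[OF M.vector_field_tangent[OF M.vector_field_lie_bracket[OF X Y]]]])
  also have "\<dots> = (\<Sum>j\<in>Basis. X p (\<lambda>q. Y q (\<lambda>r. y j (F r))) *\<^sub>R E j (F p)) - (\<Sum>j\<in>Basis. Y p (\<lambda>q. X q (\<lambda>r. y j (F r))) *\<^sub>R E j (F p))"
    unfolding sum_subtractf[symmetric] scaleR_diff_left[symmetric]
    by (rule sum.cong[OF refl]) (simp add: pushforward_apply[OF sy] lie_bracket_def)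
  finally show ?thesis unfolding eq[OF X Y] eq[OF Y X] T by simp
qed

lemma sec_metric_smooth:
  assumes s: "sec s" and t: "sec t"
  shows "smooth_fun A (\<lambda>q. g' (F q) (s q) (t q))"
proof (rule M.smooth_fun_local)
  fix p
  obtain \<Omega> y E where fr: "F p \<in> \<Omega>" "N.coordinate_frame \<Omega> y E" using N.exists_coordinate_frame by blast
  have sy: "smooth_fun A (\<lambda>q. s q (y j))" if "j \<in> Basis" "sec s" for j s
    by (rule sec_smooth[OF that(2) N.frame_smooth[OF fr(2) that(1)]])
  note vE = N.frame_field[OF fr(2)]
  note tE = N.vector_field_tangent[OF vE]
  let ?h = "\<lambda>q. \<Sum>i\<in>Basis. s q (y i) * (\<Sum>j\<in>Basis. t q (y j) * g' (F q) (E j (F q)) (E i (F q)))"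
  have "smooth_fun A ?h"
    by (rule M.smooth_fun_sum, rule M.smooth_fun_mult[OF sy[OF _ s]], assumption,
        rule M.smooth_fun_sum, rule M.smooth_fun_mult[OF sy[OF _ t]], assumption,
        rule smooth_fun_comp_F[OF N.g_smooth[OF vE vE]])
  moreover have "g' (F q) (s q) (t q) = ?h q" if "q \<in> F -` \<Omega>" for q
  proof -
    have q: "F q \<in> \<Omega>" using that by simp
    have 1: "g' (F q) (t q) w = (\<Sum>j\<in>Basis. t q (y j) * g' (F q) (E j (F q)) w)" if "w \<in> N.T (F q)" for w
      by (subst sec_frame_expand[OF fr(2) q t], rule N.g_sum_left[OF tE that])
    have "g' (F q) (s q) (t q) = (\<Sum>i\<in>Basis. s q (y i) * g' (F q) (E i (F q)) (t q))"
      by (subst sec_frame_expand[OF fr(2) q s], rule N.g_sum_left[OF tE sec_tangent[OF t]])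
    also have "\<dots> = ?h q"
      by (rule sum.cong[OF refl]) (simp add: N.g_sym[OF tE sec_tangent[OF t]] 1 tE)
    finally show ?thesis .
  qed
  moreover have "open (F -` \<Omega>)" "p \<in> F -` \<Omega>"
    using open_preimage_F[OF N.frame_open[OF fr(2)]] fr(1) by auto
  ultimately show "\<exists>\<Omega> h. open \<Omega> \<and> p \<in> \<Omega> \<and> smooth_fun A h \<and> (\<forall>x\<in>\<Omega>. g' (F x) (s x) (t x) = h x)"
    by (intro exI[of _ "F -` \<Omega>"] exI[of _ ?h]) simp
qed

text \<open>Compatibility of the pullback connection with the metric at \<open>p\<close>, for a single pair of sections. It holds
  for fields of the form \<open>W \<circ> F\<close> by the compatibility of \<open>nablaN\<close> and extends to all sections by linearity
  over functions, in one argument at a time.\<close>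

definition metric_at :: "('m \<Rightarrow> 'm tvec) \<Rightarrow> 'm \<Rightarrow> ('m \<Rightarrow> 'n tvec) \<Rightarrow> ('m \<Rightarrow> 'n tvec) \<Rightarrow> bool" where
  "metric_at X p s t \<longleftrightarrow> X p (\<lambda>q. g' (F q) (s q) (t q)) =
     g' (F p) (nablaF X s p) (t p) + g' (F p) (s p) (nablaF X t p)"

lemma metric_at_frame_sum:
  assumes X: "vf X" and t: "sec t"
    and I: "\<And>j. j \<in> I \<Longrightarrow> smooth_fun A (f j)" "\<And>j. j \<in> I \<Longrightarrow> vfN (W j)" "\<And>j. j \<in> I \<Longrightarrow> metric_at X p (W j \<circ> F) t"
  shows "metric_at X p (\<lambda>q. \<Sum>j\<in>I. f j q *\<^sub>R W j (F q)) t"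
  using I
proof (induction I rule: infinite_finite_induct)
  case (insert j I)
  note tX = M.vector_field_tangent[OF X] and tt = sec_tangent[OF t] and tn = sec_tangent[OF nablaF_section[OF X]]
  let ?a = "W j \<circ> F" and ?r = "\<lambda>q. \<Sum>j\<in>I. f j q *\<^sub>R W j (F q)"
  let ?s = "\<lambda>q. f j q *\<^sub>R ?a q"
  have a: "sec ?a" and f: "smooth_fun A (f j)"
    using insert.prems(1,2)[OF insertI1] sec_comp by simp_all
  have ma: "metric_at X p ?a t" by (rule insert.prems(3)[OF insertI1])
  have s: "sec ?s" by (rule sec_scale[OF f a])
  have r: "sec ?r" by (rule sec_frame_sum) (use insert.prems in auto)
  have mr: "metric_at X p ?r t" using insert by blast
  have "X p (\<lambda>q. g' (F q) (?s q) (t q)) = X p (\<lambda>q. f j q * g' (F q) (?a q) (t q))"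
    using N.g_scale_left[OF sec_tangent[OF a] tt] by simp
  also have "\<dots> = X p (f j) * g' (F p) (?a p) (t p) + f j p * (g' (F p) (nablaF X ?a p) (t p) + g' (F p) (?a p) (nablaF X t p))"
    using M.tangent_mult[OF tX f sec_metric_smooth[OF a t]] ma by (simp add: metric_at_def)
  also have "\<dots> = g' (F p) (nablaF X ?s p) (t p) + g' (F p) (?s p) (nablaF X t p)"
    unfolding nablaF_scale[OF f X a]
    using sec_tangent[OF a] tt tn[OF a] tn[OF t]
    by (simp only: N.g_add_left N.g_scale_left N.T_scale) (simp add: algebra_simps)
  finally have ms: "X p (\<lambda>q. g' (F q) (?s q) (t q)) = g' (F p) (nablaF X ?s p) (t p) + g' (F p) (?s p) (nablaF X t p)" .
  have add: "X p (\<lambda>q. g' (F q) ((?s + ?r) q) (t q)) = X p (\<lambda>q. g' (F q) (?s q) (t q)) + X p (\<lambda>q. g' (F q) (?r q) (t q))"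
    unfolding plus_fun_apply N.g_add_left[OF sec_tangent[OF s] sec_tangent[OF r] tt]
    by (rule M.tangent_add[OF tX sec_metric_smooth[OF s t] sec_metric_smooth[OF r t]])
  have "metric_at X p (?s + ?r) t"
    unfolding metric_at_def add ms mr[unfolded metric_at_def]
    unfolding nablaF_add[OF X s r] plus_fun_apply N.g_add_left[OF sec_tangent[OF s] sec_tangent[OF r] tn[OF t]]
      N.g_add_left[OF tn[OF s] tn[OF r] tt]
    by simp
  then show ?case using insert.hyps by (simp add: plus_fun_def)
qed (simp_all add: metric_at_def nablaF_zero[OF X] M.tangent_const[OF M.vector_field_tangent[OF X]]
    N.g_zero_left[OF sec_tangent[OF t]] N.g_zero_left[OF sec_tangent[OF nablaF_section[OF X t]]])

lemma metric_at_sym: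
  assumes "vf X" "sec s" "sec t" "metric_at X p s t"
  shows "metric_at X p t s"
proof -
  have "(\<lambda>q. g' (F q) (t q) (s q)) = (\<lambda>q. g' (F q) (s q) (t q))"
    using N.g_sym[OF sec_tangent[OF assms(3)] sec_tangent[OF assms(2)]] by auto
  then show ?thesis
    using assms(4) N.g_sym[OF sec_tangent[OF assms(3)] sec_tangent[OF nablaF_section[OF assms(1,2)]]]
      N.g_sym[OF sec_tangent[OF nablaF_section[OF assms(1,3)]] sec_tangent[OF assms(2)]]
    by (simp add: metric_at_def)
qed

lemma metric_at_local:
  assumes X: "vf X" and s: "sec s" "sec s'" and t: "sec t" and m: "metric_at X p s' t"
    and \<Omega>: "open \<Omega>" "p \<in> \<Omega>" "\<And>q. q \<in> \<Omega> \<Longrightarrow> s q = s' q"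
  shows "metric_at X p s t"
proof -
  have "X p (\<lambda>q. g' (F q) (s q) (t q)) = X p (\<lambda>q. g' (F q) (s' q) (t q))"
    by (rule M.tangent_local[OF M.vector_field_tangent[OF X] \<Omega>(1,2) _ sec_metric_smooth[OF s(1) t] sec_metric_smooth[OF s(2) t]])
      (simp add: \<Omega>(3))
  then show ?thesis using m nablaF_local[OF X s \<Omega>] \<Omega>(2,3) by (simp add: metric_at_def)
qed

lemma nablaF_metric:
  assumes X: "vf X" and s: "sec s" and t: "sec t"
  shows "X p (\<lambda>q. g' (F q) (s q) (t q)) = g' (F p) (nablaF X s p) (t p) + g' (F p) (s p) (nablaF X t p)"
proof -
  obtain \<Omega> y E where fr: "F p \<in> \<Omega>" "N.coordinate_frame \<Omega> y E" using N.exists_coordinate_frame by blast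
  note vE = N.frame_field[OF fr(2)]
  have \<Omega>: "open (F -` \<Omega>)" "p \<in> F -` \<Omega>"
    using open_preimage_F[OF N.frame_open[OF fr(2)]] fr(1) by auto
  obtain Z where Z: "vfN Z" "Z (F p) = push (X p)"
    using N.tangent_vector_extends[OF push_tangent[OF M.vector_field_tangent[OF X]]] by blast
  have base: "metric_at X p (W \<circ> F) (W' \<circ> F)" if W: "vfN W" "vfN W'" for W W'
  proof -
    have "X p (\<lambda>q. g' (F q) (W (F q)) (W' (F q))) = push (X p) (\<lambda>r. g' r (W r) (W' r))"
      using pushforward_apply[OF N.g_smooth[OF W]] by metis
    also have "\<dots> = g' (F p) (nablaN Z W (F p)) (W' (F p)) + g' (F p) (W (F p)) (nablaN Z W' (F p))"
      unfolding Z(2)[symmetric] by (rule nablaN_metric[OF Z(1) W])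
    finally show ?thesis
      by (simp add: metric_at_def nablaF_comp[OF X W(1) Z] nablaF_comp[OF X W(2) Z])
  qed
  have step: "metric_at X p u t" if t: "sec t" and u: "sec u" and "\<And>j. j \<in> Basis \<Longrightarrow> metric_at X p (E j \<circ> F) t" for t u
  proof (rule metric_at_local[OF X u _ t _ \<Omega>])
    let ?s = "\<lambda>q. \<Sum>j\<in>Basis. u q (y j) *\<^sub>R E j (F q)"
    show "sec ?s" by (rule sec_frame_sum[OF sec_smooth[OF u N.frame_smooth[OF fr(2)]] vE])
    show "metric_at X p ?s t"
      by (rule metric_at_frame_sum[OF X t sec_smooth[OF u N.frame_smooth[OF fr(2)]] vE that(3)])
    show "u q = ?s q" if "q \<in> F -` \<Omega>" for q using sec_frame_expand[OF fr(2) _ u] that by simp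
  qed
  have "metric_at X p t (E j \<circ> F)" if "j \<in> Basis" for j
    by (rule step[OF sec_comp[OF vE[OF that]] t base[OF vE vE[OF that]]])
  then have "metric_at X p (E j \<circ> F) t" if "j \<in> Basis" for j
    using metric_at_sym[OF X t sec_comp[OF vE[OF that]]] that by blast
  then have "metric_at X p s t" by (rule step[OF t s])
  then show ?thesis by (simp add: metric_at_def)
qed

lemma Koszul:
  assumes "vf X" "vf Y" "vf Z"
  shows "2 * g p (nabla X Y p) (Z p) = X p (\<lambda>q. g q (Y q) (Z q)) + Y p (\<lambda>q. g q (X q) (Z q)) - Z p (\<lambda>q. g q (X q) (Y q))
    + g p (lie_bracket X Y p) (Z p) - g p (lie_bracket X Z p) (Y p) - g p (lie_bracket Y Z p) (X p)"
proof -
  note t = M.vector_field_tangent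
  have tor: "g p (nabla X Y p) (Z p) - g p (nabla Y X p) (Z p) = g p (lie_bracket X Y p) (Z p)" if "vf X" "vf Y" "vf Z" for X Y Z
    using M.g_diff_left[OF t[OF nabla_field[OF that(1,2)]] t[OF nabla_field[OF that(2,1)]] t[OF that(3)], symmetric]
      fun_cong[OF nabla_torsion[OF that(1,2)], of p] by simp
  have sym: "g p (X p) (nabla Y Z p) = g p (nabla Y Z p) (X p)" if "vf X" "vf Y" "vf Z" for X Y Z
    by (rule M.g_sym[OF t[OF that(1)] t[OF nabla_field[OF that(2,3)]]])
  show ?thesis
  proof (rule Koszul_algebra)
    show "X p (\<lambda>q. g q (Y q) (Z q)) = g p (nabla X Y p) (Z p) + g p (nabla X Z p) (Y p)"
      using nabla_metric[OF assms] sym assms by simp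
    show "Y p (\<lambda>q. g q (X q) (Z q)) = g p (nabla Y X p) (Z p) + g p (nabla Y Z p) (X p)"
      using nabla_metric[OF assms(2,1,3)] sym assms by simp
    show "Z p (\<lambda>q. g q (X q) (Y q)) = g p (nabla Z X p) (Y p) + g p (nabla Z Y p) (X p)"
      using nabla_metric[OF assms(3,1,2)] sym assms by simp
  qed (use tor assms in auto)
qed

lemma Koszul_along:
  assumes "vf X" "vf Y" "vf Z"
  defines "G \<equiv> \<lambda>u v q. g' (F q) (push (u q)) (push (v q))"
  shows "2 * g' (F p) (nablaF X (push_field B F Y) p) (push (Z p)) = X p (G Y Z) + Y p (G X Z) - Z p (G X Y)
    + g' (F p) (push (lie_bracket X Y p)) (push (Z p)) - g' (F p) (push (lie_bracket X Z p)) (push (Y p))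
    - g' (F p) (push (lie_bracket Y Z p)) (push (X p))"
proof -
  let ?P = "push_field B F"
  note t = push_tangent[OF M.vector_field_tangent]
  note tn = sec_tangent[OF nablaF_section[OF _ sec_push]]
  have tor: "g' (F p) (nablaF X (?P Y) p) (push (Z p)) - g' (F p) (nablaF Y (?P X) p) (push (Z p)) = g' (F p) (push (lie_bracket X Y p)) (push (Z p))"
    if "vf X" "vf Y" "vf Z" for X Y Z
    using N.g_diff_left[OF tn[OF that(1,2)] tn[OF that(2,1)] t[OF that(3)], symmetric]
      nablaF_torsion[OF that(1,2), of p] by simp
  have met: "X p (G Y Z) = g' (F p) (nablaF X (?P Y) p) (push (Z p)) + g' (F p) (nablaF X (?P Z) p) (push (Y p))"
    if "vf X" "vf Y" "vf Z" for X Y Z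
    using nablaF_metric[OF that(1) sec_push[OF that(2)] sec_push[OF that(3)], of p] N.g_sym[OF t[OF that(2)] tn[OF that(1,3)]]
    by (simp add: push_field_def G_def)
  show ?thesis
    by (rule Koszul_algebra[OF met met met]) (use tor assms in auto)
qed

text \<open>One horizontal argument suffices, since vertical parts are orthogonal to it and are mapped to \<open>0\<close>.\<close>

lemma conformal_eq_tangent:
  assumes "u \<in> M.T p" "v \<in> Hor p"
  shows "g' (F p) (push u) (push v) = (lam p)\<^sup>2 * g p u v"
    and "g' (F p) (push v) (push u) = (lam p)\<^sup>2 * g p v u"
proof -
  let ?h = "orth_proj g p (Hor p) u" and ?v = "orth_proj g p (Ver p) u"
  note d = decomposition[OF assms(1)]
  have "push u = push ?h" using d(2,3) pushforward_add[of B F ?v ?h] by (simp add: Ver_iff)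
  moreover have "g p u v = g p ?h v"
    using M.g_add_left[of ?v p ?h v] d Ver_Hor_orthogonal[OF d(2) assms(2)] Ver_tangent Hor_tangent assms(2) by simp
  ultimately show *: "g' (F p) (push u) (push v) = (lam p)\<^sup>2 * g p u v"
    using conformal_eq[OF d(1) assms(2)] by simp
  show "g' (F p) (push v) (push u) = (lam p)\<^sup>2 * g p v u"
    using * N.g_sym[OF push_tangent push_tangent] M.g_sym assms Hor_tangent by metis
qed

lemma smooth_ln_lam: "smooth_fun A (\<lambda>q. ln (lam q))"
  by (rule M.smooth_fun_compose[OF smooth_lam smooth_on_ln]) (simp add: lam_pos)

lemma derivative_lam_squared:
  assumes "v \<in> M.T p"
  shows "v (\<lambda>q. (lam q)\<^sup>2) = 2 * (lam p)\<^sup>2 * v (\<lambda>q. ln (lam q))"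
proof -
  have "v (\<lambda>q. ln (lam q)) = inverse (lam p) * v lam"
    by (rule M.tangent_chain_rule[OF assms smooth_lam smooth_on_ln])
      (use lam_pos DERIV_ln in \<open>auto\<close>)
  moreover have "v (\<lambda>q. (lam q)\<^sup>2) = 2 * lam p * v lam"
    using M.tangent_mult[OF assms smooth_lam smooth_lam] by (simp add: power2_eq_square)
  ultimately show ?thesis using lam_pos[of p] by (simp add: power2_eq_square field_simps)
qed

text \<open>The vertical part of the gradient is orthogonal to \<open>v\<close>.\<close>

lemma hgrad_ln_lam:
  assumes "v \<in> Hor p"
  shows "g p (hpart (gradient A g (\<lambda>q. ln (lam q))) p) v = v (\<lambda>q. ln (lam q))"
proof -
  let ?G = "gradient A g (\<lambda>q. ln (lam q))"
  note v = M.gradient_field[OF smooth_ln_lam]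
  have "g p (?G p) v = g p (vpart ?G p) v + g p (hpart ?G p) v"
    using M.g_add_left[OF Ver_tangent[OF vpart_Ver[OF v]] Hor_tangent[OF hpart_Hor[OF v]] Hor_tangent[OF assms]]
      hpart_vpart[OF v, of p] by simp
  then show ?thesis
    using M.g_gradient[OF Hor_tangent[OF assms]] Ver_Hor_orthogonal[OF vpart_Ver[OF v] assms] by simp
qed

text \<open>The second fundamental form of a conformal submersion on horizontal fields, obtained by
  comparing the Koszul formulas upstairs and along \<open>F\<close>.\<close>

lemma second_fundamental_form:
  assumes X: "section_of A Hor X" and Y: "section_of A Hor Y" and Z: "section_of A Hor Z"
  defines "H \<equiv> hpart (gradient A g (\<lambda>q. ln (lam q)))"
  shows "1 / (lam p)\<^sup>2 * g' (F p) (nablaF X (push_field B F Y) p) (push (Z p)) =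
    g p (nabla X Y p) (Z p) + g p (H p) (X p) * g p (Y p) (Z p) + g p (H p) (Y p) * g p (X p) (Z p)
    - g p (H p) (Z p) * g p (X p) (Y p)"
proof -
  have vX: "vf X" and vY: "vf Y" and vZ: "vf Z" and hX: "\<And>q. X q \<in> Hor q" and hY: "\<And>q. Y q \<in> Hor q" and hZ: "\<And>q. Z q \<in> Hor q"
    using X Y Z by (auto simp: section_of_def)
  note t = M.vector_field_tangent
  have sl: "smooth_fun A (\<lambda>q. (lam q)\<^sup>2)"
    using M.smooth_fun_mult[OF smooth_lam smooth_lam] by (simp add: power2_eq_square)
  \<comment> \<open>Derivatives of the metric along \<open>F\<close>; the factor \<open>\<lambda>\<^sup>2\<close> contributes the logarithmic terms.\<close>
  have D: "U p (\<lambda>q. g' (F q) (push (V q)) (push (W q))) =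
     2 * (lam p)\<^sup>2 * g p (H p) (U p) * g p (V p) (W p) + (lam p)\<^sup>2 * U p (\<lambda>q. g q (V q) (W q))"
    if "vf U" "U p \<in> Hor p" "vf V" "\<And>q. V q \<in> Hor q" "vf W" "\<And>q. W q \<in> Hor q" for U V W
  proof -
    have "U p (\<lambda>q. g' (F q) (push (V q)) (push (W q))) = U p (\<lambda>q. (lam q)\<^sup>2 * g q (V q) (W q))"
      using conformal_eq[OF that(4,6)] by simp
    also have "\<dots> = U p (\<lambda>q. (lam q)\<^sup>2) * g p (V p) (W p) + (lam p)\<^sup>2 * U p (\<lambda>q. g q (V q) (W q))"
      by (rule M.tangent_mult[OF t[OF that(1)] sl M.g_smooth[OF that(3,5)]])
    finally show ?thesis
      unfolding derivative_lam_squared[OF t[OF that(1)]] H_def hgrad_ln_lam[OF that(2)] by simp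
  qed
  have br: "g' (F p) (push (lie_bracket U V p)) (push w) = (lam p)\<^sup>2 * g p (lie_bracket U V p) w"
    if "vf U" "vf V" "w \<in> Hor p" for U V w
    by (rule conformal_eq_tangent(1)[OF t[OF M.vector_field_lie_bracket[OF that(1,2)]] that(3)])
  have "2 * g' (F p) (nablaF X (push_field B F Y) p) (push (Z p)) =
    (lam p)\<^sup>2 * (2 * g p (nabla X Y p) (Z p)) + 2 * (lam p)\<^sup>2 * (g p (H p) (X p) * g p (Y p) (Z p)
      + g p (H p) (Y p) * g p (X p) (Z p) - g p (H p) (Z p) * g p (X p) (Y p))"
    unfolding Koszul_along[OF vX vY vZ] Koszul[OF vX vY vZ]
      D[OF vX hX vY hY vZ hZ] D[OF vY hY vX hX vZ hZ] D[OF vZ hZ vX hX vY hY]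
      br[OF vX vY hZ] br[OF vX vZ hY] br[OF vY vZ hX]
    by (simp add: algebra_simps)
  also have "\<dots> = 2 *
    ((lam p)\<^sup>2 * (g p (nabla X Y p) (Z p) + g p (H p) (X p) * g p (Y p) (Z p)
      + g p (H p) (Y p) * g p (X p) (Z p) - g p (H p) (Z p) * g p (X p) (Y p)))"
    by (simp add: algebra_simps)
  finally show ?thesis using lam_pos[of p] by simp
qed

end


section \<open>Conformal anti-invariant submersions from Kaehler manifolds\<close>

definition (in conformal_submersion) involutive :: bool where
  "involutive \<longleftrightarrow> (\<forall>X Y. section_of A Hor X \<longrightarrow> section_of A Hor Y \<longrightarrow> (\<forall>p. lie_bracket X Y p \<in> Hor p))"

locale anti_invariant_submersion = submersion_connections A g B g' F lam nabla nablaN nablaF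
  for A :: "('m::{t2_space, second_countable_topology}, 'e::euclidean_space) atlas" and g :: "'m metric"
    and B :: "('n::{t2_space, second_countable_topology}, 'f::euclidean_space) atlas" and g' :: "'n metric"
    and F lam nabla nablaN nablaF +
  fixes J :: "'m \<Rightarrow> 'm tvec \<Rightarrow> 'm tvec"
  assumes kaehler: "kaehler_manifold A g nabla J"
    and anti_invariant: "J p ` Ver p \<subseteq> Hor p"
begin

lemma J_tangent: "u \<in> M.T p \<Longrightarrow> J p u \<in> M.T p"
  and J_field: "vf X \<Longrightarrow> vf (\<lambda>p. J p (X p))"
  and J_J: "u \<in> M.T p \<Longrightarrow> J p (J p u) = - u"
  and J_isometry: "u \<in> M.T p \<Longrightarrow> v \<in> M.T p \<Longrightarrow> g p (J p u) (J p v) = g p u v"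
  and J_parallel: "vf X \<Longrightarrow> vf Y \<Longrightarrow> nabla X (\<lambda>p. J p (Y p)) = (\<lambda>p. J p (nabla X Y p))"
  using kaehler unfolding kaehler_manifold_def tensor_field_11_def by (elim conjE; meson)+

lemma J_skew:
  assumes "u \<in> M.T p" "v \<in> M.T p"
  shows "g p (J p u) v = - g p u (J p v)"
proof -
  have "g p u (J p v) = g p (J p u) (J p (J p v))"
    using J_isometry[OF assms(1) J_tangent[OF assms(2)]] by simp
  then show ?thesis using J_J[OF assms(2)] M.g_minus_right[OF assms(2) J_tangent[OF assms(1)]] by simp
qed

lemma J_Ver: "v \<in> Ver p \<Longrightarrow> J p v \<in> Hor p"
  using anti_invariant by blast

text \<open>As \<open>J\<close> is orthogonal, \<open>J u\<close> is orthogonal to \<open>J w\<close> for vertical \<open>w\<close>; so is its vertical part, because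
  \<open>J w\<close> is horizontal.\<close>

lemma hor_proj_J_mu:
  assumes "u \<in> Hor p"
  shows "orth_proj g p (Hor p) (J p u) \<in> mu A g J B F p"
proof -
  let ?h = "orth_proj g p (Hor p) (J p u)" and ?v = "orth_proj g p (Ver p) (J p u)"
  note u = Hor_tangent[OF assms]
  note d = decomposition[OF J_tangent[OF u]]
  have "g p ?h (J p w) = 0" if w: "w \<in> Ver p" for w
  proof -
    have "g p (J p u) (J p w) = g p ?v (J p w) + g p ?h (J p w)"
      using M.g_add_left[OF Ver_tangent[OF d(2)] Hor_tangent[OF d(1)] J_tangent[OF Ver_tangent[OF w]]] d(3) by simp
    moreover have "g p (J p u) (J p w) = 0"
      using J_isometry[OF u Ver_tangent[OF w]] Hor_Ver_orthogonal[OF assms w] by simp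
    moreover have "g p ?v (J p w) = 0" by (rule Ver_Hor_orthogonal[OF d(2) J_Ver[OF w]])
    ultimately show ?thesis by simp
  qed
  then show ?thesis using d(1) by (auto simp: mu_def)
qed

text \<open>Hence \<open>J u = B u + C u\<close> is the decomposition into vertical and horizontal part.\<close>

lemma BC_part_eq:
  assumes "u \<in> Hor p"
  shows "BC_part A g J B F p u = (orth_proj g p (Ver p) (J p u), orth_proj g p (Hor p) (J p u))"
  unfolding BC_part_def
proof (rule the_equality)
  note d = decomposition[OF J_tangent[OF Hor_tangent[OF assms]]]
  show "case (orth_proj g p (Ver p) (J p u), orth_proj g p (Hor p) (J p u)) of
    (b, c) \<Rightarrow> b \<in> Ver p \<and> c \<in> mu A g J B F p \<and> J p u = b + c"
    using d hor_proj_J_mu[OF assms] by simp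
  fix x assume "case x of (b, c) \<Rightarrow> b \<in> Ver p \<and> c \<in> mu A g J B F p \<and> J p u = b + c"
  then obtain b c where x: "x = (b, c)" "b \<in> Ver p" "c \<in> Hor p" "J p u = b + c"
    by (auto simp: mu_def split: prod.splits)
  have "orth_proj g p (Ver p) (J p u) = b"
    by (rule ver_proj_eqI[OF J_tangent[OF Hor_tangent[OF assms]] x(2)]) (use x in simp)
  moreover have "orth_proj g p (Hor p) (J p u) = c"
    by (rule hor_proj_eqI[OF J_tangent[OF Hor_tangent[OF assms]] x(3)]) (use x in simp)
  ultimately show "x = (orth_proj g p (Ver p) (J p u), orth_proj g p (Hor p) (J p u))"
    using x(1) by simp
qed

context
  fixes X assumes X: "section_of A Hor X"
begin

lemma B_part_eq: "B_part A g J B F X = vpart (\<lambda>q. J q (X q))"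
  and C_part_eq: "C_part A g J B F X = hpart (\<lambda>q. J q (X q))"
  using BC_part_eq X by (auto simp: B_part_def C_part_def ver_part_def hor_part_def section_of_def)

lemma B_section: "section_of A Ver (B_part A g J B F X)"
  and C_section: "section_of A Hor (C_part A g J B F X)"
  and J_eq_B_plus_C: "(\<lambda>q. J q (X q)) = B_part A g J B F X + C_part A g J B F X"
proof -
  have J: "vf (\<lambda>q. J q (X q))" using X J_field by (simp add: section_of_def)
  show "section_of A Ver (B_part A g J B F X)" "section_of A Hor (C_part A g J B F X)"
    unfolding B_part_eq C_part_eq section_of_def
    using vpart_field[OF J] vpart_Ver[OF J] hpart_field[OF J] hpart_Hor[OF J] by blast+
  show "(\<lambda>q. J q (X q)) = B_part A g J B F X + C_part A g J B F X"
    unfolding B_part_eq C_part_eq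
  proof
    fix q show "J q (X q) = (vpart (\<lambda>q. J q (X q)) + hpart (\<lambda>q. J q (X q))) q"
      by (subst plus_fun_apply) (rule hpart_vpart[OF J])
  qed
qed

lemma g_C_part_JV:
  assumes "v \<in> Ver p"
  shows "g p (C_part A g J B F X p) (J p v) = 0"
proof -
  have "C_part A g J B F X p \<in> mu A g J B F p"
    unfolding C_part_eq hor_part_def
    using hor_proj_J_mu X by (simp add: section_of_def)
  then show ?thesis using assms by (auto simp: mu_def)
qed

lemma g_C_part:
  assumes Y: "Y \<in> Hor p"
  shows "g p (C_part A g J B F X p) Y = g p (J p (X p)) Y"
proof -
  have "g p (J p (X p)) Y = g p (B_part A g J B F X p) Y + g p (C_part A g J B F X p) Y"
    using fun_cong[OF J_eq_B_plus_C, of p] B_section C_section Y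
    by (simp add: M.g_add_left[OF Ver_tangent Hor_tangent Hor_tangent] section_of_def)
  then show ?thesis using Ver_Hor_orthogonal[OF _ Y] B_section by (simp add: section_of_def)
qed

lemma g_oneill_vertical:
  assumes V: "section_of A Ver V" and h: "h \<in> Hor p"
  shows "oneill_A A g nabla B F X V p \<in> M.T p"
    and "g p (oneill_A A g nabla B F X V p) h = g p (nabla X V p) h"
proof -
  have vX: "vf X" and vV: "vf V" using X V by (auto simp: section_of_def)
  have 1: "hpart X = X" using X hpart_eqI by (auto simp: section_of_def)
  have 2: "hpart V = (\<lambda>q. 0)" "vpart V = V"
    using V hpart_Ver vpart_eqI by (auto simp: section_of_def)
  have "vpart (\<lambda>q. 0) p = 0" by (rule vpart_Hor) (rule subspace_0[OF Hor_subspace])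
  then have eq: "oneill_A A g nabla B F X V p = hpart (nabla X V) p"
    by (simp add: oneill_A_def 1 2 nabla_zero[OF vX])
  note n = nabla_field[OF vX vV]
  show "oneill_A A g nabla B F X V p \<in> M.T p" unfolding eq by (rule Hor_tangent[OF hpart_Hor[OF n]])
  have "g p (nabla X V p) h = g p (vpart (nabla X V) p) h + g p (hpart (nabla X V) p) h"
    using M.g_add_left[OF Ver_tangent[OF vpart_Ver[OF n]] Hor_tangent[OF hpart_Hor[OF n]] Hor_tangent[OF h]]
      hpart_vpart[OF n, of p] by simp
  then show "g p (oneill_A A g nabla B F X V p) h = g p (nabla X V p) h"
    unfolding eq using Ver_Hor_orthogonal[OF vpart_Ver[OF n] h] by simp
qed

end

text \<open>Since \<open>J\<close> is parallel and orthogonal, \<open>g(\<nabla>\<^sub>X Y, V) = g(\<nabla>\<^sub>X JY, JV)\<close>; split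
  \<open>JY = BY + CY\<close> and express the second part by the second fundamental form.\<close>

lemma g_nabla_vertical:
  assumes X: "section_of A Hor X" and Y: "section_of A Hor Y" and V: "section_of A Ver V"
  defines "H \<equiv> hpart (gradient A g (\<lambda>q. ln (lam q)))"
  shows "g p (nabla X Y p) (V p) = g p (oneill_A A g nabla B F X (B_part A g J B F Y) p) (J p (V p))
    + 1 / (lam p)\<^sup>2 * g' (F p) (nablaF X (push_field B F (C_part A g J B F Y)) p) (push (J p (V p)))
    - g p (H p) (C_part A g J B F Y p) * g p (X p) (J p (V p))
    + g p (H p) (J p (V p)) * g p (X p) (C_part A g J B F Y p)"
proof -
  let ?B = "B_part A g J B F Y" and ?C = "C_part A g J B F Y"
  have vX: "vf X" and vY: "vf Y" and vV: "vf V" using X Y V by (auto simp: section_of_def)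
  note Bs = B_section[OF Y] and Cs = C_section[OF Y]
  have vB: "vf ?B" and vC: "vf ?C" using Bs Cs by (auto simp: section_of_def)
  note t = M.vector_field_tangent
  have JV: "section_of A Hor (\<lambda>q. J q (V q))"
    using V J_Ver J_field by (simp add: section_of_def)
  then have hJV: "J p (V p) \<in> Hor p" by (simp add: section_of_def)
  have "g p (nabla X Y p) (V p) = g p (J p (nabla X Y p)) (J p (V p))"
    by (rule J_isometry[OF t[OF nabla_field[OF vX vY]] t[OF vV], symmetric])
  also have "J p (nabla X Y p) = nabla X (?B + ?C) p"
    unfolding J_eq_B_plus_C[OF Y, symmetric] J_parallel[OF vX vY] ..
  also have "\<dots> = nabla X ?B p + nabla X ?C p"
    unfolding nabla_add[OF vX vB vC] by simp
  also have "g p (nabla X ?B p + nabla X ?C p) (J p (V p)) = g p (nabla X ?B p) (J p (V p)) + g p (nabla X ?C p) (J p (V p))"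
    by (rule M.g_add_left[OF t[OF nabla_field[OF vX vB]] t[OF nabla_field[OF vX vC]] Hor_tangent[OF hJV]])
  also have "g p (nabla X ?B p) (J p (V p)) = g p (oneill_A A g nabla B F X ?B p) (J p (V p))"
    by (rule g_oneill_vertical(2)[OF X Bs hJV, symmetric])
  also have "g p (nabla X ?C p) (J p (V p)) = 1 / (lam p)\<^sup>2 * g' (F p) (nablaF X (push_field B F ?C) p) (push (J p (V p)))
    - g p (H p) (?C p) * g p (X p) (J p (V p)) + g p (H p) (J p (V p)) * g p (X p) (?C p)"
    using second_fundamental_form[OF X Cs JV, of p] g_C_part_JV[OF Y, of "V p" p] V
    by (simp add: H_def section_of_def)
  finally show ?thesis by simp
qed

lemma integrability_algebra:
  fixes l :: real
  assumes "l = n1 - n2" "t = t1 - t2" "q = q2 - q1"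
    and "n1 = t1 + k * q1 - hY * xj + hj * xc" "n2 = t2 + k * q2 - hX * yj + hj * yc" "xc = - yc" "yc = cy"
  shows "l = t - hY * xj + hX * yj - 2 * cy * hj - k * q"
  unfolding assms by (simp add: algebra_simps)

text \<open>The difference of \<open>g_nabla_vertical\<close> for \<open>(X, Y)\<close> and \<open>(Y, X)\<close>. As \<open>J\<close> is skew,
  \<open>g(X, CY) = - g(CX, Y)\<close>, which produces the coefficient \<open>2\<close>.\<close>

lemma integrability_identity:
  assumes X: "section_of A Hor X" and Y: "section_of A Hor Y" and V: "section_of A Ver V"
  defines "H \<equiv> hpart (gradient A g (\<lambda>q. ln (lam q)))" and "BB \<equiv> B_part A g J B F" and "C \<equiv> C_part A g J B F"
    and "AA \<equiv> oneill_A A g nabla B F"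
  shows "g p (lie_bracket X Y p) (V p) =
    g p ((AA X (BB Y) - AA Y (BB X)) p) (J p (V p))
    - g p (H p) (C Y p) * g p (X p) (J p (V p)) + g p (H p) (C X p) * g p (Y p) (J p (V p))
    - 2 * g p (C X p) (Y p) * g p (H p) (J p (V p))
    - 1 / (lam p)\<^sup>2 * g' (F p) ((nablaF Y (push_field B F (C X)) - nablaF X (push_field B F (C Y))) p)
        (push_field B F (\<lambda>q. J q (V q)) p)"
proof -
  have vX: "vf X" and vY: "vf Y" and vV: "vf V" and hX: "X p \<in> Hor p" and hY: "Y p \<in> Hor p"
    using X Y V by (auto simp: section_of_def)
  note t = M.vector_field_tangent
  have hJV: "J p (V p) \<in> Hor p" using V J_Ver by (simp add: section_of_def)
  have vC: "vf (C X)" if "section_of A Hor X" for X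
    using C_section[OF that] by (simp add: C_def section_of_def)
  have hC: "C X p \<in> Hor p" if "section_of A Hor X" for X
    using C_section[OF that] by (simp add: C_def section_of_def)
  have "g p (X p) (C Y p) = g p (J p (Y p)) (X p)"
    using g_C_part[OF Y hX] M.g_sym[OF Hor_tangent[OF hX] Hor_tangent[OF hC[OF Y]]] by (simp add: C_def)
  also have "\<dots> = - g p (Y p) (J p (X p))" by (rule J_skew[OF Hor_tangent[OF hY] Hor_tangent[OF hX]])
  also have "\<dots> = - g p (C X p) (Y p)"
    using g_C_part[OF X hY] M.g_sym[OF Hor_tangent[OF hY] J_tangent[OF Hor_tangent[OF hX]]] by (simp add: C_def)
  finally have XCY: "g p (X p) (C Y p) = - g p (C X p) (Y p)" .
  have YCX: "g p (Y p) (C X p) = g p (C X p) (Y p)"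
    by (rule M.g_sym[OF Hor_tangent[OF hY] Hor_tangent[OF hC[OF X]]])
  show ?thesis
  proof (rule integrability_algebra)
    show "g p (lie_bracket X Y p) (V p) = g p (nabla X Y p) (V p) - g p (nabla Y X p) (V p)"
      using M.g_diff_left[OF t[OF nabla_field[OF vX vY]] t[OF nabla_field[OF vY vX]] t[OF vV], of p]
        fun_cong[OF nabla_torsion[OF vX vY], of p] by simp
    show "g p ((AA X (BB Y) - AA Y (BB X)) p) (J p (V p)) =
        g p (AA X (BB Y) p) (J p (V p)) - g p (AA Y (BB X) p) (J p (V p))"
      unfolding AA_def BB_def
      using M.g_diff_left[OF g_oneill_vertical(1)[OF X B_section[OF Y] hJV] g_oneill_vertical(1)[OF Y B_section[OF X] hJV] Hor_tangent[OF hJV]]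
      by simp
    show "g' (F p) ((nablaF Y (push_field B F (C X)) - nablaF X (push_field B F (C Y))) p) (push_field B F (\<lambda>q. J q (V q)) p) =
        g' (F p) (nablaF Y (push_field B F (C X)) p) (push (J p (V p))) - g' (F p) (nablaF X (push_field B F (C Y)) p) (push (J p (V p)))"
      using N.g_diff_left[OF sec_tangent[OF nablaF_section[OF vY sec_push[OF vC[OF X]]]]
          sec_tangent[OF nablaF_section[OF vX sec_push[OF vC[OF Y]]]] push_tangent[OF Hor_tangent[OF hJV]]]
      by (simp add: push_field_def[of B F "\<lambda>q. J q (V q)"])
    show "g p (nabla X Y p) (V p) = g p (AA X (BB Y) p) (J p (V p))
        + 1 / (lam p)\<^sup>2 * g' (F p) (nablaF X (push_field B F (C Y)) p) (push (J p (V p)))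
        - g p (H p) (C Y p) * g p (X p) (J p (V p)) + g p (H p) (J p (V p)) * g p (X p) (C Y p)"
      unfolding AA_def BB_def C_def H_def by (rule g_nabla_vertical[OF X Y V])
    show "g p (nabla Y X p) (V p) = g p (AA Y (BB X) p) (J p (V p))
        + 1 / (lam p)\<^sup>2 * g' (F p) (nablaF Y (push_field B F (C X)) p) (push (J p (V p)))
        - g p (H p) (C X p) * g p (Y p) (J p (V p)) + g p (H p) (J p (V p)) * g p (Y p) (C X p)"
      unfolding AA_def BB_def C_def H_def by (rule g_nabla_vertical[OF Y X V])
    show "g p (X p) (C Y p) = - g p (Y p) (C X p)" using XCY YCX by simp
    show "g p (Y p) (C X p) = g p (C X p) (Y p)" by (rule YCX)
  qed
qed

text \<open>Every vertical vector is a value of a vertical field.\<close>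

lemma involutive_iff: "involutive \<longleftrightarrow> (\<forall>X Y V. section_of A Hor X \<longrightarrow> section_of A Hor Y \<longrightarrow>
  section_of A Ver V \<longrightarrow> (\<forall>p. g p (lie_bracket X Y p) (V p) = 0))"
proof (intro iffI)
  assume "involutive"
  then show "\<forall>X Y V. section_of A Hor X \<longrightarrow> section_of A Hor Y \<longrightarrow> section_of A Ver V \<longrightarrow> (\<forall>p. g p (lie_bracket X Y p) (V p) = 0)"
    using Hor_Ver_orthogonal unfolding involutive_def section_of_def by blast
next
  assume *: "\<forall>X Y V. section_of A Hor X \<longrightarrow> section_of A Hor Y \<longrightarrow> section_of A Ver V \<longrightarrow> (\<forall>p. g p (lie_bracket X Y p) (V p) = 0)"
  show involutive
    unfolding involutive_def
  proof (intro allI impI)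
    fix X Y p assume X: "section_of A Hor X" and Y: "section_of A Hor Y"
    have "lie_bracket X Y p \<in> M.T p"
      using M.vector_field_tangent[OF M.vector_field_lie_bracket] X Y by (simp add: section_of_def)
    moreover have "g p (lie_bracket X Y p) w = 0" if w: "w \<in> Ver p" for w
    proof -
      obtain V where "section_of A Ver V" "V p = w" using vertical_extends[OF w] by blast
      then show ?thesis using * X Y by blast
    qed
    ultimately show "lie_bracket X Y p \<in> Hor p" by (simp add: hor_def)
  qed
qed

end


section \<open>Integrable horizontal distributions are involutive\<close>

lemma frechet_derivative_sum_mult:
  fixes f h :: "'i \<Rightarrow> 'a::euclidean_space \<Rightarrow> real"
  assumes "\<And>i. i \<in> I \<Longrightarrow> smooth_on S (f i)" "\<And>i. i \<in> I \<Longrightarrow> smooth_on S (h i)" "x \<in> S"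
  shows "frechet_derivative (\<lambda>x. \<Sum>i\<in>I. f i x * h i x) (at x) v =
    (\<Sum>i\<in>I. f i x * frechet_derivative (h i) (at x) v + frechet_derivative (f i) (at x) v * h i x)"
proof -
  have D: "((\<lambda>x. \<Sum>i\<in>I. f i x * h i x) has_derivative
      (\<lambda>v. \<Sum>i\<in>I. f i x * frechet_derivative (h i) (at x) v + frechet_derivative (f i) (at x) v * h i x)) (at x)"
    by (rule has_derivative_sum, rule has_derivative_mult; rule smooth_on_has_derivative[OF _ assms(3)])
      (use assms in auto)
  show ?thesis by (simp only: frechet_derivative_at[OF D, symmetric])
qed

lemma (in manifold) smooth_on_comp_immersion:
  assumes imm: "injective_immersion_on A W \<phi>" and f: "smooth_fun A f"
  shows "smooth_on W (f \<circ> \<phi>)"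
proof (rule smooth_on_local)
  fix x assume x: "x \<in> W"
  obtain U \<chi>' where c: "(U, \<chi>') \<in> A" "\<phi> x \<in> U" using chart_at by blast
  have W: "open W" "continuous_on W \<phi>" using imm by (auto simp: injective_immersion_on_def)
  let ?T = "W \<inter> \<phi> -` U"
  have T: "open ?T" by (rule continuous_open_preimage[OF W(2,1) open_domain[OF c(1)]])
  have "\<forall>(V, \<psi>)\<in>A. smooth_on (W \<inter> \<phi> -` V) (\<psi> \<circ> \<phi>)" using imm by (simp add: injective_immersion_on_def)
  from bspec[OF this c(1)] have s: "smooth_on ?T (\<chi>' \<circ> \<phi>)" by simp
  have "smooth_on ?T (\<lambda>y. (f \<circ> inv_into U \<chi>') ((\<chi>' \<circ> \<phi>) y))"
    by (rule smooth_on_compose[OF T _ s smooth_fun_chart[OF f c(1)]]) auto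
  then have "smooth_on ?T (f \<circ> \<phi>)"
    by (rule smooth_on_cong[OF T, rotated]) (auto simp: chart_inverse[OF c(1)])
  then show "\<exists>T. open T \<and> x \<in> T \<and> smooth_on T (f \<circ> \<phi>)" using T x c(2) by blast
qed

text \<open>A vertical field \<open>V\<close> gives the one-form \<open>\<omega> = g(V, -) = \<Sum> \<omega>\<^sub>i dx\<^sub>i\<close>, which
  annihilates horizontal vectors. Its pullback to an integral manifold vanishes, hence so does the
  pullback of \<open>d\<omega>\<close>, and \<open>d\<omega>(X, Y) = - \<omega>([X, Y])\<close> for horizontal \<open>X\<close> and \<open>Y\<close>.\<close>

lemma (in conformal_submersion) integrable_imp_involutive:
  assumes "integrable_distribution TYPE('k::euclidean_space) A Hor"
  shows involutive
  unfolding involutive_def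
proof (intro allI impI)
  fix X Y p assume X: "section_of A Hor X" and Y: "section_of A Hor Y"
  have vX: "vector_field A X" and vY: "vector_field A Y" and hX: "\<And>q. X q \<in> Hor q" and hY: "\<And>q. Y q \<in> Hor q"
    using X Y by (auto simp: section_of_def)
  note t = M.vector_field_tangent
  obtain W :: "'k set" and \<phi> where imm: "injective_immersion_on A W \<phi>" and "p \<in> \<phi> ` W"
    and range: "\<And>x. x \<in> W \<Longrightarrow> range (param_differential A \<phi> x) = Hor (\<phi> x)"
    using assms unfolding integrable_distribution_def by meson
  then obtain x0 where x0: "x0 \<in> W" "\<phi> x0 = p" by blast
  have W: "open W" "continuous_on W \<phi>" using imm by (auto simp: injective_immersion_on_def)
  have zero: "g p (lie_bracket X Y p) w = 0" if w: "w \<in> Ver p" for w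
  proof -
    obtain V where V: "section_of A Ver V" "V p = w" using vertical_extends[OF w] by blast
    then have vV: "vector_field A V" and verV: "\<And>q. V q \<in> Ver q" by (auto simp: section_of_def)
    obtain \<Omega> x E where fr: "p \<in> \<Omega>" "M.coordinate_frame \<Omega> x E" using M.exists_coordinate_frame by blast
    note vE = M.frame_field[OF fr(2)] and sx = M.frame_smooth[OF fr(2)]
    define \<omega> where "\<omega> = (\<lambda>i q. g q (E i q) (V q))"
    have s\<omega>: "smooth_fun A (\<omega> i)" if "i \<in> Basis" for i
      unfolding \<omega>_def by (rule M.g_smooth[OF vE[OF that] vV])
    have expand: "g q u (V q) = (\<Sum>i\<in>Basis. u (x i) * \<omega> i q)" if "q \<in> \<Omega>" "u \<in> M.T q" for q u
      unfolding \<omega>_def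
      by (subst M.frame_expand[OF fr(2) that], rule M.g_sum_left[OF t[OF vE] t[OF vV]])
    let ?S = "W \<inter> \<phi> -` \<Omega>"
    have S: "open ?S" "x0 \<in> ?S"
      using continuous_open_preimage[OF W(2,1) M.frame_open[OF fr(2)]] x0 fr(1) by auto
    have smooth: "smooth_on ?S (f \<circ> \<phi>)" if "smooth_fun A f" for f
      by (rule smooth_on_subset[OF M.smooth_on_comp_immersion[OF imm that]]) blast
    note sa = smooth[OF sx] and sw = smooth[OF s\<omega>]
    let ?D = "\<lambda>f z v. frechet_derivative (f \<circ> \<phi>) (at z) v"
    have pd: "param_differential A \<phi> z v f = ?D f z v" if "smooth_fun A f" for f z v
      using that by (simp add: param_differential_def)
    have K: "(\<Sum>i\<in>Basis. ?D (x i) z v * (\<omega> i \<circ> \<phi>) z) = 0" if z: "z \<in> ?S" for z v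
    proof -
      have h: "param_differential A \<phi> z v \<in> Hor (\<phi> z)" using range z by blast
      have "0 = g (\<phi> z) (param_differential A \<phi> z v) (V (\<phi> z))"
        using Hor_Ver_orthogonal[OF h verV] by simp
      also have "\<dots> = (\<Sum>i\<in>Basis. param_differential A \<phi> z v (x i) * \<omega> i (\<phi> z))"
        by (rule expand) (use z Hor_tangent[OF h] in auto)
      also have "\<dots> = (\<Sum>i\<in>Basis. ?D (x i) z v * (\<omega> i \<circ> \<phi>) z)"
        by (rule sum.cong[OF refl]) (simp add: pd sx)
      finally show ?thesis by simp
    qed
    have K2: "(\<Sum>i\<in>Basis. ?D (x i) x0 v * ?D (\<omega> i) x0 u
        + frechet_derivative (\<lambda>z. ?D (x i) z v) (at x0) u * \<omega> i p) = 0" for u v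
    proof -
      have "frechet_derivative (\<lambda>z. \<Sum>i\<in>Basis. ?D (x i) z v * (\<omega> i \<circ> \<phi>) z) (at x0) = frechet_derivative (\<lambda>z. 0) (at x0)"
        by (rule frechet_derivative_cong_open[OF S]) (rule K)
      then have "0 = frechet_derivative (\<lambda>z. \<Sum>i\<in>Basis. ?D (x i) z v * (\<omega> i \<circ> \<phi>) z) (at x0) u"
        by (simp only: frechet_derivative_const)
      also have "\<dots> = (\<Sum>i\<in>Basis. ?D (x i) x0 v * ?D (\<omega> i) x0 u
          + frechet_derivative (\<lambda>z. ?D (x i) z v) (at x0) u * (\<omega> i \<circ> \<phi>) x0)"
        by (rule frechet_derivative_sum_mult[OF smooth_on_frechet[OF sa] sw S(2)])
      finally show ?thesis using x0(2) by simp
    qed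
    have closed: "(\<Sum>i\<in>Basis. ?D (x i) x0 v * ?D (\<omega> i) x0 u) = (\<Sum>i\<in>Basis. ?D (x i) x0 u * ?D (\<omega> i) x0 v)" for u v
    proof -
      have "(\<Sum>i\<in>Basis. frechet_derivative (\<lambda>z. ?D (x i) z v) (at x0) u * \<omega> i p) =
          (\<Sum>i\<in>Basis. frechet_derivative (\<lambda>z. ?D (x i) z u) (at x0) v * \<omega> i p)"
        by (rule sum.cong[OF refl]) (simp add: second_derivative_symmetric[OF sa S])
      then show ?thesis using K2[of v u] K2[of u v] by (simp add: sum.distrib)
    qed
    obtain v where v: "X p = param_differential A \<phi> x0 v" using range[OF x0(1)] hX[of p] x0(2) by (metis imageE)
    obtain u where u: "Y p = param_differential A \<phi> x0 u" using range[OF x0(1)] hY[of p] x0(2) by (metis imageE)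
    have sym: "(\<Sum>i\<in>Basis. X p (x i) * Y p (\<omega> i)) = (\<Sum>i\<in>Basis. Y p (x i) * X p (\<omega> i))"
      using closed[of v u] by (simp add: v u pd sx s\<omega> cong: sum.cong)
    have deriv: "(\<Sum>i\<in>Basis. X p (\<lambda>q. Y q (x i)) * \<omega> i p + Y p (x i) * X p (\<omega> i)) = 0"
      if vX: "vector_field A X" and vY: "vector_field A Y" and hY: "\<And>q. Y q \<in> Hor q" for X Y
    proof -
      have sYx: "smooth_fun A (\<lambda>q. Y q (x i))" if "i \<in> Basis" for i
        by (rule M.vector_field_smooth[OF vY sx[OF that]])
      have "0 = X p (\<lambda>q. 0)" by (simp add: M.tangent_const[OF t[OF vX]])
      also have "\<dots> = X p (\<lambda>q. \<Sum>i\<in>Basis. Y q (x i) * \<omega> i q)"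
      proof (rule M.tangent_local[OF t[OF vX] M.frame_open[OF fr(2)] fr(1) _ M.smooth_fun_const])
        show "0 = (\<Sum>i\<in>Basis. Y q (x i) * \<omega> i q)" if "q \<in> \<Omega>" for q
          using expand[OF that t[OF vY]] Hor_Ver_orthogonal[OF hY verV] by simp
        show "smooth_fun A (\<lambda>q. \<Sum>i\<in>Basis. Y q (x i) * \<omega> i q)"
          by (rule M.smooth_fun_sum, rule M.smooth_fun_mult[OF sYx s\<omega>])
      qed
      also have "\<dots> = (\<Sum>i\<in>Basis. X p (\<lambda>q. Y q (x i) * \<omega> i q))"
        by (rule M.tangent_sum[OF t[OF vX] M.smooth_fun_mult[OF sYx s\<omega>]])
      also have "\<dots> = (\<Sum>i\<in>Basis. X p (\<lambda>q. Y q (x i)) * \<omega> i p + Y p (x i) * X p (\<omega> i))"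
        by (rule sum.cong[OF refl]) (simp add: M.tangent_mult[OF t[OF vX] sYx s\<omega>])
      finally show ?thesis by simp
    qed
    have "g p (lie_bracket X Y p) (V p) = (\<Sum>i\<in>Basis. lie_bracket X Y p (x i) * \<omega> i p)"
      by (rule expand[OF fr(1) t[OF M.vector_field_lie_bracket[OF vX vY]]])
    also have "\<dots> = (\<Sum>i\<in>Basis. X p (\<lambda>q. Y q (x i)) * \<omega> i p) - (\<Sum>i\<in>Basis. Y p (\<lambda>q. X q (x i)) * \<omega> i p)"
      by (simp add: lie_bracket_def left_diff_distrib sum_subtractf)
    also have "\<dots> = 0"
      using deriv[OF vX vY hY] deriv[OF vY vX hX] sym by (simp add: sum.distrib)
    finally show ?thesis using V(2) by simp
  qed
  then show "lie_bracket X Y p \<in> Hor p"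
    using t[OF M.vector_field_lie_bracket[OF vX vY]] by (simp add: hor_def)
qed


section \<open>Involutive horizontal distributions are integrable\<close>

context conformal_submersion
begin

lemma g_gradient_comp:
  assumes "smooth_fun B h" "v \<in> M.T q"
  shows "g q (gradient A g (\<lambda>q. h (F q)) q) v = push v h"
  unfolding M.g_gradient[OF assms(2)] pushforward_apply[OF assms(1)] ..

lemma gradient_comp_horizontal:
  assumes "smooth_fun B h"
  shows "gradient A g (\<lambda>q. h (F q)) q \<in> Hor q"
  using M.gradient_tangent g_gradient_comp[OF assms] by (auto simp: hor_def Ver_iff)

lemma push_surj_Hor:
  assumes "w \<in> N.T (F p)"
  obtains v where "v \<in> Hor p" "push v = w"
proof -
  obtain u where u: "u \<in> M.T p" "push u = w" using push_surj[OF assms] by blast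
  note d = decomposition[OF u(1)]
  have "push (orth_proj g p (Ver p) u + orth_proj g p (Hor p) u) = push (orth_proj g p (Hor p) u)"
    using d(2) by (simp only: pushforward_add Ver_iff) simp
  then show ?thesis using that[OF d(1)] d(3) u(2) by simp
qed

text \<open>By conformality both sides have the same inner product with \<open>F\<^sub>*v\<close> for horizontal \<open>v\<close>, and these
  vectors exhaust the tangent space of the base.\<close>

lemma push_gradient_comp:
  assumes h: "smooth_fun B h"
  shows "push (gradient A g (\<lambda>q. h (F q)) p) = (lam p)\<^sup>2 *\<^sub>R gradient B g' h (F p)"
proof (rule N.g_ext)
  let ?u = "gradient A g (\<lambda>q. h (F q)) p"
  show "push ?u \<in> N.T (F p)" by (rule push_tangent[OF M.gradient_tangent])
  show "(lam p)\<^sup>2 *\<^sub>R gradient B g' h (F p) \<in> N.T (F p)" by (rule N.T_scale[OF N.gradient_tangent])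
  fix w assume w: "w \<in> N.T (F p)"
  obtain v where v: "v \<in> Hor p" "push v = w" by (rule push_surj_Hor[OF w])
  have "g' (F p) (push ?u) (push v) = (lam p)\<^sup>2 * push v h"
    unfolding conformal_eq[OF gradient_comp_horizontal[OF h] v(1)] g_gradient_comp[OF h Hor_tangent[OF v(1)]] ..
  then show "g' (F p) (push ?u) w = g' (F p) ((lam p)\<^sup>2 *\<^sub>R gradient B g' h (F p)) w"
    using v w by (simp add: N.g_scale_left[OF N.gradient_tangent] N.g_gradient)
qed

text \<open>The gradients of coordinates form the dual frame, which expresses the coordinate fields by
  gradients and so gives their horizontal lifts.\<close>

definition lift :: "('f \<Rightarrow> 'n \<Rightarrow> real) \<Rightarrow> ('f \<Rightarrow> 'n \<Rightarrow> 'n tvec) \<Rightarrow> 'f \<Rightarrow> 'm \<Rightarrow> 'm tvec" where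
  "lift y E i q = (\<Sum>k\<in>Basis. (inverse ((lam q)\<^sup>2) * g' (F q) (E i (F q)) (E k (F q))) *\<^sub>R gradient A g (\<lambda>r. y k (F r)) q)"

context
  fixes \<Omega> y E assumes frame: "N.coordinate_frame \<Omega> y E"
begin

lemma lift_field: "i \<in> Basis \<Longrightarrow> vector_field A (lift y E i)"
proof -
  assume i: "i \<in> Basis"
  have sq: "smooth_fun A (\<lambda>q. (lam q)\<^sup>2)"
    using M.smooth_fun_mult[OF smooth_lam smooth_lam] by (simp add: power2_eq_square)
  have "smooth_fun A (\<lambda>q. inverse ((lam q)\<^sup>2))"
    by (rule M.smooth_fun_compose[OF sq smooth_on_inverse]) (use lam_pos in \<open>simp add: less_imp_neq[symmetric]\<close>)
  then show ?thesis
    unfolding lift_def[abs_def]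
    by (intro M.vector_field_sum M.vector_field_scale M.smooth_fun_mult smooth_fun_comp_F[OF N.g_smooth]
        M.gradient_field smooth_fun_comp_F[OF N.frame_smooth[OF frame]] N.frame_field[OF frame] i)
qed

lemma lift_horizontal: "lift y E i q \<in> Hor q"
  unfolding lift_def
  by (intro subspace_sum[OF Hor_subspace] subspace_scale[OF Hor_subspace] gradient_comp_horizontal
      N.frame_smooth[OF frame])

lemma push_sum: "push (\<Sum>k\<in>I. c k *\<^sub>R v k) = (\<Sum>k\<in>I. c k *\<^sub>R push (v k))"
proof (induction I rule: infinite_finite_induct)
  case (infinite I)
  show ?case unfolding sum.infinite[OF infinite] by (rule pushforward_zero)
next
  case empty
  show ?case unfolding sum.empty by (rule pushforward_zero)
next
  case (insert x I)
  show ?case unfolding sum.insert[OF insert.hyps] pushforward_add pushforward_scale insert.IH ..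
qed

lemma push_lift:
  assumes i: "i \<in> Basis" and q: "F q \<in> \<Omega>"
  shows "push (lift y E i q) = E i (F q)"
proof -
  note tE = N.vector_field_tangent[OF N.frame_field[OF frame]]
  let ?G = "\<lambda>k. gradient B g' (y k) (F q)"
  have l: "(lam q)\<^sup>2 \<noteq> 0" using lam_pos[of q] by simp
  have "push (lift y E i q) = (\<Sum>k\<in>Basis. g' (F q) (E i (F q)) (E k (F q)) *\<^sub>R ?G k)"
    unfolding lift_def push_sum
  proof (rule sum.cong[OF refl])
    fix k :: 'f assume "k \<in> Basis"
    then show "(inverse ((lam q)\<^sup>2) * g' (F q) (E i (F q)) (E k (F q))) *\<^sub>R push (gradient A g (\<lambda>r. y k (F r)) q) =
        g' (F q) (E i (F q)) (E k (F q)) *\<^sub>R ?G k"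
      using l by (simp add: push_gradient_comp[OF N.frame_smooth[OF frame]])
  qed
  also have "\<dots> = E i (F q)"
  proof (rule N.g_ext)
    show "(\<Sum>k\<in>Basis. g' (F q) (E i (F q)) (E k (F q)) *\<^sub>R ?G k) \<in> N.T (F q)"
      by (intro N.T_sum N.T_scale N.gradient_tangent)
    show "E i (F q) \<in> N.T (F q)" by (rule tE[OF i])
    fix w assume w: "w \<in> N.T (F q)"
    have "g' (F q) (\<Sum>k\<in>Basis. g' (F q) (E i (F q)) (E k (F q)) *\<^sub>R ?G k) w =
        (\<Sum>k\<in>Basis. g' (F q) (E i (F q)) (E k (F q)) * g' (F q) (?G k) w)"
      by (rule N.g_sum_left[OF N.gradient_tangent w])
    also have "\<dots> = (\<Sum>k\<in>Basis. w (y k) * g' (F q) (E k (F q)) (E i (F q)))"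
      by (rule sum.cong[OF refl]) (simp add: N.g_gradient[OF w] N.g_sym[OF tE[OF i] tE])
    also have "\<dots> = g' (F q) (\<Sum>k\<in>Basis. w (y k) *\<^sub>R E k (F q)) (E i (F q))"
      by (rule N.g_sum_left[OF tE tE[OF i], symmetric])
    also have "\<dots> = g' (F q) w (E i (F q))"
      using N.frame_expand[OF frame q w] by simp
    also have "\<dots> = g' (F q) (E i (F q)) w" by (rule N.g_sym[OF w tE[OF i]])
    finally show "g' (F q) (\<Sum>k\<in>Basis. g' (F q) (E i (F q)) (E k (F q)) *\<^sub>R ?G k) w = g' (F q) (E i (F q)) w" .
  qed
  finally show ?thesis .
qed

lemma lift_coordinates:
  assumes "i \<in> Basis" "j \<in> Basis" "F q \<in> \<Omega>"
  shows "lift y E i q (\<lambda>r. y j (F r)) = (if i = j then 1 else 0)"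
  using fun_cong[OF push_lift[OF assms(1,3)], of "y j"]
  by (simp add: pushforward_apply[OF N.frame_smooth[OF frame assms(2)]] N.frame_dual[OF frame assms(3,1,2)])

text \<open>The bracket of two such lifts is horizontal by involutivity, and vertical since the lifts
  have constant coordinates on the base.\<close>

lemma lift_bracket:
  assumes inv: involutive and i: "i \<in> Basis" and j: "j \<in> Basis" and q: "F q \<in> \<Omega>"
  shows "lie_bracket (lift y E i) (lift y E j) q = 0"
proof (rule Hor_Ver_zero)
  note t = M.vector_field_tangent[OF lift_field]
  have "section_of A Hor (lift y E i)" if "i \<in> Basis" for i
    using lift_field[OF that] lift_horizontal by (simp add: section_of_def)
  then show "lie_bracket (lift y E i) (lift y E j) q \<in> Hor q"
    using inv i j by (simp add: involutive_def)
  have T: "lie_bracket (lift y E i) (lift y E j) q \<in> M.T q"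
    by (rule M.vector_field_tangent[OF M.vector_field_lie_bracket[OF lift_field[OF i] lift_field[OF j]]])
  have "push (lie_bracket (lift y E i) (lift y E j) q) = 0"
  proof (rule N.frame_ext[OF frame q push_tangent[OF T] N.T_zero])
    fix k :: 'f assume k: "k \<in> Basis"
    have sk: "smooth_fun A (\<lambda>r. y k (F r))" by (rule smooth_fun_comp_F[OF N.frame_smooth[OF frame k]])
    have z: "lift y E i q (\<lambda>q. lift y E j q (\<lambda>r. y k (F r))) = 0" if "i \<in> Basis" "j \<in> Basis" for i j
    proof -
      have "lift y E i q (\<lambda>q. lift y E j q (\<lambda>r. y k (F r))) = lift y E i q (\<lambda>q. if j = k then 1 else 0)"
        by (rule M.tangent_local[OF t[OF that(1)] open_preimage_F[OF N.frame_open[OF frame]] _ _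
              M.vector_field_smooth[OF lift_field[OF that(2)] sk] M.smooth_fun_const])
          (use q lift_coordinates[OF that(2) k] in auto)
      then show ?thesis by (simp only: M.tangent_const[OF t[OF that(1)]])
    qed
    show "push (lie_bracket (lift y E i) (lift y E j) q) (y k) = 0 (y k)"
      using z[OF i j] z[OF j i] by (simp add: pushforward_apply[OF N.frame_smooth[OF frame k]] lie_bracket_def)
  qed
  then show "lie_bracket (lift y E i) (lift y E j) q \<in> Ver q" using T by (simp add: Ver_iff)
qed

lemma lift_span:
  assumes q: "F q \<in> \<Omega>"
  shows "range (\<lambda>h. \<Sum>i\<in>Basis. (h \<bullet> i) *\<^sub>R lift y E i q) = Hor q"
proof (intro subset_antisym subsetI)
  fix u assume "u \<in> range (\<lambda>h. \<Sum>i\<in>Basis. (h \<bullet> i) *\<^sub>R lift y E i q)"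
  then show "u \<in> Hor q"
    using lift_horizontal by (auto intro!: subspace_sum[OF Hor_subspace] subspace_scale[OF Hor_subspace])
next
  fix u assume u: "u \<in> Hor q"
  let ?h = "\<Sum>j\<in>Basis. push u (y j) *\<^sub>R j"
  let ?w = "\<Sum>i\<in>Basis. (?h \<bullet> i) *\<^sub>R lift y E i q"
  have w: "?w \<in> Hor q"
    using lift_horizontal by (auto intro!: subspace_sum[OF Hor_subspace] subspace_scale[OF Hor_subspace])
  have "push ?w = (\<Sum>i\<in>Basis. (?h \<bullet> i) *\<^sub>R push (lift y E i q))" by (rule push_sum)
  also have "\<dots> = (\<Sum>i\<in>Basis. push u (y i) *\<^sub>R E i (F q))"
    by (rule sum.cong[OF refl]) (simp add: push_lift[OF _ q])
  also have "\<dots> = push u" using N.frame_expand[OF frame q push_tangent[OF Hor_tangent[OF u]]] by simp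
  finally have p: "push (u - ?w) = 0" by (simp add: pushforward_diff)
  have "u - ?w \<in> Hor q" by (rule subspace_diff[OF Hor_subspace u w])
  moreover from this have "u - ?w \<in> Ver q" using p Hor_tangent by (simp add: Ver_iff)
  ultimately have "u - ?w = 0" by (rule Hor_Ver_zero)
  then have "u = ?w" by simp
  then show "u \<in> range (\<lambda>h. \<Sum>i\<in>Basis. (h \<bullet> i) *\<^sub>R lift y E i q)" by (rule image_eqI) simp
qed

end

text \<open>Near \<open>p\<close> the horizontal lifts \<open>X\<^sub>i\<close> of the coordinate fields on \<open>N\<close> commute and span the horizontal
  spaces. An integral map of their representatives \<open>a i\<close> in a chart parametrizes the integral manifold.\<close>

lemma involutive_imp_integrable:
  assumes inv: involutive
  shows "integrable_distribution TYPE('f) A Hor"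
  unfolding integrable_distribution_def
proof
  fix p
  obtain \<Omega>1 y E where frN: "F p \<in> \<Omega>1" "N.coordinate_frame \<Omega>1 y E" using N.exists_coordinate_frame by blast
  obtain U \<psi> \<Omega>2 x E2 where c: "(U, \<psi>) \<in> A" "p \<in> \<Omega>2" "\<Omega>2 \<subseteq> U" and frM: "M.coordinate_frame \<Omega>2 x E2"
    and xeq: "\<And>i q. i \<in> Basis \<Longrightarrow> q \<in> \<Omega>2 \<Longrightarrow> x i q = \<psi> q \<bullet> i"
    using M.exists_coordinate_frame_chart[of p] by metis
  note inv_chart = M.chart_inverse[OF c(1)] and sx = M.frame_smooth[OF frM]
  let ?inv = "inv_into U \<psi>" and ?X = "lift y E"
  let ?O = "\<Omega>2 \<inter> F -` \<Omega>1" and ?S = "\<psi> ` (\<Omega>2 \<inter> F -` \<Omega>1)"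
  have O: "open ?O" "p \<in> ?O" "?O \<subseteq> U"
    using M.frame_open[OF frM] open_preimage_F[OF N.frame_open[OF frN(2)]] c frN(1) by auto
  have S: "open ?S" by (rule M.chart_image_open[OF c(1) O(1,3)])
  have Sinv: "?inv z \<in> ?O" "\<psi> (?inv z) = z" if "z \<in> ?S" for z
    using that O(3) inv_chart by auto
  note vX = lift_field[OF frN(2)]
  note tX = M.vector_field_tangent[OF vX]
  define a where "a = (\<lambda>i z. \<Sum>b\<in>Basis. ?X i (?inv z) (x b) *\<^sub>R b)"
  have sXx: "smooth_fun A (\<lambda>q. ?X i q (x b))" if "i \<in> Basis" "b \<in> Basis" for i b
    by (rule M.vector_field_smooth[OF vX[OF that(1)] sx[OF that(2)]])
  have s_chart: "smooth_on ?S (f \<circ> ?inv)" if "smooth_fun A f" for f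
    by (rule smooth_on_subset[OF M.smooth_fun_chart[OF that c(1)]]) (use O(3) in blast)
  have sa: "smooth_on ?S (a i)" if "i \<in> Basis" for i
    unfolding a_def
    by (rule smooth_on_sum[OF S], rule smooth_on_scaleR[OF S s_chart[OF sXx[OF that], unfolded comp_def] smooth_on_const[OF S]])
  have a_inner: "a i z \<bullet> b = ?X i (?inv z) (x b)" if "b \<in> Basis" for i z b
    using that by (simp add: a_def inner_sum_left inner_Basis sum_kronecker)
  have lin: "linear (frechet_derivative (f \<circ> ?inv) (at z))" if "smooth_fun A f" "z \<in> ?S" for f z
    by (rule has_derivative_linear[OF smooth_on_has_derivative[OF s_chart[OF that(1)] that(2)]])
  \<comment> \<open>The map \<open>a i\<close> represents the field \<open>X\<^sub>i\<close> in the chart.\<close>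
  have Xf: "frechet_derivative (f \<circ> ?inv) (at z) (a i z) = ?X i (?inv z) f"
    if i: "i \<in> Basis" and f: "smooth_fun A f" and z: "z \<in> ?S" for i f z
  proof -
    have q: "?inv z \<in> \<Omega>2" "\<psi> (?inv z) = z" using Sinv[OF z] by auto
    have "?X i (?inv z) f = (\<Sum>b\<in>Basis. ?X i (?inv z) (x b) * frechet_derivative (f \<circ> ?inv) (at (\<psi> (?inv z))) b)"
      by (rule M.tangent_eq_sum_partials[OF c(1) M.frame_open[OF frM] c(3) q(1) sx xeq tX[OF i] f])
    then show ?thesis
      unfolding a_def q(2) using lin[OF f z] by (simp add: linear_sum linear_cmul)
  qed
  have commute: "frechet_derivative (a i) (at z) (a j z) = frechet_derivative (a j) (at z) (a i z)"
    if i: "i \<in> Basis" and j: "j \<in> Basis" and z: "z \<in> ?S" for i j z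
  proof (rule euclidean_eqI)
    fix b :: 'e assume b: "b \<in> Basis"
    have D: "frechet_derivative (a i) (at z) w \<bullet> b = frechet_derivative ((\<lambda>q. ?X i q (x b)) \<circ> ?inv) (at z) w"
      if "i \<in> Basis" for i w
    proof -
      have "((\<lambda>z. a i z \<bullet> b) has_derivative (\<lambda>w. frechet_derivative (a i) (at z) w \<bullet> b)) (at z)"
        by (rule has_derivative_inner_left[OF smooth_on_has_derivative[OF sa[OF that] z]])
      then have "((\<lambda>q. ?X i q (x b)) \<circ> ?inv has_derivative (\<lambda>w. frechet_derivative (a i) (at z) w \<bullet> b)) (at z)"
        by (simp add: a_inner[OF b] comp_def)
      from frechet_derivative_at[OF this] show ?thesis by (rule fun_cong)
    qed
    have q: "F (?inv z) \<in> \<Omega>1" using Sinv(1)[OF z] by simp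
    have "?X j (?inv z) (\<lambda>q. ?X i q (x b)) = ?X i (?inv z) (\<lambda>q. ?X j q (x b))"
      using fun_cong[OF lift_bracket[OF frN(2) inv j i q], of "x b"] by (simp add: lie_bracket_def)
    then show "frechet_derivative (a i) (at z) (a j z) \<bullet> b = frechet_derivative (a j) (at z) (a i z) \<bullet> b"
      unfolding D[OF i] D[OF j] Xf[OF j sXx[OF i b] z] Xf[OF i sXx[OF j b] z] .
  qed
  have "\<psi> p \<in> ?S" using O(2) by blast
  from commuting_fields_integral_map[of ?S "\<psi> p" a, OF S this sa commute]
  obtain r \<phi> where r: "r > 0" "\<phi> 0 = \<psi> p" "smooth_on (ball 0 r) \<phi>"
    and \<phi>: "\<And>z. z \<in> ball 0 r \<Longrightarrow> \<phi> z \<in> ?S"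
      "\<And>z. z \<in> ball 0 r \<Longrightarrow> (\<phi> has_derivative (\<lambda>h. \<Sum>i\<in>Basis. (h \<bullet> i) *\<^sub>R a i (\<phi> z))) (at z)"
    by blast
  define \<Phi> where "\<Phi> = (\<lambda>z. ?inv (\<phi> z))"
  let ?W = "ball (0::'f) r"
  have \<Phi>O: "\<Phi> z \<in> ?O" if "z \<in> ?W" for z unfolding \<Phi>_def by (rule Sinv(1)[OF \<phi>(1)[OF that]])
  have cont: "continuous_on ?W \<Phi>"
    unfolding \<Phi>_def
    by (rule continuous_on_compose2[OF M.chart_inv_continuous[OF c(1)] smooth_on_continuous[OF r(3)]]) (use \<phi>(1) O(3) in blast)
  have der: "((f \<circ> \<Phi>) has_derivative (\<lambda>h. \<Sum>i\<in>Basis. (h \<bullet> i) * ?X i (\<Phi> z) f)) (at z)"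
    if f: "smooth_fun A f" and z: "z \<in> ?W" for f z
  proof -
    note S' = \<phi>(1)[OF z]
    have "((\<lambda>z. (f \<circ> ?inv) (\<phi> z)) has_derivative
      (\<lambda>h. frechet_derivative (f \<circ> ?inv) (at (\<phi> z)) (\<Sum>i\<in>Basis. (h \<bullet> i) *\<^sub>R a i (\<phi> z)))) (at z)"
      by (rule has_derivative_compose[OF \<phi>(2)[OF z] smooth_on_has_derivative[OF s_chart[OF f] S']])
    moreover have "frechet_derivative (f \<circ> ?inv) (at (\<phi> z)) (\<Sum>i\<in>Basis. (h \<bullet> i) *\<^sub>R a i (\<phi> z)) =
        (\<Sum>i\<in>Basis. (h \<bullet> i) * ?X i (\<Phi> z) f)" for h
      using lin[OF f S'] by (simp add: linear_sum linear_cmul Xf[OF _ f S'] \<Phi>_def)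
    ultimately show ?thesis by (simp add: \<Phi>_def comp_def)
  qed
  have pd: "param_differential A \<Phi> z h = (\<Sum>i\<in>Basis. (h \<bullet> i) *\<^sub>R ?X i (\<Phi> z))" if z: "z \<in> ?W" for z h
  proof
    fix f
    show "param_differential A \<Phi> z h f = (\<Sum>i\<in>Basis. (h \<bullet> i) *\<^sub>R ?X i (\<Phi> z)) f"
    proof (cases "smooth_fun A f")
      case True
      show ?thesis
        using fun_cong[OF frechet_derivative_at[OF der[OF True z]], of h] True
        by (simp add: param_differential_def sum_fun_apply scaleR_fun_apply)
    next
      case False
      then show ?thesis
        using M.tangent_nonsmooth[OF tX False] by (simp add: param_differential_def sum_fun_apply scaleR_fun_apply)
    qed
  qed
  have sy: "smooth_fun A (\<lambda>q. y j (F q))" if "j \<in> Basis" for j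
    by (rule smooth_fun_comp_F[OF N.frame_smooth[OF frN(2) that]])
  have coord: "(\<Sum>i\<in>Basis. (h \<bullet> i) * ?X i (\<Phi> z) (\<lambda>q. y j (F q))) = h \<bullet> j" if "z \<in> ?W" "j \<in> Basis" for z j h
  proof -
    have "(\<Sum>i\<in>Basis. (h \<bullet> i) * ?X i (\<Phi> z) (\<lambda>q. y j (F q))) = (\<Sum>i\<in>Basis. (h \<bullet> i) * (if i = j then 1 else 0))"
      by (rule sum.cong[OF refl]) (use lift_coordinates[OF frN(2) _ that(2)] \<Phi>O[OF that(1)] in simp)
    then show ?thesis by (simp only: sum_kronecker[OF finite_Basis that(2)])
  qed
  \<comment> \<open>In the coordinates of the base the map differs from the identity by a constant.\<close>
  have inj: "inj_on \<Phi> ?W"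
  proof (rule inj_onI)
    fix z z' assume z: "z \<in> ?W" "z' \<in> ?W" "\<Phi> z = \<Phi> z'"
    show "z = z'"
    proof (rule euclidean_eqI)
      fix j :: 'f assume j: "j \<in> Basis"
      let ?k = "\<lambda>z. y j (F (\<Phi> z)) - z \<bullet> j"
      have "(?k has_derivative (\<lambda>h. 0)) (at w within ?W)" if w: "w \<in> ?W" for w
      proof -
        have "((\<lambda>z. y j (F (\<Phi> z))) has_derivative (\<lambda>h. h \<bullet> j)) (at w)"
          using der[OF sy[OF j] w] by (simp add: comp_def coord[OF w j])
        then have "(?k has_derivative (\<lambda>h. h \<bullet> j - h \<bullet> j)) (at w)"
          by (rule has_derivative_diff) (rule bounded_linear_imp_has_derivative[OF bounded_linear_inner_left])
        then show ?thesis by (simp add: has_derivative_at_withinI)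
      qed
      then obtain k where "\<And>w. w \<in> ?W \<Longrightarrow> ?k w = k"
        using has_derivative_zero_constant[OF convex_ball, of 0 r ?k] by blast
      from this[OF z(1)] this[OF z(2)] z(3) show "z \<bullet> j = z' \<bullet> j" by simp
    qed
  qed
  have "inj (param_differential A \<Phi> z)" if z: "z \<in> ?W" for z
  proof (rule injI)
    fix h h' assume eq: "param_differential A \<Phi> z h = param_differential A \<Phi> z h'"
    have "param_differential A \<Phi> z h (\<lambda>q. y j (F q)) = h \<bullet> j" if "j \<in> Basis" for h j
      unfolding pd[OF z] sum_fun_apply scaleR_fun_apply real_scaleR_def by (rule coord[OF z that])
    then show "h = h'" using eq by (metis euclidean_eqI)
  qed
  moreover have "smooth_on (?W \<inter> \<Phi> -` V) (\<psi>' \<circ> \<Phi>)" if V: "(V, \<psi>') \<in> A" for V \<psi>'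
  proof -
    have T: "open (?W \<inter> \<Phi> -` V)" by (rule continuous_open_preimage[OF cont open_ball M.open_domain[OF V]])
    have "smooth_on (?W \<inter> \<Phi> -` V) (\<lambda>z. (\<psi>' \<circ> ?inv) (\<phi> z))"
    proof (rule smooth_on_compose[OF T _ smooth_on_subset[OF r(3)] M.transition_smooth[OF c(1) V]])
      show "\<phi> ` (?W \<inter> \<Phi> -` V) \<subseteq> \<psi> ` (U \<inter> V)"
      proof
        fix w assume "w \<in> \<phi> ` (?W \<inter> \<Phi> -` V)"
        then obtain z where z: "z \<in> ?W" "\<Phi> z \<in> V" "w = \<phi> z" by blast
        then have "w = \<psi> (\<Phi> z)" "\<Phi> z \<in> U" using Sinv[OF \<phi>(1)[OF z(1)]] O(3) by (auto simp: \<Phi>_def)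
        then show "w \<in> \<psi> ` (U \<inter> V)" using z by blast
      qed
    qed blast
    then show ?thesis by (simp add: \<Phi>_def comp_def)
  qed
  ultimately have "injective_immersion_on A ?W \<Phi>"
    unfolding injective_immersion_on_def using cont inj by (auto simp only: open_ball simp_thms split: prod.split)
  moreover have "p \<in> \<Phi> ` ?W"
    using r(1,2) inv_chart[of p] O by (intro image_eqI[of _ _ 0]) (auto simp: \<Phi>_def)
  moreover have "\<forall>z\<in>?W. range (param_differential A \<Phi> z) = Hor (\<Phi> z)"
  proof
    fix z assume z: "z \<in> ?W"
    have "F (\<Phi> z) \<in> \<Omega>1" using \<Phi>O[OF z] by simp
    from lift_span[OF frN(2) this] show "range (param_differential A \<Phi> z) = Hor (\<Phi> z)"
      by (simp add: pd[OF z])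
  qed
  ultimately show "\<exists>(W :: 'f set) \<phi>. injective_immersion_on A W \<phi> \<and> p \<in> \<phi> ` W \<and>
      (\<forall>x\<in>W. range (param_differential A \<phi> x) = Hor (\<phi> x))" by blast
qed

end


section \<open>The characterization of integrability\<close>

theorem theorem3p5:
  fixes AM :: "('m::{t2_space, second_countable_topology}, 'e::euclidean_space) atlas"
    and AN :: "('n::{t2_space, second_countable_topology}, 'f::euclidean_space) atlas"
    and g :: "'m metric" and g' :: "'n metric"
    and J :: "'m \<Rightarrow> 'm tvec \<Rightarrow> 'm tvec"
    and nabla :: "'m conn" and nablaN :: "'n conn"
    and nablaF :: "('m \<Rightarrow> 'm tvec) \<Rightarrow> ('m \<Rightarrow> 'n tvec) \<Rightarrow> 'm \<Rightarrow> 'n tvec"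
    and F :: "'m \<Rightarrow> 'n" and lam :: "'m \<Rightarrow> real"
  assumes "kaehler_manifold AM g nabla J"
    and "riemannian_manifold AN g'"
    and "levi_civita AN g' nablaN"
    and "conformal_anti_invariant_submersion AM g J AN g' F lam"
    and "pullback_connection AM AN F nablaN nablaF"
  shows "integrable_distribution TYPE('f) AM (hor AM g AN F) \<longleftrightarrow>
    (\<forall>X Y V. section_of AM (hor AM g AN F) X \<longrightarrow> section_of AM (hor AM g AN F) Y \<longrightarrow>
       section_of AM (ver AM AN F) V \<longrightarrow>
       (let B = B_part AM g J AN F;
            C = C_part AM g J AN F;
            A = oneill_A AM g nabla AN F;
            Hgrad = hor_part AM g AN F (gradient AM g (\<lambda>q. ln (lam q)));
            JV = (\<lambda>q. J q (V q))
        in \<forall>p. 1 / (lam p)\<^sup>2 *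
             g' (F p)
               ((nablaF Y (push_field AN F (C X)) - nablaF X (push_field AN F (C Y))) p)
               (push_field AN F JV p)
           = g p ((A X (B Y) - A Y (B X)) p) (JV p)
             - g p (Hgrad p) (C Y p) * g p (X p) (JV p)
             + g p (Hgrad p) (C X p) * g p (Y p) (JV p)
             - 2 * g p (C X p) (Y p) * g p (Hgrad p) (JV p)))"
proof -
  have kaehler: "kaehler_manifold AM g nabla J" and lcN: "levi_civita AN g' nablaN"
    and anti: "conformal_anti_invariant_submersion AM g J AN g' F lam"
    and pullback: "pullback_connection AM AN F nablaN nablaF"
    by (fact assms)+
  interpret anti_invariant_submersion AM g AN g' F lam nabla nablaN nablaF J
  proof unfold_locales
    show "smooth_manifold AM" "riemannian_metric AM g" "levi_civita AM g nabla"
      using kaehler by (simp_all add: kaehler_manifold_def riemannian_manifold_def)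
    show "smooth_manifold AN" "riemannian_metric AN g'"
      using assms(2) by (simp_all add: riemannian_manifold_def)
    show "horizontally_conformal AM g AN g' F lam" and "J p ` ver AM AN F p \<subseteq> hor AM g AN F p" for p
      using anti by (simp_all add: conformal_anti_invariant_submersion_def)
  qed (fact kaehler lcN pullback)+
  have involutive: "integrable_distribution TYPE('f) AM (hor AM g AN F) \<longleftrightarrow>
      (\<forall>X Y V. section_of AM Hor X \<longrightarrow> section_of AM Hor Y \<longrightarrow> section_of AM Ver V \<longrightarrow>
        (\<forall>p. g p (lie_bracket X Y p) (V p) = 0))"
    using integrable_imp_involutive involutive_imp_integrable involutive_iff by blast
  have shift: "l = t - u + v - w - q \<Longrightarrow> l = 0 \<longleftrightarrow> q = t - u + v - w" for l t u v w q :: real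
    by auto
  show ?thesis
    unfolding involutive Let_def
    by (intro iff_allI imp_cong refl) (rule shift, rule integrability_identity)
qed

end
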